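(* Let $n\ge2$, $N\ge1$ and let $\alpha_1,\dots,\alpha_N\in(0,\pi]$. Let $G=(V,E)$ be the spherical cap packing graph for the angles $\alpha_1,\dots,\alpha_N$, with weight function $w(x,i)=w(\alpha_i)$. Then the weighted theta prime number $\vartheta'_w(G)$ equals the infimum of $$\max\{f_{ii}(1): i=1,\dots,N\},\qquad f_{ij}(u)=\sum_{k=0}^\infty f_{ij,k}P_k^n(u),$$ taken over all families of real numbers $f_{ij,k}$ ($1\le i,j\le N$, $k\ge0$) with $f_{ij,k}=f_{ji,k}$ and $\sum_{k=0}^\infty|f_{ij,k}|<\infty$ for all $i,j$, such that (i) $\bigl(f_{ij,0}-w(\alpha_i)^{1/2}w(\alpha_j)^{1/2}\bigr)_{i,j=1}^N$ is positive semidefinite; (ii) $\bigl(f_{ij,k}\bigr)_{i,j=1}^N$ is positive semidefinite for every $k\ge1$; (iii) $f_{ij}(u)\le0$ whenever $-1\le u\le\cos(\alpha_i+\alpha_j)$, for all $i,j$.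
   Context: $S^{n-1}$ is the unit sphere in $\mathbb{R}^n$, and $$w(\alpha)=\frac{\omega_{n-1}(S^{n-2})}{\omega_n(S^{n-1})}\int_{\cos\alpha}^1(1-u^2)^{(n-3)/2}\,du,\qquad \omega_n(S^{n-1})=\frac{2\pi^{n/2}}{\Gamma(n/2)},$$ is the normalized volume of a spherical cap of angle $\alpha$. $P_k^n$ is the Jacobi polynomial $P_k^{((n-3)/2,(n-3)/2)}$ of degree $k$ normalized so that $P_k^n(1)=1$. The spherical cap packing graph has vertex set $V=S^{n-1}\times\{1,\dots,N\}$, and two distinct vertices $(x,i)$ and $(y,j)$ are adjacent if $\cos(\alpha_i+\alpha_j)<x\cdot y$. For a graph $G=(V,E)$ with $V$ a compact space and a continuous weight function $w\colon V\to\mathbb{R}_{\ge0}$, a kernel is a real-valued continuous function on $V\times V$; a kernel $K$ is symmetric if $K(x,y)=K(y,x)$ for all $x,y$, and positive if it is symmetric and for all finitely many points $x_1,\dots,x_m\in V$ the matrix $(K(x_i,x_j))_{i,j=1}^m$ is positive semidefinite. The weighted theta prime number $\vartheta'_w(G)$ is the infimum of all $M\in\mathbb{R}$ for which there is a symmetric kernel $K$ such that: the kernel $(x,y)\mapsto K(x,y)-w(x)^{1/2}w(y)^{1/2}$ is positive; $K(x,x)\le M$ for all $x\in V$; and $K(x,y)\le0$ for all $x\ne y$ with $\{x,y\}\notin E$. The infimum of the empty set is $+\infty$. *)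

theory Defs
  imports "HOL-Analysis.Analysis"
begin

definition psd_matrix :: "'i set \<Rightarrow> ('i \<Rightarrow> 'i \<Rightarrow> real) \<Rightarrow> bool" where
  "psd_matrix I A \<longleftrightarrow>
     (\<forall>i\<in>I. \<forall>j\<in>I. A i j = A j i) \<and>
     (\<forall>c :: 'i \<Rightarrow> real. (\<Sum>i\<in>I. \<Sum>j\<in>I. c i * A i j * c j) \<ge> 0)"

definition kernel_on :: "'a::topological_space set \<Rightarrow> ('a \<Rightarrow> 'a \<Rightarrow> real) \<Rightarrow> bool" where
  "kernel_on V K \<longleftrightarrow> continuous_on (V \<times> V) (\<lambda>(x, y). K x y)"

definition symmetric_kernel :: "'a::topological_space set \<Rightarrow> ('a \<Rightarrow> 'a \<Rightarrow> real) \<Rightarrow> bool" where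
  "symmetric_kernel V K \<longleftrightarrow> kernel_on V K \<and> (\<forall>x\<in>V. \<forall>y\<in>V. K x y = K y x)"

definition positive_kernel :: "'a::topological_space set \<Rightarrow> ('a \<Rightarrow> 'a \<Rightarrow> real) \<Rightarrow> bool" where
  "positive_kernel V K \<longleftrightarrow> symmetric_kernel V K \<and>
     (\<forall>(m :: nat) (x :: nat \<Rightarrow> 'a). (\<forall>i\<in>{1..m}. x i \<in> V) \<longrightarrow>
        psd_matrix {1..m} (\<lambda>i j. K (x i) (x j)))"

text \<open>
  A graph is given by its vertex set and its set of edges, an edge being a set of two
  vertices. The definition is meant for compact \<open>V\<close> and a weight \<open>w\<close> that is continuous and
  nonnegative on \<open>V\<close>. The infimum is taken in the extended reals, so that it is
  \<open>\<infinity>\<close> if no \<open>M\<close> is feasible.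
\<close>

definition weighted_theta_prime ::
    "'a::topological_space set \<Rightarrow> 'a set set \<Rightarrow> ('a \<Rightarrow> real) \<Rightarrow> ereal" where
  "weighted_theta_prime V E w =
     Inf {ereal M | M. \<exists>K. symmetric_kernel V K \<and>
       positive_kernel V (\<lambda>x y. K x y - sqrt (w x) * sqrt (w y)) \<and>
       (\<forall>x\<in>V. K x x \<le> M) \<and>
       (\<forall>x\<in>V. \<forall>y\<in>V. x \<noteq> y \<and> {x, y} \<notin> E \<longrightarrow> K x y \<le> 0)}"

definition sphere_area :: "nat \<Rightarrow> real" where
  "sphere_area n = 2 * pi powr (real n / 2) / Gamma (real n / 2)"

definition cap_volume :: "nat \<Rightarrow> real \<Rightarrow> real" where
  "cap_volume n a = sphere_area (n - 1) / sphere_area n *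
     integral {cos a..1} (\<lambda>u. (1 - u\<^sup>2) powr ((real n - 3) / 2))"

text \<open>
  The Jacobi polynomial \<open>P\<^sub>k\<^bsup>(a,b)\<^esup>\<close> in its standard normalization, by the explicit
  formula obtained from Rodrigues' formula with the Leibniz rule.
\<close>

definition jacobi :: "real \<Rightarrow> real \<Rightarrow> nat \<Rightarrow> real \<Rightarrow> real" where
  "jacobi a b k u =
     (\<Sum>s\<le>k. ((real k + a) gchoose (k - s)) * ((real k + b) gchoose s) *
        ((u - 1) / 2) ^ s * ((u + 1) / 2) ^ (k - s))"

definition sphere_poly :: "nat \<Rightarrow> nat \<Rightarrow> real \<Rightarrow> real" where
  "sphere_poly n k u =
     jacobi ((real n - 3) / 2) ((real n - 3) / 2) k u /
     jacobi ((real n - 3) / 2) ((real n - 3) / 2) k 1"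

text \<open>
  The spherical cap packing graph in \<open>\<real>\<^sup>n\<close>, where \<open>n = CARD('n)\<close>. The topology of
  the type \<^typ>\<open>nat\<close> is discrete, so the vertex set carries the topology of a disjoint
  union of \<open>N\<close> spheres.
\<close>

definition cap_vertices :: "nat \<Rightarrow> ((real ^ 'n::finite) \<times> nat) set" where
  "cap_vertices N = sphere 0 1 \<times> {1..N}"

definition cap_edges :: "nat \<Rightarrow> (nat \<Rightarrow> real) \<Rightarrow> ((real ^ 'n::finite) \<times> nat) set set" where
  "cap_edges N \<alpha> =
     {{(x, i), (y, j)} | x i y j. (x, i) \<in> cap_vertices N \<and> (y, j) \<in> cap_vertices N \<and>
        (x, i) \<noteq> (y, j) \<and> cos (\<alpha> i + \<alpha> j) < x \<bullet> y}"

definition cap_weight :: "(nat \<Rightarrow> real) \<Rightarrow> (real ^ 'n::finite) \<times> nat \<Rightarrow> real" where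
  "cap_weight \<alpha> = (\<lambda>(x, i). cap_volume CARD('n) (\<alpha> i))"

definition sphere_series :: "nat \<Rightarrow> (nat \<Rightarrow> real) \<Rightarrow> real \<Rightarrow> real" where
  "sphere_series n c u = (\<Sum>k. c k * sphere_poly n k u)"

text \<open>Here \<open>f i j k\<close> is the coefficient \<open>f\<^bsub>ij,k\<^esub>\<close>.\<close>

definition cap_feasible :: "nat \<Rightarrow> nat \<Rightarrow> (nat \<Rightarrow> real) \<Rightarrow> (nat \<Rightarrow> nat \<Rightarrow> nat \<Rightarrow> real) \<Rightarrow> bool" where
  "cap_feasible n N \<alpha> f \<longleftrightarrow>
     (\<forall>i\<in>{1..N}. \<forall>j\<in>{1..N}. (\<forall>k. f i j k = f j i k) \<and> summable (\<lambda>k. \<bar>f i j k\<bar>)) \<and>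
     psd_matrix {1..N}
       (\<lambda>i j. f i j 0 - sqrt (cap_volume n (\<alpha> i)) * sqrt (cap_volume n (\<alpha> j))) \<and>
     (\<forall>k\<ge>1. psd_matrix {1..N} (\<lambda>i j. f i j k)) \<and>
     (\<forall>i\<in>{1..N}. \<forall>j\<in>{1..N}. \<forall>u. -1 \<le> u \<and> u \<le> cos (\<alpha> i + \<alpha> j) \<longrightarrow>
        sphere_series n (f i j) u \<le> 0)"

end

theory Submission
  imports Defs "HOL-Probability.Probability" "HOL-Computational_Algebra.Polynomial"
begin

text \<open>
  Positive definite kernels on the sphere are expanded in zonal polynomials. The uniform
  measure on the sphere is invariant under reflections, so convolution of zonal polynomials
  \<open>p(x \<bullet> z)\<close>, \<open>q(y \<bullet> z)\<close> over \<open>z\<close> is again zonal and does not raise degrees; hence the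
  orthogonal polynomials \<open>P\<^sub>k\<close> reproduce themselves, which makes \<open>P\<^sub>k(x \<bullet> y)\<close> positive
  definite. A feasible family \<open>f\<close> thus gives the kernel \<open>f\<^bsub>ij\<^esub>(x \<bullet> y)\<close>.

  Conversely the coefficients of a feasible kernel \<open>K\<close> are its averages against \<open>P\<^sub>k\<close>, so no
  averaging over the orthogonal group is needed: testing against \<open>((1 + u) / 2)\<^sup>m\<close> shows that
  they sum to at most the diagonal bound, and testing against polynomials concentrated at
  \<open>u\<close> transfers the sign conditions from \<open>K\<close> to the resulting series.
\<close>

subsection \<open>Gegenbauer polynomials\<close>

text \<open>The difficulty is that a feasible kernel is only continuous: no expansion of it in zonal
  polynomials is known to converge, and an average against P_k says nothing pointwise. Both gaps are
  closed by test polynomials b^m, where b has maximum 1 on [-1, 1], attained at a single point.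
  Averages against them involve finitely many coefficients, and for large m they see only pairs with
  x . y near that point. For the bound the point is 1, where every P_k equals 1, so that positivity
  yields summability for the diagonal blocks; the principal 2 x 2 submatrices of the coefficient
  matrices carry it to the other blocks. Orthogonality is not read off from the density (1 -
  u^2)^((n - 3) / 2) of x . y, which is unbounded for n = 2. Its integration by parts is replaced by
  a recursion for moments, obtained by rotating in a plane, so that all n >= 2 are treated alike.
  The polynomials are given by an explicit sum, hence their differential equation is derived from
  that sum.\<close>

definition jacobi_coeff :: "real \<Rightarrow> nat \<Rightarrow> nat \<Rightarrow> real" where
  "jacobi_coeff a k s = ((real k + a) gchoose (k - s)) * ((real k + a) gchoose s)"

text \<open>With v = (u - 1) / 2 and w = (u + 1) / 2 these are the products v^s w^r. They suit the
  differential operator because v + w = u and -4 v w = 1 - u^2 are its coefficients.\<close>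

definition ultra_term :: "nat \<Rightarrow> nat \<Rightarrow> real poly" where
  "ultra_term s r = [:- 1 / 2, 1 / 2:] ^ s * [:1 / 2, 1 / 2:] ^ r"

definition ultra_poly :: "real \<Rightarrow> nat \<Rightarrow> real poly" where
  "ultra_poly a k = (\<Sum>s\<le>k. smult (jacobi_coeff a k s) (ultra_term s (k - s)))"

text \<open>The Gegenbauer operator. For a = (n - 3) / 2 it is the Laplace-Beltrami operator of the
  unit sphere in n-space, acting on functions of u = x . e.\<close>

definition ultra_op :: "real \<Rightarrow> real poly \<Rightarrow> real poly" where
  "ultra_op a p = [:1, 0, -1:] * pderiv (pderiv p) - smult (2 * a + 2) ([:0, 1:] * pderiv p)"

lemma poly_ultra_poly: "poly (ultra_poly a k) u = jacobi a a k u"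
  by (simp add: ultra_poly_def jacobi_def jacobi_coeff_def ultra_term_def poly_sum mult.assoc
      diff_divide_distrib add_divide_distrib add.commute)

text \<open>Every factor k + a - i of the binomial coefficients has i < k, hence is at least 1 + a.
  Positivity is what excludes cancellation in the leading coefficient and in the value at 1; the
  case n = 2 needs it at a = -1/2.\<close>

lemma jacobi_coeff_pos:
  assumes "a > -1" "s \<le> k"
  shows "jacobi_coeff a k s > 0"
proof -
  have "((real k + a) gchoose t) > 0" if "t \<le> k" for t
  proof -
    have "real k + a - real i > 0" if "i \<in> {0..<t}" for i
    proof -
      have "real i + 1 \<le> real k" using that \<open>t \<le> k\<close> by auto
      thus ?thesis using assms by linarith
    qed
    thus ?thesis by (auto simp: gbinomial_prod_rev intro!: divide_pos_pos prod_pos)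
  qed
  thus ?thesis using assms by (simp add: jacobi_coeff_def)
qed

text \<open>The ratio of neighbouring coefficients, cleared of denominators. In this form it cancels
  the mixed terms when the operator is applied to the whole sum.\<close>

lemma jacobi_coeff_rec:
  assumes "s < k"
  shows "jacobi_coeff a k (Suc s) * (real (Suc s) * (real (Suc s) + a)) =
         jacobi_coeff a k s * (real (k - s) * (real (k - s) + a))"
proof -
  define r where "r = k - Suc s"
  have r: "k - s = Suc r" "k - Suc s = r" "k = Suc (r + s)" using assms by (auto simp: r_def)
  define z where "z = real k + a"
  have g: "real (Suc t) * (z gchoose Suc t) = (z - real t) * (z gchoose t)" for t
    using gbinomial_mult_1[of z t] by (simp add: algebra_simps)
  have 1: "z - real s = real (Suc r) + a" "z - real r = real (Suc s) + a"
    using r(3) by (simp_all add: z_def)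
  have "jacobi_coeff a k (Suc s) * (real (Suc s) * (real (Suc s) + a)) =
      (z gchoose r) * (real (Suc s) + a) * (real (Suc s) * (z gchoose Suc s))"
    by (simp add: jacobi_coeff_def r(2) z_def)
  also have "\<dots> = (z - real r) * (z gchoose r) * ((z - real s) * (z gchoose s))"
    by (simp only: g 1 mult_ac)
  also have "\<dots> = real (Suc r) * (z gchoose Suc r) * ((real (Suc r) + a) * (z gchoose s))"
    by (simp only: g 1)
  also have "\<dots> = jacobi_coeff a k s * (real (k - s) * (real (k - s) + a))"
    by (simp add: jacobi_coeff_def r(1) z_def)
  finally show ?thesis .
qed

text \<open>Both bases v and w have derivative 1/2, so the operator reproduces the product and
  exchanges one factor between v and w. Where s - 1 or r - 1 is truncated, the coefficient s (s + a)
  or r (r + a) vanishes.\<close>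

lemma ultra_op_ultra_term:
  "ultra_op a (ultra_term s r) =
     - smult (real s * (real s + a)) (ultra_term (s - 1) (r + 1))
     - smult (real r * (real r + a)) (ultra_term (s + 1) (r - 1))
     - smult (2 * real s * real r + (a + 1) * (real s + real r)) (ultra_term s r)"
proof -
  let ?v = "[:- 1 / 2, 1 / 2:] :: real poly" and ?w = "[:1 / 2, 1 / 2:] :: real poly"
  have dv: "pderiv (?v ^ m) = smult (real m / 2) (?v ^ (m - 1))" for m
    by (cases m) (simp_all add: pderiv_power_Suc pderiv_pCons smult_add_left[symmetric] field_simps del: power_Suc)
  have dw: "pderiv (?w ^ m) = smult (real m / 2) (?w ^ (m - 1))" for m
    by (cases m) (simp_all add: pderiv_power_Suc pderiv_pCons smult_add_left[symmetric] field_simps del: power_Suc)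
  \<comment> \<open>Multiplying by the base restores the exponent lowered by a derivative; the
    numerical factors vanish exactly when the natural subtraction is truncated.\<close>
  have one: "y * (real m / 2 * y ^ (m - 1)) = real m / 2 * y ^ m" for m and y :: real
    by (cases m) simp_all
  have two: "y * (real m / 2 * (real (m - 1) / 2 * y ^ (m - 1 - 1))) =
      (real m - 1) / 2 * (real m / 2 * y ^ (m - 1))" for m and y :: real
  proof (cases m)
    case (Suc m')
    thus ?thesis by (cases m') simp_all
  qed simp
  have "poly (ultra_op a (ultra_term s r)) x = poly (- smult (real s * (real s + a)) (ultra_term (s - 1) (r + 1))
     - smult (real r * (real r + a)) (ultra_term (s + 1) (r - 1))
     - smult (2 * real s * real r + (a + 1) * (real s + real r)) (ultra_term s r)) x" for x
  proof -
    define v w where "v = poly ?v x" and "w = poly ?w x"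
    have q: "poly [:1, 0, -1:] x = - 4 * v * w" "poly [:0, 1:] x = v + w"
      by (simp_all add: v_def w_def field_simps)
    define V1 W1 V2 W2 where "V1 = real s / 2 * v ^ (s - 1)" and "W1 = real r / 2 * w ^ (r - 1)"
      and "V2 = real s / 2 * (real (s - 1) / 2 * v ^ (s - 1 - 1))"
      and "W2 = real r / 2 * (real (r - 1) / 2 * w ^ (r - 1 - 1))"
    have e: "v * V1 = real s / 2 * v ^ s" "w * W1 = real r / 2 * w ^ r"
      "v * V2 = (real s - 1) / 2 * V1" "w * W2 = (real r - 1) / 2 * W1"
      unfolding V1_def W1_def V2_def W2_def by (rule one two)+
    have "poly (ultra_op a (ultra_term s r)) x =
      - 4 * v * w * (V2 * w ^ r + 2 * V1 * W1 + v ^ s * W2)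
      - (2 * a + 2) * ((v + w) * (V1 * w ^ r + v ^ s * W1))"
      unfolding ultra_op_def ultra_term_def pderiv_mult pderiv_add dv dw pderiv_smult poly_add
        poly_diff poly_mult poly_smult poly_power q v_def[symmetric] w_def[symmetric]
      by (simp add: V1_def V2_def W1_def W2_def algebra_simps)
    also have "\<dots> = - 4 * ((v * V2) * (w * w ^ r) + 2 * (v * V1) * (w * W1) + (v * v ^ s) * (w * W2))
      - (2 * a + 2) * ((v * V1) * w ^ r + V1 * (w * w ^ r) + (v * v ^ s) * W1 + v ^ s * (w * W1))"
      by (simp add: algebra_simps)
    also have "\<dots> = - (2 * (real s + a)) * V1 * (w * w ^ r) - 2 * (real r + a) * W1 * (v * v ^ s)
       - (2 * real s * real r + (a + 1) * (real s + real r)) * (v ^ s * w ^ r)"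
      unfolding e by (simp add: field_simps)
    also have "\<dots> = poly (- smult (real s * (real s + a)) (ultra_term (s - 1) (r + 1))
        - smult (real r * (real r + a)) (ultra_term (s + 1) (r - 1))
        - smult (2 * real s * real r + (a + 1) * (real s + real r)) (ultra_term s r)) x"
      unfolding V1_def W1_def ultra_term_def poly_diff poly_minus poly_smult poly_mult poly_power
        v_def[symmetric] w_def[symmetric]
      by (simp add: field_simps)
    finally show ?thesis .
  qed
  thus ?thesis by (metis poly_eq_poly_eq_iff ext)
qed

lemma smult_sum_right: "smult b (sum f A) = (\<Sum>x\<in>A. smult b (f x))"
  by (induction A rule: infinite_finite_induct) (simp_all add: smult_add_right)

lemma ultra_op_smult: "ultra_op a (smult b p) = smult b (ultra_op a p)"
  unfolding ultra_op_def pderiv_smult mult_smult_right smult_diff_right smult_smult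
  by (simp only: mult.commute)

text \<open>After adding the eigenvalue, each term of the sum becomes a difference of consecutive
  exchange terms, because the recursion of the coefficients matches what a term passes to the next
  one. The sum telescopes to zero.\<close>

lemma ultra_op_ultra_poly:
  "ultra_op a (ultra_poly a k) = - smult (real k * (real k + 2 * a + 1)) (ultra_poly a k)"
proof -
  define lam where "lam = real k * (real k + 2 * a + 1)"
  define c where "c = jacobi_coeff a k"
  \<comment> \<open>\<open>E s\<close> is the exchange between the terms s - 1 and s. It vanishes at
    0 through the factor s and beyond k by definition, so both ends of the telescope are
    zero.\<close>
  define E where "E s = (if s \<le> k then smult (c s * (real s * (real s + a)))
      (ultra_term s (k - s) - ultra_term (s - 1) (k - s + 1)) else 0)" for s
  have lin: "ultra_op a (\<Sum>s\<le>k. smult (c s) (F s)) = (\<Sum>s\<le>k. smult (c s) (ultra_op a (F s)))" for F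
  proof -
    have add: "ultra_op a (p + q) = ultra_op a p + ultra_op a q" for p q
      by (simp add: ultra_op_def pderiv_add algebra_simps smult_add_right)
    have "ultra_op a (sum G A) = (\<Sum>s\<in>A. ultra_op a (G s))" if "finite A" for G and A :: "nat set"
      using that by (induction A) (simp_all add: add, simp add: ultra_op_def)
    thus ?thesis by (simp add: ultra_op_smult)
  qed
  have step: "smult (c s) (ultra_op a (ultra_term s (k - s)) + smult lam (ultra_term s (k - s))) = E s - E (Suc s)"
    if "s \<le> k" for s
  proof -
    let ?r = "k - s"
    have kr: "real k = real s + real ?r" using that by simp
    have "ultra_op a (ultra_term s ?r) + smult lam (ultra_term s ?r) =
      smult (real s * (real s + a)) (ultra_term s ?r - ultra_term (s - 1) (?r + 1)) -
      smult (real ?r * (real ?r + a)) (ultra_term (s + 1) (?r - 1) - ultra_term s ?r)"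
    proof -
      have "lam = real s * (real s + a) + real ?r * (real ?r + a) + (2 * real s * real ?r + (a + 1) * (real s + real ?r))"
        unfolding lam_def kr by (simp add: algebra_simps)
      thus ?thesis unfolding ultra_op_ultra_term by (simp add: smult_add_left smult_diff_right)
    qed
    moreover have "smult (c s) (smult (real ?r * (real ?r + a)) (ultra_term (s + 1) (?r - 1) - ultra_term s ?r)) = E (Suc s)"
    proof (cases "s < k")
      case True
      have "c (Suc s) * (real (Suc s) * (real (Suc s) + a)) = c s * (real ?r * (real ?r + a))"
        unfolding c_def by (rule jacobi_coeff_rec[OF True])
      moreover have "k - Suc s = ?r - 1" "?r - 1 + 1 = ?r" using True by auto
      ultimately show ?thesis using True unfolding E_def by (simp del: of_nat_Suc)
    next
      case False
      hence "?r = 0" "s = k" using that by auto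
      thus ?thesis by (simp add: E_def)
    qed
    ultimately show ?thesis using that by (simp add: smult_diff_right E_def)
  qed
  have "ultra_op a (ultra_poly a k) + smult lam (ultra_poly a k) = (\<Sum>s\<le>k. E s - E (Suc s))"
    unfolding ultra_poly_def c_def[symmetric] lin smult_sum_right sum.distrib[symmetric]
    by (intro sum.cong refl) (simp add: step[symmetric] smult_add_right mult.commute)
  also have "\<dots> = E 0 - E (Suc k)" by (rule sum_telescope)
  also have "\<dots> = 0" by (simp add: E_def)
  finally show ?thesis by (simp add: lam_def eq_neg_iff_add_eq_0)
qed

text \<open>All k + 1 summands have degree k and leading coefficient a positive multiple of 2^(-k),
  so nothing cancels.\<close>

lemma degree_ultra_poly:
  assumes "a > -1"
  shows "degree (ultra_poly a k) = k" "ultra_poly a k \<noteq> 0"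
proof -
  have d: "degree (ultra_term s r) = s + r" for s r
    unfolding ultra_term_def by (subst degree_mult_eq) (simp_all add: degree_power_eq)
  have lc: "lead_coeff (ultra_term s r) = (1 / 2) ^ (s + r)" for s r
    unfolding ultra_term_def by (simp add: lead_coeff_mult lead_coeff_power power_add)
  have "coeff (ultra_poly a k) k = (\<Sum>s\<le>k. jacobi_coeff a k s * (1 / 2) ^ k)"
    unfolding ultra_poly_def coeff_sum
  proof (intro sum.cong refl)
    fix s assume "s \<in> {..k}"
    thus "coeff (smult (jacobi_coeff a k s) (ultra_term s (k - s))) k = jacobi_coeff a k s * (1 / 2) ^ k"
      using lc[of s "k - s"] d[of s "k - s"] by simp
  qed
  also have "\<dots> > 0"
    by (intro sum_pos mult_pos_pos jacobi_coeff_pos assms) auto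
  finally have 1: "coeff (ultra_poly a k) k \<noteq> 0" by simp
  have "degree (ultra_poly a k) \<le> k"
    unfolding ultra_poly_def by (intro degree_sum_le order.trans[OF degree_smult_le]) (simp_all add: d)
  with 1 show "degree (ultra_poly a k) = k" by (meson le_antisym le_degree)
  from 1 show "ultra_poly a k \<noteq> 0" by auto
qed

definition sphere_polynomial :: "nat \<Rightarrow> nat \<Rightarrow> real poly" where
  "sphere_polynomial n k =
     smult (1 / jacobi ((real n - 3) / 2) ((real n - 3) / 2) k 1) (ultra_poly ((real n - 3) / 2) k)"

lemma poly_sphere_polynomial: "poly (sphere_polynomial n k) u = sphere_poly n k u"
  by (simp add: sphere_polynomial_def sphere_poly_def poly_ultra_poly)

lemma jacobi_1_pos:
  assumes "a > -1"
  shows "jacobi a a k 1 > 0"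
proof -
  have "jacobi a a k 1 = (\<Sum>s\<le>k. if s = 0 then jacobi_coeff a k 0 else 0)"
    unfolding jacobi_def by (intro sum.cong refl) (auto simp: jacobi_coeff_def)
  also have "\<dots> = jacobi_coeff a k 0" by simp
  finally show ?thesis using jacobi_coeff_pos[OF assms, of 0 k] by simp
qed

lemma sphere_poly_1: "n \<ge> 2 \<Longrightarrow> sphere_poly n k 1 = 1"
  using jacobi_1_pos[of "(real n - 3) / 2" k] by (simp add: sphere_poly_def)

lemma degree_sphere_polynomial:
  assumes "n \<ge> 2"
  shows "degree (sphere_polynomial n k) = k" "sphere_polynomial n k \<noteq> 0"
  using degree_ultra_poly[of "(real n - 3) / 2" k] jacobi_1_pos[of "(real n - 3) / 2" k] assms
  by (auto simp: sphere_polynomial_def)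

lemma sphere_poly_0: "n \<ge> 2 \<Longrightarrow> sphere_poly n 0 u = 1"
  by (simp add: sphere_poly_def jacobi_def)

text \<open>k (k + n - 2) is the Laplace eigenvalue of the spherical harmonics of degree k.
  Orthogonality rests on these numbers being distinct.\<close>

lemma ultra_op_sphere_polynomial:
  "ultra_op ((real n - 3) / 2) (sphere_polynomial n k) =
     - smult (real k * (real k + real n - 2)) (sphere_polynomial n k)"
proof -
  have "real k + 2 * ((real n - 3) / 2) + 1 = real k + real n - 2" by (simp add: field_simps)
  thus ?thesis
    unfolding sphere_polynomial_def ultra_op_smult ultra_op_ultra_poly
    by (simp only: smult_minus_right smult_smult mult.commute)
qed

section \<open>Bases graded by degree, and orthogonality\<close>

lemma poly_span_of_degrees:
  fixes P :: "nat \<Rightarrow> real poly"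
  assumes "\<And>k. degree (P k) = k" "\<And>k. P k \<noteq> 0" "degree p \<le> m"
  shows "\<exists>c. p = (\<Sum>k\<le>m. smult (c k) (P k))"
  using assms(3)
proof (induction m arbitrary: p)
  case 0
  then obtain b where b: "p = [:b:]" by (metis degree_eq_zeroE le_zero_eq)
  obtain b0 where b0: "P 0 = [:b0:]" using assms(1)[of 0] by (metis degree_eq_zeroE)
  with assms(2)[of 0] have "b0 \<noteq> 0" by auto
  thus ?case using b b0 by (intro exI[of _ "\<lambda>_. b / b0"]) simp
next
  case (Suc m)
  define d where "d = coeff p (Suc m) / lead_coeff (P (Suc m))"
  have "lead_coeff (P (Suc m)) \<noteq> 0" using assms(2) by simp
  hence "coeff (p - smult d (P (Suc m))) (Suc m) = 0" using assms(1)[of "Suc m"] by (simp add: d_def)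
  moreover have "degree (p - smult d (P (Suc m))) \<le> Suc m"
    using Suc.prems assms(1)[of "Suc m"] by (intro degree_diff_le order.trans[OF degree_smult_le]) auto
  ultimately have "degree (p - smult d (P (Suc m))) \<le> m"
    by (intro degree_le allI impI) (metis Suc_lessI coeff_eq_0 le_less_trans)
  from Suc.IH[OF this] obtain c where c: "p - smult d (P (Suc m)) = (\<Sum>k\<le>m. smult (c k) (P k))" by blast
  have "(\<Sum>k\<le>m. smult ((c(Suc m := d)) k) (P k)) = (\<Sum>k\<le>m. smult (c k) (P k))"
    by (intro sum.cong) auto
  hence "p = (\<Sum>k\<le>Suc m. smult ((c(Suc m := d)) k) (P k))"
    using c by (simp add: algebra_simps)
  thus ?case by blast
qed

text \<open>
  The differential operator is formally self-adjoint for every functional satisfying the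
  moment recursion \<open>rec\<close>: with \<open>r = p q' - q p'\<close> the left-hand side of \<open>rec\<close> is
  \<open>L (p D q - q D p)\<close>.
\<close>

lemma sphere_polynomial_orthogonal:
  fixes L :: "real poly \<Rightarrow> real"
  assumes "n \<ge> 2" "k \<noteq> l"
    and sm: "\<And>c p. L (smult c p) = c * L p"
    and rec: "\<And>r. L ([:1, 0, -1:] * pderiv r - smult (real n - 1) ([:0, 1:] * r)) = 0"
  shows "L (sphere_polynomial n k * sphere_polynomial n l) = 0"
proof -
  define p q where "p = sphere_polynomial n k" and "q = sphere_polynomial n l"
  define r where "r = p * pderiv q - q * pderiv p"
  define lam where "lam m = real m * (real m + real n - 2)" for m
  let ?D = "ultra_op ((real n - 3) / 2)"
  have D: "?D p = - smult (lam k) p" "?D q = - smult (lam l) q"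
    unfolding p_def q_def lam_def by (rule ultra_op_sphere_polynomial)+
  have n: "2 * ((real n - 3) / 2) + 2 = real n - 1" by (simp add: field_simps)
  have "[:1, 0, -1:] * pderiv r - smult (real n - 1) ([:0, 1:] * r) = p * ?D q - q * ?D p"
    unfolding r_def ultra_op_def n pderiv_diff pderiv_mult
    by (simp add: algebra_simps smult_diff_right smult_add_right)
  also have "\<dots> = smult (lam k - lam l) (p * q)"
    unfolding D by (simp add: smult_diff_left mult.commute)
  finally have "(lam k - lam l) * L (p * q) = 0" using rec[of r] sm by metis
  moreover have "lam k \<noteq> lam l"
  proof -
    have *: "lam i < lam j" if "i < j" for i j
      unfolding lam_def
    proof (cases "i = 0")
      case True
      thus "real i * (real i + real n - 2) < real j * (real j + real n - 2)" using that assms(1) by simp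
    next
      case False
      thus "real i * (real i + real n - 2) < real j * (real j + real n - 2)"
        using that assms(1) by (intro mult_strict_mono) auto
    qed
    from assms(2) consider "k < l" | "l < k" by linarith
    thus ?thesis by cases (auto dest: *)
  qed
  ultimately show ?thesis by (simp add: p_def q_def)
qed

text \<open>
  Uniqueness of Haar measure: both \<open>lborel\<close> and its image under \<open>f\<close> are invariant under
  translations, and they agree on the unit ball.
\<close>

lemma distr_lborel_orthogonal:
  fixes f :: "'a::euclidean_space \<Rightarrow> 'a"
  assumes f: "orthogonal_transformation f"
  shows "distr lborel borel f = lborel"
proof -
  have lin: "linear f" using f by (rule orthogonal_transformation_linear)
  have fm [measurable]: "f \<in> borel_measurable borel"
    by (intro borel_measurable_continuous_onI linear_continuous_on linear_linear[THEN iffD2] lin)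
  define N where "N = distr lborel borel f"
  have sN [measurable_cong, simp]: "sets N = sets borel" and spN [simp]: "space N = UNIV"
    by (simp_all add: N_def)
  have ball: "f -` ball 0 r = ball 0 r" for r
    using orthogonal_transformation_norm[OF f] by auto
  have emN: "emeasure N A = emeasure lborel (f -` A)" if "A \<in> sets borel" for A
    using that by (simp add: N_def emeasure_distr)
  have Nball: "emeasure N (ball 0 r) = emeasure lborel (ball 0 r :: 'a set)" for r
    by (simp add: emN ball)
  have bfin: "emeasure lborel (ball 0 r :: 'a set) < \<infinity>" for r
    by (intro emeasure_bounded_finite) simp
  interpret N: sigma_finite_measure N
  proof
    show "\<exists>A. countable A \<and> A \<subseteq> sets N \<and> \<Union> A = space N \<and> (\<forall>a\<in>A. emeasure N a \<noteq> \<infinity>)"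
    proof (intro exI[of _ "range (\<lambda>n::nat. ball 0 (real n))"] conjI ballI)
      show "\<Union> (range (\<lambda>n::nat. ball (0::'a) (real n))) = space N"
        by (auto simp: reals_Archimedean2)
      fix a assume "a \<in> range (\<lambda>n::nat. ball (0::'a) (real n))"
      thus "emeasure N a \<noteq> \<infinity>" using Nball bfin by (auto simp: less_top)
    qed auto
  qed
  interpret LN: pair_sigma_finite "lborel :: 'a measure" N ..
  \<comment> \<open>Since f is linear and onto, translating the image by c = f d amounts to
    translating by d before applying f.\<close>
  have trN: "distr N borel (\<lambda>y. c + y) = N" for c
  proof -
    obtain d where d: "f d = c" using orthogonal_transformation_surj[OF f] by (metis surjD)
    have "distr N borel (\<lambda>y. c + y) = distr lborel borel (\<lambda>y. c + f y)"
      unfolding N_def by (subst distr_distr) (simp_all add: o_def)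
    also have "\<dots> = distr lborel borel (\<lambda>y. f (d + y))"
      using d by (simp add: linear_add[OF lin])
    also have "\<dots> = distr (distr lborel borel ((+) d)) borel f"
      by (subst distr_distr) (simp_all add: o_def)
    also have "\<dots> = N" by (simp add: lborel_distr_plus N_def)
    finally show ?thesis .
  qed
  let ?B = "ball 0 1 :: 'a set"
  have [measurable]: "?B \<in> sets borel" by simp
  \<comment> \<open>The product measure of A x ball is computed twice: shifting x by y and then y by
    x lets the two measures exchange their sets.\<close>
  have key: "emeasure lborel A * emeasure N ?B = emeasure N A * emeasure lborel ?B"
    if A [measurable]: "A \<in> sets borel" for A
  proof -
    have "emeasure lborel A * emeasure N ?B =
        (\<integral>\<^sup>+y. (\<integral>\<^sup>+x. indicator A x * indicator ?B y \<partial>lborel) \<partial>N)"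
      by (simp add: nn_integral_multc nn_integral_cmult_indicator)
    also have "\<dots> = (\<integral>\<^sup>+y. (\<integral>\<^sup>+x. indicator A (y + x) * indicator ?B y \<partial>lborel) \<partial>N)"
    proof (rule nn_integral_cong)
      fix y
      have "(\<integral>\<^sup>+x. indicator A x * indicator ?B y \<partial>lborel) =
          (\<integral>\<^sup>+x. indicator A x * indicator ?B y \<partial>(distr lborel borel ((+) y)))"
        by (simp add: lborel_distr_plus)
      also have "\<dots> = (\<integral>\<^sup>+x. indicator A (y + x) * indicator ?B y \<partial>lborel)"
        by (subst nn_integral_distr) simp_all
      finally show "(\<integral>\<^sup>+x. indicator A x * indicator ?B y \<partial>lborel) =
          (\<integral>\<^sup>+x. indicator A (y + x) * indicator ?B y \<partial>lborel)" .
    qed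
    also have "\<dots> = (\<integral>\<^sup>+x. (\<integral>\<^sup>+y. indicator A (y + x) * indicator ?B y \<partial>N) \<partial>lborel)"
      by (rule LN.Fubini') measurable
    also have "\<dots> = (\<integral>\<^sup>+x. (\<integral>\<^sup>+y. indicator A y * indicator ?B (y - x) \<partial>N) \<partial>lborel)"
    proof (rule nn_integral_cong)
      fix x
      have "(\<integral>\<^sup>+y. indicator A y * indicator ?B (y - x) \<partial>N) =
          (\<integral>\<^sup>+y. indicator A y * indicator ?B (y - x) \<partial>(distr N borel (\<lambda>y. x + y)))"
        by (simp add: trN)
      also have "\<dots> = (\<integral>\<^sup>+y. indicator A (y + x) * indicator ?B y \<partial>N)"
        by (subst nn_integral_distr) (simp_all add: add.commute)
      finally show "(\<integral>\<^sup>+y. indicator A (y + x) * indicator ?B y \<partial>N) =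
          (\<integral>\<^sup>+y. indicator A y * indicator ?B (y - x) \<partial>N)" ..
    qed
    also have "\<dots> = (\<integral>\<^sup>+y. (\<integral>\<^sup>+x. indicator A y * indicator ?B (y - x) \<partial>lborel) \<partial>N)"
      by (rule LN.Fubini'[symmetric]) measurable
    also have "\<dots> = (\<integral>\<^sup>+y. indicator A y * emeasure lborel ?B \<partial>N)"
    proof (rule nn_integral_cong)
      fix y
      have "(\<integral>\<^sup>+x. indicator ?B (y - x) \<partial>lborel) = (\<integral>\<^sup>+x. indicator (ball y 1) x \<partial>lborel)"
        by (intro nn_integral_cong) (auto simp: indicator_def dist_norm norm_minus_commute)
      also have "\<dots> = emeasure lborel ?B"
        by (simp add: emeasure_ball)
      finally show "(\<integral>\<^sup>+x. indicator A y * indicator ?B (y - x) \<partial>lborel) = indicator A y * emeasure lborel ?B"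
        by (simp add: nn_integral_cmult)
    qed
    also have "\<dots> = emeasure N A * emeasure lborel ?B"
      by (simp add: nn_integral_multc)
    finally show ?thesis .
  qed
  have nz: "emeasure lborel ?B \<noteq> 0" "emeasure lborel ?B \<noteq> \<infinity>"
    using bfin[of 1] unit_ball_vol_pos[of "real DIM('a)"]
    by (auto simp: emeasure_ball ennreal_eq_0_iff simp del: unit_ball_vol_pos)
  have "emeasure lborel A = emeasure N A" if "A \<in> sets borel" for A
  proof -
    have "emeasure lborel ?B * emeasure lborel A = emeasure lborel ?B * emeasure N A"
      using key[OF that] Nball[of 1] by (simp add: mult.commute)
    thus ?thesis using nz by (simp add: ennreal_mult_cancel_left)
  qed
  thus ?thesis
    unfolding N_def[symmetric] by (intro measure_eqI) auto
qed

subsection \<open>The uniform measure on the unit sphere\<close>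

text \<open>The origin is sent to an arbitrary basis vector so that the map takes values on the
  sphere everywhere; this changes it only on a null set.\<close>

definition sphere_proj :: "'a::euclidean_space \<Rightarrow> 'a" where
  "sphere_proj x = (if x = 0 then (SOME b. b \<in> Basis) else sgn x)"

text \<open>The uniform measure as the radial image of the uniform distribution on the ball.
  Invariance and full support are then inherited from Lebesgue measure.\<close>

definition sphere_measure :: "'a::euclidean_space measure" where
  "sphere_measure =
     distr (uniform_measure lborel (ball 0 1)) (restrict_space borel (sphere 0 1)) sphere_proj"

lemma sphere_proj_in_sphere: "sphere_proj x \<in> sphere 0 1"
proof -
  have "(SOME b::'a. b \<in> Basis) \<in> Basis" by (rule someI_ex) (use nonempty_Basis in blast)
  thus ?thesis by (auto simp: sphere_proj_def norm_sgn)
qed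

lemma sphere_proj_measurable [measurable]:
  "sphere_proj \<in> borel \<rightarrow>\<^sub>M restrict_space borel (sphere 0 1)"
proof (rule measurable_restrict_space2)
  show "sphere_proj \<in> borel_measurable (borel :: 'a measure)"
    unfolding sphere_proj_def[abs_def] by measurable
qed (use sphere_proj_in_sphere in blast)

lemma space_sphere_measure [simp]: "space sphere_measure = sphere 0 1"
  and sets_sphere_measure [measurable_cong]:
    "sets sphere_measure = sets (restrict_space borel (sphere 0 1))"
  by (simp_all add: sphere_measure_def space_restrict_space)

lemma open_Int_sphere_measurable:
  assumes "open U"
  shows "U \<inter> sphere 0 1 \<in> sets sphere_measure"
  unfolding sets_sphere_measure sets_restrict_space
  by (rule image_eqI[of _ _ U]) (use assms in \<open>simp_all add: Int_commute borel_open\<close>)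

lemma emeasure_unit_ball:
  "emeasure lborel (ball 0 1 :: 'a::euclidean_space set) \<noteq> 0"
  "emeasure lborel (ball 0 1 :: 'a::euclidean_space set) \<noteq> \<infinity>"
  using unit_ball_vol_pos[of "real DIM('a)"]
  by (auto simp: emeasure_ball ennreal_eq_0_iff simp del: unit_ball_vol_pos)

lemma prob_space_sphere_measure: "prob_space sphere_measure"
proof -
  interpret U: prob_space "uniform_measure lborel (ball 0 1) :: 'a::euclidean_space measure"
    by (intro prob_space_uniform_measure emeasure_unit_ball)
  have "sphere_proj \<in> uniform_measure lborel (ball 0 1) \<rightarrow>\<^sub>M restrict_space borel (sphere (0::'a) 1)"
    using sphere_proj_measurable by (subst measurable_cong_sets) auto
  thus "prob_space (sphere_measure :: 'a measure)"
    unfolding sphere_measure_def by (rule U.prob_space_distr)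
qed

interpretation sphere_measure: prob_space "sphere_measure :: 'a::euclidean_space measure"
  by (rule prob_space_sphere_measure)

interpretation sphere_pair: pair_prob_space
  "sphere_measure :: 'a::euclidean_space measure" "sphere_measure :: 'a measure" ..

lemma id_measurable_sphere_measure: "(\<lambda>x. x) \<in> sphere_measure \<rightarrow>\<^sub>M borel"
  by (subst measurable_cong_sets[OF sets_sphere_measure refl]) (simp add: measurable_restrict_space1)

lemma inner_measurable_sphere_measure [measurable]:
  "(\<lambda>z. e \<bullet> z) \<in> borel_measurable sphere_measure"
  using id_measurable_sphere_measure by (intro borel_measurable_inner) simp_all

lemma integrable_sphere_measure:
  fixes g :: "'a::euclidean_space \<Rightarrow> real"
  assumes "continuous_on (sphere 0 1) g"
  shows "integrable sphere_measure g"
proof -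
  have [measurable]: "g \<in> borel_measurable sphere_measure"
    using borel_measurable_continuous_on_restrict[OF assms]
    by (subst measurable_cong_sets[OF sets_sphere_measure refl])
  have "compact (g ` sphere 0 1)" by (intro compact_continuous_image assms) simp
  then obtain B where "\<forall>x\<in>g ` sphere 0 1. norm x \<le> B" by (metis compact_imp_bounded bounded_iff)
  thus ?thesis by (intro sphere_measure.integrable_const_bound[where B = B]) auto
qed

lemma integrable_sphere_pair:
  fixes g :: "'a::euclidean_space \<Rightarrow> 'a \<Rightarrow> real"
  assumes "continuous_on (sphere 0 1 \<times> sphere 0 1) (\<lambda>(x, y). g x y)"
  shows "integrable (sphere_measure \<Otimes>\<^sub>M sphere_measure) (\<lambda>(x, y). g x y)"
proof -
  let ?S = "sphere 0 1 \<times> sphere 0 1 :: ('a \<times> 'a) set"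
  let ?P = "sphere_measure \<Otimes>\<^sub>M sphere_measure :: ('a \<times> 'a) measure"
  have sp: "space ?P = ?S" by (simp add: space_pair_measure)
  \<comment> \<open>Extension by zero from the closed set S x S gives a Borel function on the whole
    space, which the identity map pulls back to the product sigma-algebra.\<close>
  have "?S \<in> sets borel" by (intro borel_closed closed_Times) auto
  from borel_measurable_continuous_on_indicator[OF this assms]
  have 1: "(\<lambda>p. indicator ?S p *\<^sub>R (case p of (x, y) \<Rightarrow> g x y)) \<in> borel_measurable borel" .
  have "(\<lambda>p. p) \<in> ?P \<rightarrow>\<^sub>M borel \<Otimes>\<^sub>M borel"
    by (rule measurable_pair)
       (auto simp: o_def intro!: measurable_compose[OF measurable_fst id_measurable_sphere_measure]
          measurable_compose[OF measurable_snd id_measurable_sphere_measure])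
  hence "(\<lambda>p. p) \<in> ?P \<rightarrow>\<^sub>M borel" by (simp add: borel_prod)
  from measurable_compose[OF this 1]
  have m: "(\<lambda>p. indicator ?S p *\<^sub>R (case p of (x, y) \<Rightarrow> g x y)) \<in> borel_measurable ?P" .
  have [measurable]: "(\<lambda>(x, y). g x y) \<in> borel_measurable ?P"
    by (rule measurable_cong[THEN iffD1, OF _ m]) (simp add: sp)
  have "compact ((\<lambda>(x, y). g x y) ` ?S)" by (intro compact_continuous_image assms compact_Times) auto
  then obtain B where "\<forall>x\<in>(\<lambda>(x, y). g x y) ` ?S. norm x \<le> B" by (metis compact_imp_bounded bounded_iff)
  hence "norm (case p of (x, y) \<Rightarrow> g x y) \<le> B" if "p \<in> space ?P" for p
    using that unfolding sp by blast
  thus ?thesis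
    by (intro sphere_pair.integrable_const_bound[where B = B] AE_I2) auto
qed

text \<open>Away from the origin f commutes with the radial projection, and it preserves the uniform
  distribution on the ball.\<close>

lemma integral_sphere_orthogonal:
  fixes f :: "'a::euclidean_space \<Rightarrow> 'a" and g :: "'a \<Rightarrow> real"
  assumes f: "orthogonal_transformation f" and g [measurable]: "g \<in> borel_measurable sphere_measure"
  shows "(\<integral>z. g (f z) \<partial>sphere_measure) = (\<integral>z. g z \<partial>sphere_measure)"
proof -
  let ?U = "uniform_measure lborel (ball 0 1) :: 'a measure"
  have lin: "linear f" using f by (rule orthogonal_transformation_linear)
  have fn [simp]: "norm (f x) = norm x" for x using f by (rule orthogonal_transformation_norm)
  have f0: "f x = 0 \<longleftrightarrow> x = 0" for x using fn[of x] by (metis norm_eq_zero)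
  have fm [measurable]: "f \<in> borel_measurable borel"
    by (intro borel_measurable_continuous_onI linear_continuous_on linear_linear[THEN iffD2] lin)
  have fs: "f \<in> sphere_measure \<rightarrow>\<^sub>M sphere_measure"
    unfolding measurable_cong_sets[OF sets_sphere_measure sets_sphere_measure]
    by (rule measurable_restrict_space2[OF _ measurable_restrict_space1[OF fm]])
       (auto simp: space_restrict_space)
  have g': "g \<in> borel_measurable (restrict_space borel (sphere 0 1))"
    using g unfolding measurable_cong_sets[OF sets_sphere_measure refl] .
  have U: "distr ?U borel f = ?U"
  proof (rule measure_eqI)
    fix A :: "'a set" assume "A \<in> sets (distr ?U borel f)"
    hence [measurable]: "A \<in> sets borel" by simp
    have "emeasure (distr ?U borel f) A = emeasure ?U (f -` A)"
      by (subst emeasure_distr) simp_all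
    also have "\<dots> = emeasure lborel (ball 0 1 \<inter> f -` A) / emeasure lborel (ball 0 1 :: 'a set)"
      by (subst emeasure_uniform_measure) (auto intro!: measurable_sets_borel[OF fm])
    also have "ball 0 1 \<inter> f -` A = f -` (ball 0 1 \<inter> A)" by auto
    also have "emeasure lborel \<dots> = emeasure (distr lborel borel f) (ball 0 1 \<inter> A)"
      by (subst emeasure_distr) simp_all
    finally show "emeasure (distr ?U borel f) A = emeasure ?U A"
      by (simp add: distr_lborel_orthogonal[OF f])
  qed simp
  have fgm: "(\<lambda>z. g (f z)) \<in> borel_measurable (restrict_space borel (sphere 0 1))"
    using measurable_compose[OF fs g] unfolding measurable_cong_sets[OF sets_sphere_measure refl] .
  have "(\<integral>z. g (f z) \<partial>sphere_measure) = (\<integral>x. g (f (sphere_proj x)) \<partial>?U)"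
    unfolding sphere_measure_def by (rule integral_distr) (simp_all add: fgm)
  also have "\<dots> = (\<integral>x. g (sphere_proj (f x)) \<partial>?U)"
  proof (rule integral_cong_AE)
    show "AE x in ?U. g (f (sphere_proj x)) = g (sphere_proj (f x))"
    proof (rule AE_uniform_measureI)
      have "AE x in lborel. x \<noteq> (0::'a)" by (rule AE_lborel_singleton)
      thus "AE x in lborel. x \<in> ball (0::'a) 1 \<longrightarrow> g (f (sphere_proj x)) = g (sphere_proj (f x))"
        by (rule AE_mp) (auto simp: sphere_proj_def sgn_div_norm f0 linear_scale[OF lin])
    qed simp
    show "(\<lambda>x. g (f (sphere_proj x))) \<in> borel_measurable ?U"
      using measurable_compose[OF sphere_proj_measurable fgm] by simp
    show "(\<lambda>x. g (sphere_proj (f x))) \<in> borel_measurable ?U"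
      using measurable_compose[OF measurable_compose[OF fm sphere_proj_measurable] g'] by simp
  qed
  also have "\<dots> = (\<integral>x. g (sphere_proj x) \<partial>(distr ?U borel f))"
    by (rule integral_distr[symmetric])
       (use measurable_compose[OF sphere_proj_measurable g'] in simp_all)
  also have "\<dots> = (\<integral>x. g (sphere_proj x) \<partial>?U)" by (simp only: U)
  also have "\<dots> = (\<integral>z. g z \<partial>sphere_measure)"
    unfolding sphere_measure_def by (rule integral_distr[symmetric]) (simp_all add: g')
  finally show ?thesis .
qed

text \<open>The cone over U in the punctured ball is open and contains x / 2, so it has positive
  Lebesgue measure.\<close>

lemma sphere_measure_open_pos:
  fixes U :: "'a::euclidean_space set"
  assumes "open U" "x \<in> U" "norm x = 1"
  shows "measure sphere_measure (U \<inter> sphere 0 1) > 0"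
proof -
  let ?W = "{y \<in> ball 0 1 - {0}. sgn y \<in> U}"
  have "continuous_on (ball 0 1 - {0}) (sgn :: 'a \<Rightarrow> 'a)" by (intro continuous_intros) auto
  hence oW: "open ?W"
    using continuous_open_preimage[of "ball 0 1 - {0}" sgn U] assms(1)
    by (simp add: vimage_def Int_def open_Diff)
  have "x /\<^sub>R 2 \<in> ?W" using assms by (auto simp: sgn_div_norm)
  hence "\<not> negligible ?W" using open_not_negligible[OF oW] by blast
  hence pos: "emeasure lborel ?W \<noteq> 0"
    using oW by (auto simp: negligible_iff_null_sets null_sets_def emeasure_completion borel_open main_part_sets)
  have Um: "U \<inter> sphere 0 1 \<in> sets (restrict_space borel (sphere 0 1))"
    using open_Int_sphere_measurable[OF assms(1)] unfolding sets_sphere_measure .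
  have pm: "sphere_proj -` (U \<inter> sphere 0 1) \<in> sets borel"
    using measurable_sets[OF sphere_proj_measurable Um] by simp
  have "emeasure sphere_measure (U \<inter> sphere 0 1) =
      emeasure lborel (ball 0 1 \<inter> sphere_proj -` (U \<inter> sphere 0 1)) / emeasure lborel (ball 0 1 :: 'a set)"
    unfolding sphere_measure_def using Um pm by (subst emeasure_distr) simp_all
  moreover have "emeasure lborel ?W \<le> emeasure lborel (ball 0 1 \<inter> sphere_proj -` (U \<inter> sphere 0 1))"
    using pm by (intro emeasure_mono) (auto simp: sphere_proj_def norm_sgn)
  hence "emeasure lborel (ball 0 1 \<inter> sphere_proj -` (U \<inter> sphere 0 1)) \<noteq> 0" using pos by auto
  ultimately have "emeasure sphere_measure (U \<inter> sphere 0 1) \<noteq> 0"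
    using emeasure_unit_ball by (simp add: ennreal_divide_eq_0_iff)
  thus ?thesis
    by (metis sphere_measure.emeasure_eq_measure ennreal_0 measure_nonneg order_le_less)
qed

subsection \<open>Moments of the uniform measure\<close>

text \<open>The Householder reflection in the hyperplane orthogonal to d. For d = 0 it is the
  identity, so exchanging two equal vectors needs no exception.\<close>

definition reflection :: "'a::euclidean_space \<Rightarrow> 'a \<Rightarrow> 'a" where
  "reflection d v = v - (2 * (v \<bullet> d) / (d \<bullet> d)) *\<^sub>R d"

lemma orthogonal_transformation_reflection: "orthogonal_transformation (reflection d)"
  unfolding orthogonal_transformation_def
proof (intro conjI allI)
  show "linear (reflection d)"
    by (rule linearI)
       (simp_all add: reflection_def inner_add_left distrib_left add_divide_distrib scaleR_add_left scaleR_diff_right)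
  fix v w
  show "reflection d v \<bullet> reflection d w = v \<bullet> w"
  proof (cases "d = 0")
    case False
    define a b c where "a = v \<bullet> d" and "b = w \<bullet> d" and "c = d \<bullet> d"
    have c: "c \<noteq> 0" using False by (simp add: c_def)
    have "reflection d v \<bullet> reflection d w = v \<bullet> w - 2 * a / c * b - 2 * b / c * (a - 2 * a / c * c)"
      unfolding reflection_def a_def[symmetric] b_def[symmetric] c_def[symmetric]
      by (simp only: inner_diff_left inner_diff_right inner_scaleR_left inner_scaleR_right
          inner_commute[of d w] a_def b_def c_def)
    also have "\<dots> = v \<bullet> w" using c by (simp add: field_simps)
    finally show ?thesis .
  qed (simp add: reflection_def)
qed

lemma orthogonal_transformation_inner:
  "orthogonal_transformation f \<Longrightarrow> f v \<bullet> f w = v \<bullet> w"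
  by (simp add: orthogonal_transformation_def)

lemma reflection_swap:
  assumes "norm u = norm w"
  shows "reflection (u - w) u = w"
proof (cases "u = w")
  case False
  have uw: "u \<bullet> u = w \<bullet> w" using assms by (simp add: dot_square_norm)
  have "2 * (u \<bullet> (u - w)) = (u - w) \<bullet> (u - w)"
    using uw by (simp add: inner_diff_left inner_diff_right inner_commute)
  moreover have "(u - w) \<bullet> (u - w) \<noteq> 0" using False by simp
  ultimately show ?thesis by (simp add: reflection_def)
qed (simp add: reflection_def)

lemma reflection_fixes: "v \<bullet> d = 0 \<Longrightarrow> reflection d v = v"
  by (simp add: reflection_def)

definition orthonormal_pair :: "'a::euclidean_space \<Rightarrow> 'a \<Rightarrow> bool" where
  "orthonormal_pair e w \<longleftrightarrow> norm e = 1 \<and> norm w = 1 \<and> e \<bullet> w = 0"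

text \<open>Two reflections suffice: the first carries e to e', the second moves the image of w to
  w' along a direction orthogonal to e' and therefore leaves e' in place.\<close>

lemma orthonormal_pair_transitive:
  fixes e w e' w' :: "'a::euclidean_space"
  assumes "orthonormal_pair e w" "orthonormal_pair e' w'"
  obtains f where "orthogonal_transformation f" "f e = e'" "f w = w'"
proof -
  define g where "g = reflection (e - e')"
  have g: "orthogonal_transformation g" "g e = e'"
    using assms unfolding g_def
    by (auto intro!: orthogonal_transformation_reflection reflection_swap simp: orthonormal_pair_def)
  define h where "h = reflection (g w - w')"
  have n: "norm (g w) = norm w'"
    using assms orthogonal_transformation_norm[OF g(1)] by (simp add: orthonormal_pair_def)
  have "e' \<bullet> g w = 0"
    using orthogonal_transformation_inner[OF g(1), of e w] g(2) assms(1)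
    by (simp add: orthonormal_pair_def)
  hence "h e' = e'"
    unfolding h_def using assms by (intro reflection_fixes) (simp add: inner_diff_right orthonormal_pair_def)
  moreover have "h (g w) = w'" unfolding h_def by (rule reflection_swap[OF n])
  moreover have "orthogonal_transformation h" unfolding h_def by (rule orthogonal_transformation_reflection)
  ultimately show ?thesis
    using g that[of "h \<circ> g"] by (auto intro: orthogonal_transformation_compose)
qed

lemma orthonormal_pair_exists:
  fixes e :: "'a::euclidean_space"
  assumes "DIM('a) \<ge> 2" "norm e = 1"
  obtains w where "orthonormal_pair e w"
proof -
  obtain v where v: "v \<noteq> 0" "orthogonal e v" using orthogonal_to_vector_exists[OF assms(1)] by blast
  have "e \<bullet> sgn v = 0" using v(2) unfolding sgn_div_norm orthogonal_def by simp
  moreover have "norm (sgn v) = 1" using v(1) by (simp add: norm_sgn)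
  ultimately show ?thesis using that[of "sgn v"] assms(2) by (simp add: orthonormal_pair_def)
qed

lemma integral_sphere_pair_invariant:
  fixes e w e' w' :: "'a::euclidean_space" and G :: "real \<Rightarrow> real \<Rightarrow> real"
  assumes "orthonormal_pair e w" "orthonormal_pair e' w'"
    and "continuous_on UNIV (\<lambda>(s, t). G s t)"
  shows "(\<integral>z. G (e \<bullet> z) (w \<bullet> z) \<partial>sphere_measure) = (\<integral>z. G (e' \<bullet> z) (w' \<bullet> z) \<partial>sphere_measure)"
proof -
  obtain f where f: "orthogonal_transformation f" "f e = e'" "f w = w'"
    using orthonormal_pair_transitive[OF assms(1,2)] .
  have "(\<lambda>z. (e' \<bullet> z, w' \<bullet> z)) \<in> borel_measurable sphere_measure"
    by (rule borel_measurable_Pair[OF inner_measurable_sphere_measure inner_measurable_sphere_measure])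
  from measurable_compose[OF this borel_measurable_continuous_onI[OF assms(3)]]
  have m: "(\<lambda>z. G (e' \<bullet> z) (w' \<bullet> z)) \<in> borel_measurable sphere_measure"
    by (simp only: prod.case)
  have "(\<integral>z. G (e' \<bullet> z) (w' \<bullet> z) \<partial>sphere_measure) = (\<integral>z. G (e' \<bullet> f z) (w' \<bullet> f z) \<partial>sphere_measure)"
    by (rule integral_sphere_orthogonal[OF f(1) m, symmetric])
  also have "\<dots> = (\<integral>z. G (e \<bullet> z) (w \<bullet> z) \<partial>sphere_measure)"
    by (simp only: f(2,3)[symmetric] orthogonal_transformation_inner[OF f(1)])
  finally show ?thesis ..
qed

lemma integral_sphere_invariant:
  fixes e e' :: "'a::euclidean_space" and G :: "real \<Rightarrow> real"
  assumes "norm e = 1" "norm e' = 1" and "continuous_on UNIV G"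
  shows "(\<integral>z. G (e \<bullet> z) \<partial>sphere_measure) = (\<integral>z. G (e' \<bullet> z) \<partial>sphere_measure)"
proof -
  obtain f where f: "orthogonal_transformation f" "f e = e'"
    using assms orthogonal_transformation_reflection reflection_swap by metis
  have m: "(\<lambda>z. G (e' \<bullet> z)) \<in> borel_measurable sphere_measure"
    by (rule measurable_compose[OF inner_measurable_sphere_measure
          borel_measurable_continuous_onI[OF assms(3)]])
  have "(\<integral>z. G (e' \<bullet> z) \<partial>sphere_measure) = (\<integral>z. G (e' \<bullet> f z) \<partial>sphere_measure)"
    by (rule integral_sphere_orthogonal[OF f(1) m, symmetric])
  also have "\<dots> = (\<integral>z. G (e \<bullet> z) \<partial>sphere_measure)"
    by (simp only: f(2)[symmetric] orthogonal_transformation_inner[OF f(1)])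
  finally show ?thesis ..
qed

lemma poly_monom_induct [case_names add monom]:
  assumes "\<And>p q. P p \<Longrightarrow> P q \<Longrightarrow> P (p + q)" "\<And>c k. P (monom c k)"
  shows "P (p :: real poly)"
proof -
  have "P (\<Sum>i\<le>n. monom (coeff p i) i)" for n
    by (induction n) (auto intro: assms)
  thus ?thesis using poly_as_sum_of_monoms[of p] by metis
qed

definition sphere_moment :: "'a::euclidean_space \<Rightarrow> 'a \<Rightarrow> nat \<Rightarrow> nat \<Rightarrow> real" where
  "sphere_moment e w p q = (\<integral>z. (e \<bullet> z) ^ p * (w \<bullet> z) ^ q \<partial>sphere_measure)"

lemma sphere_moment_eq:
  fixes e w e' w' :: "'a::euclidean_space"
  assumes "orthonormal_pair e w" "orthonormal_pair e' w'"
  shows "sphere_moment e w p q = sphere_moment e' w' p q"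
  unfolding sphere_moment_def
  by (rule integral_sphere_pair_invariant[OF assms, where G = "\<lambda>s t. s ^ p * t ^ q"])
     (simp add: case_prod_unfold continuous_intros)

text \<open>Replacing w by -w gives another orthonormal pair, hence the same moment, but changes the
  sign of the integrand.\<close>

lemma sphere_moment_odd:
  assumes "orthonormal_pair e w" "odd q"
  shows "sphere_moment e w p q = 0"
proof -
  have "orthonormal_pair e (- w)" using assms by (simp add: orthonormal_pair_def)
  from sphere_moment_eq[OF assms(1) this, of p q] show ?thesis
    using assms(2) by (simp add: sphere_moment_def)
qed

lemma integrable_sphere_monomial [simp]:
  "integrable sphere_measure (\<lambda>z. (e \<bullet> z) ^ p * (w \<bullet> z) ^ q)"
  by (intro integrable_sphere_measure continuous_intros)

lemma integrable_sphere_poly [simp]: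
  "integrable sphere_measure (\<lambda>z. poly p (e \<bullet> z))"
  by (intro integrable_sphere_measure continuous_intros)

text \<open>
  Rotating the pair \<open>e, w\<close> to \<open>e + t w, w - t e\<close> (up to normalization) keeps the odd moment
  \<open>(e \<bullet> z) ^ j * (w \<bullet> z)\<close> zero; the claim is the coefficient of \<open>t\<close>.
\<close>

lemma sphere_moment_rotation:
  fixes e w :: "'a::euclidean_space"
  assumes ew: "orthonormal_pair e w"
  shows "real j * sphere_moment e w (j - 1) 2 = sphere_moment e w (j + 1) 0"
proof -
  \<comment> \<open>With X = e . z and W = w . z, this is the integral of (t W + X)^j (W - t X),
    expanded by the binomial theorem as a polynomial in t.\<close>
  define A where "A = (\<Sum>q\<le>j. monom (real (j choose q) * sphere_moment e w (j - q) (q + 1)) q)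
     - (\<Sum>q\<le>j. monom (real (j choose q) * sphere_moment e w (j - q + 1) q) (q + 1))"
  have "poly A t = 0" for t
  proof -
    define r where "r = sqrt (1 + t\<^sup>2)"
    have r2: "r\<^sup>2 = 1 + t\<^sup>2" by (simp add: r_def)
    have r0: "r > 0" unfolding r_def by (intro real_sqrt_gt_zero) (simp add: add_pos_nonneg)
    define v v' where "v = (e + t *\<^sub>R w) /\<^sub>R r" and "v' = (w - t *\<^sub>R e) /\<^sub>R r"
    have e: "e \<bullet> e = 1" "w \<bullet> w = 1" "e \<bullet> w = 0" "w \<bullet> e = 0"
      using ew by (auto simp: orthonormal_pair_def norm_eq_1 inner_commute)
    have "1 + t * t > 0" by (simp add: add_pos_nonneg)
    hence q: "1 / (1 + t * t) + t * t / (1 + t * t) = 1" by (simp add: add_divide_distrib[symmetric])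
    have vv: "orthonormal_pair v v'"
      using r0 r2 q unfolding orthonormal_pair_def norm_eq_1 v_def v'_def
      by (simp add: inner_add_left inner_add_right inner_diff_left inner_diff_right e field_simps power2_eq_square)
    \<comment> \<open>The factor clears the normalization: one r for each of the j + 1 linear
      factors.\<close>
    have "0 = r ^ (j + 1) * sphere_moment v v' j 1"
      using sphere_moment_odd[OF vv, of 1 j] by simp
    also have "\<dots> = (\<integral>z. r ^ (j + 1) * ((v \<bullet> z) ^ j * (v' \<bullet> z) ^ 1) \<partial>sphere_measure)"
      by (simp add: sphere_moment_def)
    also have "\<dots> = (\<integral>z. (t * (w \<bullet> z) + e \<bullet> z) ^ j * (w \<bullet> z - t * (e \<bullet> z)) \<partial>sphere_measure)"
    proof (rule Bochner_Integration.integral_cong[OF refl])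
      fix z
      have vz: "r * (v \<bullet> z) = t * (w \<bullet> z) + e \<bullet> z" "r * (v' \<bullet> z) = w \<bullet> z - t * (e \<bullet> z)"
        using r0 by (simp_all add: v_def v'_def inner_add_left inner_diff_left mult.assoc[symmetric])
      have "r ^ (j + 1) * ((v \<bullet> z) ^ j * (v' \<bullet> z) ^ 1) = (r * (v \<bullet> z)) ^ j * (r * (v' \<bullet> z))"
        by (simp add: power_mult_distrib mult_ac)
      thus "r ^ (j + 1) * ((v \<bullet> z) ^ j * (v' \<bullet> z) ^ 1) = (t * (w \<bullet> z) + e \<bullet> z) ^ j * (w \<bullet> z - t * (e \<bullet> z))"
        unfolding vz .
    qed
    also have "\<dots> = (\<integral>z. (\<Sum>q\<le>j. real (j choose q) * t ^ q * ((e \<bullet> z) ^ (j - q) * (w \<bullet> z) ^ (q + 1)))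
        - (\<Sum>q\<le>j. real (j choose q) * t ^ (q + 1) * ((e \<bullet> z) ^ (j - q + 1) * (w \<bullet> z) ^ q)) \<partial>sphere_measure)"
    proof (rule Bochner_Integration.integral_cong[OF refl])
      fix z
      define X W where "X = e \<bullet> z" and "W = w \<bullet> z"
      have "(t * W + X) ^ j = (\<Sum>q\<le>j. real (j choose q) * t ^ q * W ^ q * X ^ (j - q))"
        by (subst binomial_ring) (simp add: power_mult_distrib mult.assoc)
      hence "(t * W + X) ^ j * (W - t * X) =
          (\<Sum>q\<le>j. real (j choose q) * t ^ q * W ^ q * X ^ (j - q)) * W -
          (\<Sum>q\<le>j. real (j choose q) * t ^ q * W ^ q * X ^ (j - q)) * (t * X)"
        by (simp only: right_diff_distrib)
      also have "\<dots> = (\<Sum>q\<le>j. real (j choose q) * t ^ q * (X ^ (j - q) * W ^ (q + 1)))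
          - (\<Sum>q\<le>j. real (j choose q) * t ^ (q + 1) * (X ^ (j - q + 1) * W ^ q))"
        unfolding sum_distrib_right by (simp add: mult_ac)
      finally show "(t * (w \<bullet> z) + e \<bullet> z) ^ j * (w \<bullet> z - t * (e \<bullet> z)) =
          (\<Sum>q\<le>j. real (j choose q) * t ^ q * ((e \<bullet> z) ^ (j - q) * (w \<bullet> z) ^ (q + 1)))
          - (\<Sum>q\<le>j. real (j choose q) * t ^ (q + 1) * ((e \<bullet> z) ^ (j - q + 1) * (w \<bullet> z) ^ q))"
        unfolding X_def W_def .
    qed
    also have "\<dots> = (\<Sum>q\<le>j. real (j choose q) * t ^ q * sphere_moment e w (j - q) (q + 1))
        - (\<Sum>q\<le>j. real (j choose q) * t ^ (q + 1) * sphere_moment e w (j - q + 1) q)"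
      unfolding sphere_moment_def
      by (subst Bochner_Integration.integral_diff Bochner_Integration.integral_sum;
          (intro Bochner_Integration.integrable_sum integrable_mult_right integrable_sphere_monomial)?)+ simp
    also have "\<dots> = poly A t"
      by (simp add: A_def poly_sum poly_monom mult_ac)
    finally show ?thesis ..
  qed
  hence "A = 0" by (simp add: poly_all_0_iff_0[symmetric])
  hence "coeff A 1 = 0" by simp
  moreover have "coeff A 1 = real j * sphere_moment e w (j - 1) 2 - sphere_moment e w (j + 1) 0"
  proof -
    have 1: "(\<Sum>q\<le>j. coeff (monom (real (j choose q) * sphere_moment e w (j - q) (q + 1)) q) 1)
        = (\<Sum>q\<le>j. if q = 1 then real j * sphere_moment e w (j - 1) 2 else 0)"
      by (intro sum.cong) (auto simp: numeral_2_eq_2)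
    have 2: "(\<Sum>q\<le>j. coeff (monom (real (j choose q) * sphere_moment e w (j - q + 1) q) (q + 1)) 1)
        = (\<Sum>q\<le>j. if q = 0 then sphere_moment e w (j + 1) 0 else 0)"
      by (intro sum.cong) auto
    show ?thesis unfolding A_def coeff_diff coeff_sum 1 2 by (cases j) auto
  qed
  ultimately show ?thesis by simp
qed

text \<open>In terms of the density this is the integral of the derivative of (1 - u^2)^((n - 1) /
  2) r(u). For monomials it follows by summing the rotation identity over the n - 1 basis vectors b
  orthogonal to e0, since the squares (b . z)^2 add up to 1 - (e0 . z)^2 on the sphere.\<close>

lemma sphere_moment_recursion:
  fixes e :: "'a::euclidean_space"
  assumes n: "DIM('a) \<ge> 2" and e: "norm e = 1"
  shows "(\<integral>z. poly ([:1, 0, -1:] * pderiv r - smult (real DIM('a) - 1) ([:0, 1:] * r)) (e \<bullet> z)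
            \<partial>sphere_measure) = 0"
proof -
  obtain e0 :: 'a where e0: "e0 \<in> Basis" using nonempty_Basis by blast
  define B where "B = (Basis :: 'a set) - {e0}"
  have pair: "orthonormal_pair e0 b" if "b \<in> B" for b
    using that e0 by (auto simp: B_def orthonormal_pair_def inner_not_same_Basis)
  have cB: "real (card B) = real DIM('a) - 1" using e0 n by (simp add: B_def of_nat_diff)
  let ?m = "\<lambda>p. \<integral>z. (e0 \<bullet> z) ^ p \<partial>sphere_measure"
  have mono: "real j * (?m (j - 1) - ?m (j + 1)) = (real DIM('a) - 1) * ?m (j + 1)" for j
  proof -
    have "(real DIM('a) - 1) * ?m (j + 1) = (\<Sum>b\<in>B. ?m (j + 1))" using cB by simp
    also have "\<dots> = (\<Sum>b\<in>B. real j * sphere_moment e0 b (j - 1) 2)"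
      using sphere_moment_rotation[OF pair] by (intro sum.cong refl) (simp add: sphere_moment_def)
    also have "\<dots> = real j * (\<integral>z. (\<Sum>b\<in>B. (e0 \<bullet> z) ^ (j - 1) * (b \<bullet> z) ^ 2) \<partial>sphere_measure)"
      by (subst Bochner_Integration.integral_sum) (auto simp: sphere_moment_def sum_distrib_left)
    also have "(\<integral>z. (\<Sum>b\<in>B. (e0 \<bullet> z) ^ (j - 1) * (b \<bullet> z) ^ 2) \<partial>sphere_measure) =
        (\<integral>z. (e0 \<bullet> z) ^ (j - 1) - (e0 \<bullet> z) ^ (j - 1) * (e0 \<bullet> z) ^ 2 \<partial>sphere_measure)"
    proof (rule Bochner_Integration.integral_cong[OF refl])
      fix z :: 'a assume "z \<in> space sphere_measure"
      hence "z \<bullet> z = 1" by (simp add: norm_eq_1)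
      hence "1 = (\<Sum>b\<in>Basis. (b \<bullet> z) ^ 2)"
        by (subst (asm) euclidean_inner) (simp add: power2_eq_square inner_commute)
      also have "\<dots> = (e0 \<bullet> z) ^ 2 + (\<Sum>b\<in>B. (b \<bullet> z) ^ 2)"
        unfolding B_def using e0 by (intro sum.remove) auto
      finally have s: "(\<Sum>b\<in>B. (b \<bullet> z) ^ 2) = 1 - (e0 \<bullet> z) ^ 2" by simp
      show "(\<Sum>b\<in>B. (e0 \<bullet> z) ^ (j - 1) * (b \<bullet> z) ^ 2) = (e0 \<bullet> z) ^ (j - 1) - (e0 \<bullet> z) ^ (j - 1) * (e0 \<bullet> z) ^ 2"
        unfolding sum_distrib_left[symmetric] s right_diff_distrib by simp
    qed
    also have "\<dots> = ?m (j - 1) - (\<integral>z. (e0 \<bullet> z) ^ (j - 1) * (e0 \<bullet> z) ^ 2 \<partial>sphere_measure)"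
      using integrable_sphere_monomial[of e0 "j - 1" e0 0]
      by (intro Bochner_Integration.integral_diff) simp_all
    also have "real j * \<dots> = real j * (?m (j - 1) - ?m (j + 1))"
      by (cases j) (simp_all add: power2_eq_square mult_ac)
    finally show ?thesis ..
  qed
  let ?L = "\<lambda>p. \<integral>z. poly p (e0 \<bullet> z) \<partial>sphere_measure"
  let ?T = "\<lambda>r. [:1, 0, -1:] * pderiv r - smult (real DIM('a) - 1) ([:0, 1:] * r)"
  have L_add: "?L (p + q) = ?L p + ?L q" for p q
    unfolding poly_add by (intro Bochner_Integration.integral_add integrable_sphere_poly)
  have "?L (?T r) = 0"
  proof (induction r rule: poly_monom_induct)
    case (add p q)
    have "?T (p + q) = ?T p + ?T q"
      by (simp add: pderiv_add smult_add_right distrib_left del: mult_pCons_left)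
    hence "?L (?T (p + q)) = ?L (?T p) + ?L (?T q)" by (simp only: L_add)
    thus ?case using add by (simp only: add_0_left)
  next
    case (monom c j)
    have "poly (?T (monom c j)) u = c * (real j * (u ^ (j - 1) - u ^ (j + 1)) - (real DIM('a) - 1) * u ^ (j + 1))" for u
      by (cases j) (simp_all add: pderiv_monom poly_monom algebra_simps)
    hence "?L (?T (monom c j)) = (\<integral>z. c * (real j * ((e0 \<bullet> z) ^ (j - 1) - (e0 \<bullet> z) ^ (j + 1)) -
        (real DIM('a) - 1) * (e0 \<bullet> z) ^ (j + 1)) \<partial>sphere_measure)" by (simp only:)
    also have "\<dots> = c * (real j * (?m (j - 1) - ?m (j + 1)) - (real DIM('a) - 1) * ?m (j + 1))"
      using integrable_sphere_monomial[of e0 _ e0 0] by (simp del: power_Suc)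
    finally have "?L (?T (monom c j)) =
        c * (real j * (?m (j - 1) - ?m (j + 1)) - (real DIM('a) - 1) * ?m (j + 1))" .
    thus ?case by (simp only: mono diff_self mult_zero_right)
  qed
  also have "?L (?T r) = (\<integral>z. poly (?T r) (e \<bullet> z) \<partial>sphere_measure)"
    by (rule integral_sphere_invariant) (use e e0 in \<open>auto intro!: continuous_intros\<close>)
  finally show ?thesis by (simp only:)
qed

section \<open>Pairs of unit vectors and orthogonality of zonal polynomials\<close>

lemma unit_vector_decompose:
  fixes x y :: "'a::euclidean_space"
  assumes n: "DIM('a) \<ge> 2" and x: "norm x = 1" and y: "norm y = 1"
  obtains w s where "orthonormal_pair x w" "y = (x \<bullet> y) *\<^sub>R x + s *\<^sub>R w" "s\<^sup>2 = 1 - (x \<bullet> y)\<^sup>2"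
proof -
  define t v where "t = x \<bullet> y" and "v = y - t *\<^sub>R x"
  have xx: "x \<bullet> x = 1" "y \<bullet> y = 1" using x y by (simp_all add: norm_eq_1)
  have xv: "x \<bullet> v = 0" by (simp add: v_def t_def inner_diff_right xx)
  have vv: "v \<bullet> v = 1 - t\<^sup>2"
    by (simp add: v_def inner_diff_left inner_diff_right xx t_def inner_commute[of y x] power2_eq_square)
  show ?thesis
  proof (cases "v = 0")
    case True
    \<comment> \<open>Here y = x or y = -x, and any unit vector orthogonal to x will do; dimension
      at least 2 provides one.\<close>
    obtain w where "orthonormal_pair x w" using orthonormal_pair_exists[OF n x] .
    moreover have "y = t *\<^sub>R x + 0 *\<^sub>R w" using True by (simp add: v_def)
    moreover have "0\<^sup>2 = 1 - t\<^sup>2" using vv True by simp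
    ultimately show ?thesis using that[of w 0] unfolding t_def by blast
  next
    case False
    have "x \<bullet> sgn v = 0" unfolding sgn_div_norm using xv by simp
    moreover have "norm (sgn v) = 1" using False by (simp add: norm_sgn)
    moreover have "norm v *\<^sub>R sgn v = v" using False by (simp add: sgn_div_norm)
    hence "y = t *\<^sub>R x + norm v *\<^sub>R sgn v" by (simp add: v_def)
    moreover have "(norm v)\<^sup>2 = 1 - t\<^sup>2" using vv by (simp add: power2_norm_eq_inner)
    ultimately show ?thesis using that[of "sgn v" "norm v"] x
      unfolding t_def orthonormal_pair_def by blast
  qed
qed

lemma unit_vectors_with_inner:
  assumes n: "DIM('a::euclidean_space) \<ge> 2" and u: "- 1 \<le> u" "u \<le> 1"
  obtains x y :: "'a::euclidean_space" where "norm x = 1" "norm y = 1" "x \<bullet> y = u"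
proof -
  obtain e :: 'a where "e \<in> Basis" using nonempty_Basis by blast
  then obtain w where w: "orthonormal_pair e w" using orthonormal_pair_exists[OF n, of e] by auto
  define y where "y = u *\<^sub>R e + sqrt (1 - u\<^sup>2) *\<^sub>R w"
  have "u\<^sup>2 \<le> 1" using u by (simp add: abs_square_le_1 abs_le_iff)
  moreover have "e \<bullet> e = 1" "w \<bullet> w = 1" "e \<bullet> w = 0" "w \<bullet> e = 0"
    using w by (auto simp: orthonormal_pair_def norm_eq_1 inner_commute)
  ultimately have "norm y = 1" "e \<bullet> y = u"
    unfolding norm_eq_1 y_def by (simp_all add: inner_add_left inner_add_right power2_eq_square[symmetric])
  with w show ?thesis using that[of e y] by (simp add: orthonormal_pair_def)
qed

lemma integral_sphere_orthogonal_polynomials: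
  fixes e :: "'a::euclidean_space"
  assumes "DIM('a) \<ge> 2" "norm e = 1" "k \<noteq> l"
  shows "(\<integral>z. poly (sphere_polynomial DIM('a) k * sphere_polynomial DIM('a) l) (e \<bullet> z) \<partial>sphere_measure) = 0"
proof (rule sphere_polynomial_orthogonal[OF assms(1,3), where L = "\<lambda>p. \<integral>z. poly p (e \<bullet> z) \<partial>sphere_measure"])
  show "(\<integral>z. poly (smult c p) (e \<bullet> z) \<partial>sphere_measure) = c * (\<integral>z. poly p (e \<bullet> z) \<partial>sphere_measure)" for c p
    by simp
qed (rule sphere_moment_recursion[OF assms(1,2)])

lemma sphere_polynomial_span:
  assumes "n \<ge> 2" "degree p \<le> m"
  obtains c where "p = (\<Sum>k\<le>m. smult (c k) (sphere_polynomial n k))"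
  using poly_span_of_degrees[OF degree_sphere_polynomial[OF assms(1)] assms(2)] by blast

lemma integral_sphere_polynomial_span:
  fixes e :: "'a::euclidean_space"
  assumes n: "DIM('a) \<ge> 2" and e: "norm e = 1"
  shows "(\<integral>z. poly (sphere_polynomial DIM('a) k * (\<Sum>l\<le>m. smult (c l) (sphere_polynomial DIM('a) l))) (e \<bullet> z)
      \<partial>sphere_measure) =
    (if k \<le> m then c k * (\<integral>z. (sphere_poly DIM('a) k (e \<bullet> z))\<^sup>2 \<partial>sphere_measure) else 0)"
proof -
  let ?P = "sphere_polynomial DIM('a)"
  have "(\<integral>z. poly (?P k * (\<Sum>l\<le>m. smult (c l) (?P l))) (e \<bullet> z) \<partial>sphere_measure) =
      (\<integral>z. (\<Sum>l\<le>m. c l * poly (?P k * ?P l) (e \<bullet> z)) \<partial>sphere_measure)"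
    by (simp add: poly_sum sum_distrib_left mult_ac)
  also have "\<dots> = (\<Sum>l\<le>m. c l * (\<integral>z. poly (?P k * ?P l) (e \<bullet> z) \<partial>sphere_measure))"
    by (subst Bochner_Integration.integral_sum) (simp_all del: poly_mult)
  also have "\<dots> = (\<Sum>l\<le>m. if l = k then c k * (\<integral>z. poly (?P k * ?P k) (e \<bullet> z) \<partial>sphere_measure) else 0)"
    by (intro sum.cong refl) (auto simp: integral_sphere_orthogonal_polynomials[OF n e] simp del: poly_mult)
  finally show ?thesis by (simp add: poly_sphere_polynomial power2_eq_square)
qed

lemma integral_sphere_polynomial_lower_degree:
  fixes e :: "'a::euclidean_space"
  assumes n: "DIM('a) \<ge> 2" and e: "norm e = 1" and q: "degree q < k"
  shows "(\<integral>z. poly (sphere_polynomial DIM('a) k * q) (e \<bullet> z) \<partial>sphere_measure) = 0"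
proof -
  obtain c where "q = (\<Sum>l\<le>degree q. smult (c l) (sphere_polynomial DIM('a) l))"
    using sphere_polynomial_span[OF n order_refl] .
  thus ?thesis using integral_sphere_polynomial_span[OF n e, where k = k and m = "degree q" and c = c] q by simp
qed

text \<open>By invariance the integral is the same for every unit vector, so the number depends on
  the space alone, which is passed as a type token.\<close>

definition sphere_poly_norm2 :: "'a::euclidean_space itself \<Rightarrow> nat \<Rightarrow> real" where
  "sphere_poly_norm2 _ k =
     (\<integral>z. (sphere_poly DIM('a) k ((SOME b::'a. b \<in> Basis) \<bullet> z))\<^sup>2 \<partial>sphere_measure)"

lemma continuous_on_sphere_poly [continuous_intros]:
  "continuous_on A f \<Longrightarrow> continuous_on A (\<lambda>x. sphere_poly n k (f x))"
  unfolding poly_sphere_polynomial[symmetric] by (intro continuous_intros)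

lemma sphere_poly_norm2:
  fixes e :: "'a::euclidean_space"
  assumes "norm e = 1"
  shows "(\<integral>z. (sphere_poly DIM('a) k (e \<bullet> z))\<^sup>2 \<partial>sphere_measure) = sphere_poly_norm2 TYPE('a) k"
  unfolding sphere_poly_norm2_def
proof (rule integral_sphere_invariant[where G = "\<lambda>u. (sphere_poly DIM('a) k u)\<^sup>2", OF assms])
  have "(SOME b::'a. b \<in> Basis) \<in> Basis" by (rule someI_ex) (use nonempty_Basis in blast)
  thus "norm (SOME b::'a. b \<in> Basis) = 1" by simp
qed (intro continuous_intros)

text \<open>The integrand equals 1 at z = e, so it exceeds 1/2 on an open set, and open sets meeting
  the sphere have positive measure.\<close>

lemma sphere_poly_norm2_pos:
  assumes n: "DIM('a::euclidean_space) \<ge> 2"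
  shows "sphere_poly_norm2 TYPE('a) k > 0"
proof -
  obtain e :: 'a where "e \<in> Basis" using nonempty_Basis by blast
  hence e: "norm e = 1" by simp
  let ?g = "\<lambda>z. (sphere_poly DIM('a) k (e \<bullet> z))\<^sup>2"
  define U where "U = {z. ?g z > 1 / 2}"
  have oU: "open U" unfolding U_def by (intro open_Collect_less continuous_intros)
  have "e \<in> U" using e n by (simp add: U_def norm_eq_1 sphere_poly_1)
  hence "0 < measure sphere_measure (U \<inter> sphere 0 1)" by (intro sphere_measure_open_pos[OF oU _ e])
  have US: "U \<inter> sphere 0 1 \<in> sets sphere_measure"
    by (rule open_Int_sphere_measurable[OF oU])
  have "1 / 2 * measure sphere_measure (U \<inter> sphere 0 1) =
      (\<integral>z. 1 / 2 * indicator (U \<inter> sphere 0 1) z \<partial>sphere_measure)"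
    using US by simp
  also have "\<dots> \<le> (\<integral>z. ?g z \<partial>sphere_measure)"
  proof (rule integral_mono)
    show "integrable sphere_measure ?g" by (intro integrable_sphere_measure continuous_intros)
    show "integrable sphere_measure (\<lambda>z. 1 / 2 * indicator (U \<inter> sphere 0 1) z :: real)"
      by (intro integrable_mult_right integrable_real_indicator US) (simp add: less_top[symmetric])
    show "1 / 2 * indicator (U \<inter> sphere 0 1) z \<le> ?g z" for z
      by (auto simp: U_def indicator_def)
  qed
  finally show ?thesis using \<open>0 < measure _ _\<close> sphere_poly_norm2[OF e, of k] by simp
qed

subsection \<open>Convolution of zonal polynomials\<close>

text \<open>Write y = t x + s v with v orthogonal to x and expand (y . z)^b. Moments do not depend
  on the pair x, v, and those odd in v vanish, so s enters only through s^2 = 1 - t^2. The term with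
  q factors s has degree at most (b - q) + q in t.\<close>

lemma sphere_convolution_monomials:
  assumes n: "DIM('a::euclidean_space) \<ge> 2"
  shows "\<exists>r. degree r \<le> b \<and> (\<forall>x y :: 'a. norm x = 1 \<longrightarrow> norm y = 1 \<longrightarrow>
           (\<integral>z. (x \<bullet> z) ^ a * (y \<bullet> z) ^ b \<partial>sphere_measure) = poly r (x \<bullet> y))"
proof -
  obtain e :: 'a where "e \<in> Basis" using nonempty_Basis by blast
  then obtain w where ew: "orthonormal_pair e w" using orthonormal_pair_exists[OF n, of e] by auto
  define F where "F q = (if even q then smult (real (b choose q) * sphere_moment e w (a + (b - q)) q)
      (monom 1 (b - q) * [:1, 0, -1:] ^ (q div 2)) else 0)" for q
  have "degree (F q) \<le> b" if "q \<le> b" for q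
  proof (cases "even q")
    case True
    have "degree ([:1, 0, -1:] ^ (q div 2) :: real poly) \<le> q"
      using degree_power_le[of "[:1, 0, -1:] :: real poly" "q div 2"] True by simp
    hence "degree (monom 1 (b - q) * [:1, 0, -1:] ^ (q div 2) :: real poly) \<le> (b - q) + q"
      by (intro order.trans[OF degree_mult_le] add_mono) (simp_all add: degree_monom_le)
    thus ?thesis using that True unfolding F_def
      by (simp only: if_True) (rule order.trans[OF degree_smult_le], simp)
  qed (simp add: F_def)
  hence "degree (\<Sum>q\<le>b. F q) \<le> b" by (intro degree_sum_le) auto
  moreover have "(\<integral>z. (x \<bullet> z) ^ a * (y \<bullet> z) ^ b \<partial>sphere_measure) = poly (\<Sum>q\<le>b. F q) (x \<bullet> y)"
    if x: "norm x = 1" and y: "norm y = 1" for x y :: 'a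
  proof -
    obtain v s where v: "orthonormal_pair x v" "y = (x \<bullet> y) *\<^sub>R x + s *\<^sub>R v" "s\<^sup>2 = 1 - (x \<bullet> y)\<^sup>2"
      using unit_vector_decompose[OF n x y] .
    define t where "t = x \<bullet> y"
    have "(\<integral>z. (x \<bullet> z) ^ a * (y \<bullet> z) ^ b \<partial>sphere_measure) =
       (\<integral>z. (\<Sum>q\<le>b. real (b choose q) * s ^ q * t ^ (b - q) * ((x \<bullet> z) ^ (a + (b - q)) * (v \<bullet> z) ^ q)) \<partial>sphere_measure)"
    proof (rule Bochner_Integration.integral_cong[OF refl])
      fix z
      have "y \<bullet> z = s * (v \<bullet> z) + t * (x \<bullet> z)"
        by (subst v(2)) (simp add: inner_add_left t_def)
      hence yz: "(y \<bullet> z) ^ b = (\<Sum>q\<le>b. real (b choose q) * (s * (v \<bullet> z)) ^ q * (t * (x \<bullet> z)) ^ (b - q))"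
        by (simp only: binomial_ring)
      show "(x \<bullet> z) ^ a * (y \<bullet> z) ^ b =
         (\<Sum>q\<le>b. real (b choose q) * s ^ q * t ^ (b - q) * ((x \<bullet> z) ^ (a + (b - q)) * (v \<bullet> z) ^ q))"
        unfolding yz sum_distrib_left
        by (intro sum.cong refl) (simp only: power_mult_distrib power_add mult_ac)
    qed
    also have "\<dots> = (\<Sum>q\<le>b. real (b choose q) * s ^ q * t ^ (b - q) * sphere_moment x v (a + (b - q)) q)"
      by (subst Bochner_Integration.integral_sum) (simp_all add: sphere_moment_def)
    also have "\<dots> = (\<Sum>q\<le>b. poly (F q) t)"
    proof (intro sum.cong refl)
      fix q
      have m: "sphere_moment x v (a + (b - q)) q = sphere_moment e w (a + (b - q)) q"
        by (rule sphere_moment_eq[OF v(1) ew])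
      show "real (b choose q) * s ^ q * t ^ (b - q) * sphere_moment x v (a + (b - q)) q = poly (F q) t"
      proof (cases "even q")
        case True
        hence "s ^ q = (s\<^sup>2) ^ (q div 2)" by (simp add: power_mult[symmetric])
        also have "\<dots> = poly ([:1, 0, -1:] ^ (q div 2)) t"
          using v(3) by (simp add: t_def power2_eq_square)
        finally show ?thesis using True by (simp add: F_def m poly_monom mult_ac)
      next
        case False
        thus ?thesis by (simp add: F_def m sphere_moment_odd[OF ew])
      qed
    qed
    finally show ?thesis by (simp add: poly_sum t_def)
  qed
  ultimately show ?thesis by blast
qed

lemma sphere_convolution:
  assumes n: "DIM('a::euclidean_space) \<ge> 2"
  shows "\<exists>r. degree r \<le> degree q \<and> (\<forall>x y :: 'a. norm x = 1 \<longrightarrow> norm y = 1 \<longrightarrow>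
           (\<integral>z. poly p (x \<bullet> z) * poly q (y \<bullet> z) \<partial>sphere_measure) = poly r (x \<bullet> y))"
proof -
  have "\<forall>a b. \<exists>r. degree r \<le> b \<and> (\<forall>x y :: 'a. norm x = 1 \<longrightarrow> norm y = 1 \<longrightarrow>
           (\<integral>z. (x \<bullet> z) ^ a * (y \<bullet> z) ^ b \<partial>sphere_measure) = poly r (x \<bullet> y))"
    using sphere_convolution_monomials[OF n] by blast
  then obtain R where R: "\<And>a b. degree (R a b) \<le> b" "\<And>a b x y. norm (x::'a) = 1 \<Longrightarrow> norm y = 1 \<Longrightarrow>
           (\<integral>z. (x \<bullet> z) ^ a * (y \<bullet> z) ^ b \<partial>sphere_measure) = poly (R a b) (x \<bullet> y)"
    by metis
  define r where "r = (\<Sum>a\<le>degree p. \<Sum>b\<le>degree q. smult (coeff p a * coeff q b) (R a b))"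
  show ?thesis
  proof (intro exI[of _ r] conjI allI impI)
    show "degree r \<le> degree q"
      unfolding r_def
      by (intro degree_sum_le order.trans[OF degree_smult_le] order.trans[OF R(1)]) auto
    fix x y :: 'a assume xy: "norm x = 1" "norm y = 1"
    have "(\<integral>z. poly p (x \<bullet> z) * poly q (y \<bullet> z) \<partial>sphere_measure) =
        (\<integral>z. (\<Sum>a\<le>degree p. \<Sum>b\<le>degree q. coeff p a * coeff q b * ((x \<bullet> z) ^ a * (y \<bullet> z) ^ b)) \<partial>sphere_measure)"
      unfolding poly_altdef sum_product by (simp add: mult_ac)
    also have "\<dots> = (\<Sum>a\<le>degree p. \<Sum>b\<le>degree q. coeff p a * coeff q b *
        (\<integral>z. (x \<bullet> z) ^ a * (y \<bullet> z) ^ b \<partial>sphere_measure))"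
      by (simp add: Bochner_Integration.integral_sum)
    also have "\<dots> = poly r (x \<bullet> y)" by (simp add: R(2)[OF xy] r_def poly_sum)
    finally show "(\<integral>z. poly p (x \<bullet> z) * poly q (y \<bullet> z) \<partial>sphere_measure) = poly r (x \<bullet> y)" .
  qed
qed

text \<open>
  Convolution with a fixed zonal polynomial is self-adjoint and does not raise degrees, so it
  maps \<open>P\<^sub>k\<close> to a polynomial of degree at most \<open>k\<close> orthogonal to all \<open>P\<^sub>l\<close> with \<open>l < k\<close>.
\<close>

lemma sphere_poly_reproducing:
  fixes x y :: "'a::euclidean_space"
  assumes n: "DIM('a) \<ge> 2" and x: "norm x = 1" and y: "norm y = 1"
  shows "(\<integral>z. sphere_poly DIM('a) k (x \<bullet> z) * sphere_poly DIM('a) k (y \<bullet> z) \<partial>sphere_measure) =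
    sphere_poly_norm2 TYPE('a) k * sphere_poly DIM('a) k (x \<bullet> y)"
proof -
  let ?P = "sphere_polynomial DIM('a)"
  obtain r where r: "degree r \<le> degree (?P k)" "\<And>x y :: 'a. norm x = 1 \<Longrightarrow> norm y = 1 \<Longrightarrow>
       (\<integral>z. poly (?P k) (x \<bullet> z) * poly (?P k) (y \<bullet> z) \<partial>sphere_measure) = poly r (x \<bullet> y)"
    using sphere_convolution[OF n, of "?P k" "?P k"] by blast
  have "degree r \<le> k" using r(1) degree_sphere_polynomial[OF n, of k] by simp
  then obtain c where c: "r = (\<Sum>l\<le>k. smult (c l) (?P l))" using sphere_polynomial_span[OF n] by blast
  have "c l = 0" if l: "l < k" for l
  proof -
    \<comment> \<open>This time the degree bound is taken from the factor P_l, so r' has degree at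
      most l < k and is orthogonal to P_k. Fubini brings this convolution inside the integral that
      computes \<open>c l\<close>.\<close>
    obtain r' where r': "degree r' \<le> degree (?P l)" "\<And>x y :: 'a. norm x = 1 \<Longrightarrow> norm y = 1 \<Longrightarrow>
         (\<integral>z. poly (?P k) (x \<bullet> z) * poly (?P l) (y \<bullet> z) \<partial>sphere_measure) = poly r' (x \<bullet> y)"
      using sphere_convolution[OF n, of "?P l" "?P k"] by blast
    have "degree r' < k" using r'(1) degree_sphere_polynomial[OF n, of l] l by simp
    have "c l * sphere_poly_norm2 TYPE('a) l = (\<integral>v. poly (?P l * r) (x \<bullet> v) \<partial>sphere_measure)"
      using integral_sphere_polynomial_span[OF n x, where k = l and m = k and c = c] l sphere_poly_norm2[OF x, of l]
      unfolding c by simp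
    also have "\<dots> = (\<integral>v. (\<integral>z. poly (?P l) (x \<bullet> v) * (poly (?P k) (x \<bullet> z) * poly (?P k) (v \<bullet> z)) \<partial>sphere_measure) \<partial>sphere_measure)"
      by (intro Bochner_Integration.integral_cong refl) (simp add: r(2)[OF x])
    also have "\<dots> = (\<integral>z. (\<integral>v. poly (?P l) (x \<bullet> v) * (poly (?P k) (x \<bullet> z) * poly (?P k) (v \<bullet> z)) \<partial>sphere_measure) \<partial>sphere_measure)"
      by (rule sphere_pair.Fubini_integral[symmetric])
         (intro integrable_sphere_pair[unfolded case_prod_unfold, folded case_prod_unfold]
           continuous_intros | simp add: case_prod_unfold)+
    also have "\<dots> = (\<integral>z. poly (?P k) (x \<bullet> z) * (\<integral>v. poly (?P k) (z \<bullet> v) * poly (?P l) (x \<bullet> v) \<partial>sphere_measure) \<partial>sphere_measure)"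
      by (intro Bochner_Integration.integral_cong refl,
          subst Bochner_Integration.integral_mult_right_zero[symmetric])
         (simp add: inner_commute mult_ac)
    also have "\<dots> = (\<integral>z. poly (?P k * r') (x \<bullet> z) \<partial>sphere_measure)"
    proof (rule Bochner_Integration.integral_cong[OF refl])
      fix z :: 'a assume "z \<in> space sphere_measure"
      hence "norm z = 1" by simp
      from r'(2)[OF this x]
      show "poly (?P k) (x \<bullet> z) * (\<integral>v. poly (?P k) (z \<bullet> v) * poly (?P l) (x \<bullet> v) \<partial>sphere_measure) =
          poly (?P k * r') (x \<bullet> z)"
        by (simp add: inner_commute[of z x])
    qed
    also have "\<dots> = 0" by (rule integral_sphere_polynomial_lower_degree[OF n x \<open>degree r' < k\<close>])
    finally show ?thesis using sphere_poly_norm2_pos[OF n, of l] by simp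
  qed
  hence "r = (\<Sum>l\<le>k. if l = k then smult (c k) (?P k) else 0)"
    unfolding c by (intro sum.cong) auto
  hence rk: "r = smult (c k) (?P k)" by simp
  \<comment> \<open>The remaining factor is found at y = x, where P_k(1) = 1 and the convolution is
    the squared norm.\<close>
  have "c k = poly r (x \<bullet> x)"
    using x n by (simp add: rk norm_eq_1 poly_sphere_polynomial sphere_poly_1)
  also have "\<dots> = sphere_poly_norm2 TYPE('a) k"
    using r(2)[OF x x] sphere_poly_norm2[OF x, of k] by (simp add: poly_sphere_polynomial power2_eq_square)
  finally show ?thesis using r(2)[OF x y] by (simp add: rk poly_sphere_polynomial)
qed

text \<open>By the reproducing formula P_k(x_i . x_j) is, up to a positive factor, the integral over
  z of P_k(x_i . z) P_k(x_j . z). For each z the form of A is nonnegative at the weights c_i P_k(x_i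
  . z); integrating gives the Schur product.\<close>

lemma sphere_poly_schur:
  fixes x :: "'i \<Rightarrow> 'a::euclidean_space" and A :: "'i \<Rightarrow> 'i \<Rightarrow> real"
  assumes n: "DIM('a) \<ge> 2" and x: "\<And>i. i \<in> I \<Longrightarrow> norm (x i) = 1"
    and A: "\<And>d. (\<Sum>i\<in>I. \<Sum>j\<in>I. d i * A i j * d j) \<ge> 0"
  shows "(\<Sum>i\<in>I. \<Sum>j\<in>I. c i * (A i j * sphere_poly DIM('a) k (x i \<bullet> x j)) * c j) \<ge> 0"
proof -
  let ?P = "sphere_poly DIM('a) k" and ?nu = "sphere_poly_norm2 TYPE('a) k"
  have int: "integrable sphere_measure (\<lambda>z. ?P (x i \<bullet> z) * ?P (x j \<bullet> z))" for i j
    by (intro integrable_sphere_measure continuous_intros)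
  have "0 \<le> (\<integral>z. (\<Sum>i\<in>I. \<Sum>j\<in>I. (c i * ?P (x i \<bullet> z)) * A i j * (c j * ?P (x j \<bullet> z))) \<partial>sphere_measure)"
    by (intro Bochner_Integration.integral_nonneg A)
  also have "\<dots> = (\<integral>z. (\<Sum>i\<in>I. \<Sum>j\<in>I. c i * A i j * c j * (?P (x i \<bullet> z) * ?P (x j \<bullet> z))) \<partial>sphere_measure)"
    by (simp add: mult_ac)
  also have "\<dots> = (\<Sum>i\<in>I. \<Sum>j\<in>I. c i * A i j * c j * (\<integral>z. ?P (x i \<bullet> z) * ?P (x j \<bullet> z) \<partial>sphere_measure))"
    using int by (simp add: Bochner_Integration.integral_sum)
  also have "\<dots> = ?nu * (\<Sum>i\<in>I. \<Sum>j\<in>I. c i * (A i j * ?P (x i \<bullet> x j)) * c j)"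
    unfolding sum_distrib_left
    by (intro sum.cong refl) (simp add: sphere_poly_reproducing[OF n x x])
  finally show ?thesis using sphere_poly_norm2_pos[OF n, of k] by (simp add: zero_le_mult_iff)
qed

text \<open>For unit vectors with x . y = u the 2 x 2 matrix of P_k has diagonal 1 and off-diagonal
  entry P_k(u); the weights (1, 1) and (1, -1) give both bounds.\<close>

lemma abs_sphere_poly_le_1:
  assumes n: "n \<ge> 2" "n = DIM('a::euclidean_space)" and u: "- 1 \<le> u" "u \<le> 1"
  shows "\<bar>sphere_poly n k u\<bar> \<le> 1"
proof -
  obtain x y :: 'a where xy: "norm x = 1" "norm y = 1" "x \<bullet> y = u"
    using unit_vectors_with_inner[OF n(1)[unfolded n(2)] u] .
  define X where "X b = (if b then x else y)" for b
  have "0 \<le> (\<Sum>i\<in>UNIV. \<Sum>j\<in>UNIV. c i * (1 * sphere_poly n k (X i \<bullet> X j)) * c j)" for c :: "bool \<Rightarrow> real"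
    unfolding n(2)
  proof (rule sphere_poly_schur)
    fix d :: "bool \<Rightarrow> real"
    have "(\<Sum>i\<in>UNIV. \<Sum>j\<in>UNIV. d i * 1 * d j) = (\<Sum>i\<in>UNIV. d i)\<^sup>2"
      by (simp add: power2_eq_square sum_product)
    thus "0 \<le> (\<Sum>i\<in>UNIV. \<Sum>j\<in>UNIV. d i * 1 * d j)" by simp
  qed (use n xy in \<open>auto simp: X_def\<close>)
  from this[of "\<lambda>_. 1"] this[of "\<lambda>b. if b then 1 else - 1"] show ?thesis
    using xy n(1) by (simp add: UNIV_bool X_def inner_commute[of y x] norm_eq_1 sphere_poly_1 abs_le_iff)
qed

lemma measure_sphere_measure [simp]: "measure sphere_measure (sphere 0 1) = 1"
  using sphere_measure.prob_space by simp

lemma integral_sphere_pair_inner: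
  fixes e :: "'a::euclidean_space" and g :: "real \<Rightarrow> real"
  assumes e: "norm e = 1" and g: "continuous_on UNIV g"
  shows "(\<integral>(x, y). g (x \<bullet> y) \<partial>(sphere_measure \<Otimes>\<^sub>M (sphere_measure :: 'a measure))) = (\<integral>z. g (e \<bullet> z) \<partial>sphere_measure)"
proof -
  have "continuous_on (sphere 0 1 \<times> sphere 0 1) (\<lambda>(x::'a, y). g (x \<bullet> y))"
    unfolding case_prod_unfold by (intro continuous_on_compose2[OF g] continuous_intros) auto
  from sphere_pair.integral_fst[OF integrable_sphere_pair[OF this]]
  have "(\<integral>(x, y). g (x \<bullet> y) \<partial>(sphere_measure \<Otimes>\<^sub>M (sphere_measure :: 'a measure))) =
      (\<integral>x. (\<integral>y. g (x \<bullet> y) \<partial>sphere_measure) \<partial>(sphere_measure :: 'a measure))" by simp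
  also have "\<dots> = (\<integral>x. (\<integral>z. g (e \<bullet> z) \<partial>sphere_measure) \<partial>(sphere_measure :: 'a measure))"
    by (intro Bochner_Integration.integral_cong refl integral_sphere_invariant e g) simp
  finally show ?thesis by simp
qed

subsection \<open>Double averages of continuous kernels on the sphere\<close>

definition sphere_kernel :: "('a::euclidean_space \<Rightarrow> 'a \<Rightarrow> real) \<Rightarrow> bool" where
  "sphere_kernel Q \<longleftrightarrow> continuous_on (sphere 0 1 \<times> sphere 0 1) (\<lambda>p. Q (fst p) (snd p))"

definition pair_mean :: "('a::euclidean_space \<Rightarrow> 'a \<Rightarrow> real) \<Rightarrow> real" where
  "pair_mean Q = (\<integral>p. Q (fst p) (snd p) \<partial>(sphere_measure \<Otimes>\<^sub>M sphere_measure))"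

lemma sphere_kernel_integrable:
  "sphere_kernel Q \<Longrightarrow> integrable (sphere_measure \<Otimes>\<^sub>M sphere_measure) (\<lambda>p. Q (fst p) (snd p))"
  using integrable_sphere_pair[of Q] by (simp add: sphere_kernel_def case_prod_unfold)

lemma sphere_kernel_const: "sphere_kernel (\<lambda>x y. c)"
  and sphere_kernel_add: "sphere_kernel Q \<Longrightarrow> sphere_kernel R \<Longrightarrow> sphere_kernel (\<lambda>x y. Q x y + R x y)"
  and sphere_kernel_diff: "sphere_kernel Q \<Longrightarrow> sphere_kernel R \<Longrightarrow> sphere_kernel (\<lambda>x y. Q x y - R x y)"
  and sphere_kernel_mult: "sphere_kernel Q \<Longrightarrow> sphere_kernel R \<Longrightarrow> sphere_kernel (\<lambda>x y. Q x y * R x y)"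
  and sphere_kernel_power: "sphere_kernel Q \<Longrightarrow> sphere_kernel (\<lambda>x y. Q x y ^ m)"
  and sphere_kernel_sum: "(\<And>i. i \<in> I \<Longrightarrow> sphere_kernel (F i)) \<Longrightarrow> sphere_kernel (\<lambda>x y. \<Sum>i\<in>I. F i x y)"
  unfolding sphere_kernel_def by (intro continuous_intros; simp)+

lemma inner_unit_bounds: "norm x = 1 \<Longrightarrow> norm y = 1 \<Longrightarrow> - 1 \<le> x \<bullet> y \<and> x \<bullet> y \<le> 1"
  using Cauchy_Schwarz_ineq2[of x y] by (simp add: abs_le_iff)

lemma sphere_kernel_inner:
  assumes "continuous_on {-1..1} g"
  shows "sphere_kernel (\<lambda>x y. g (x \<bullet> y))"
  unfolding sphere_kernel_def
  by (rule continuous_on_compose2[OF assms]) (auto intro!: continuous_intros dest: inner_unit_bounds)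

lemma sphere_kernel_sphere_poly: "sphere_kernel (\<lambda>x y. sphere_poly n k (x \<bullet> y))"
  by (intro sphere_kernel_inner continuous_intros)

lemma sphere_kernel_poly: "sphere_kernel (\<lambda>x y. poly p (x \<bullet> y))"
  by (intro sphere_kernel_inner continuous_intros)

lemmas sphere_kernel_intros = sphere_kernel_const sphere_kernel_add sphere_kernel_diff
  sphere_kernel_mult sphere_kernel_power sphere_kernel_sum sphere_kernel_sphere_poly sphere_kernel_poly

lemma space_sphere_pair: "space (sphere_measure \<Otimes>\<^sub>M sphere_measure) = sphere 0 1 \<times> sphere 0 1"
  by (simp add: space_pair_measure)

lemma sphere_kernel_bounded:
  assumes "sphere_kernel Q"
  obtains B where "\<And>x y. norm x = 1 \<Longrightarrow> norm y = 1 \<Longrightarrow> \<bar>Q x y\<bar> \<le> B"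
proof -
  have "compact ((\<lambda>p. Q (fst p) (snd p)) ` (sphere 0 1 \<times> sphere 0 1))"
    using assms unfolding sphere_kernel_def by (intro compact_continuous_image compact_Times) auto
  then obtain B where "\<forall>v\<in>(\<lambda>p. Q (fst p) (snd p)) ` (sphere 0 1 \<times> sphere 0 1). norm v \<le> B"
    by (metis compact_imp_bounded bounded_iff)
  thus ?thesis by (intro that[of B]) force
qed

lemma pair_mean_diff:
  "sphere_kernel Q \<Longrightarrow> sphere_kernel R \<Longrightarrow> pair_mean (\<lambda>x y. Q x y - R x y) = pair_mean Q - pair_mean R"
  unfolding pair_mean_def by (intro Bochner_Integration.integral_diff sphere_kernel_integrable)

lemma pair_mean_cmult: "pair_mean (\<lambda>x y. c * Q x y) = c * pair_mean Q"
  unfolding pair_mean_def by simp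

lemma pair_mean_sum:
  "(\<And>i. i \<in> I \<Longrightarrow> sphere_kernel (F i)) \<Longrightarrow>
    pair_mean (\<lambda>x y. \<Sum>i\<in>I. F i x y) = (\<Sum>i\<in>I. pair_mean (F i))"
  unfolding pair_mean_def by (intro Bochner_Integration.integral_sum sphere_kernel_integrable)

lemma pair_mean_cong:
  "(\<And>x y. norm x = 1 \<Longrightarrow> norm y = 1 \<Longrightarrow> Q x y = R x y) \<Longrightarrow> pair_mean Q = pair_mean R"
  unfolding pair_mean_def
  by (intro Bochner_Integration.integral_cong refl) (auto simp: space_sphere_pair)

lemma pair_mean_mono:
  assumes "sphere_kernel Q" "sphere_kernel R"
    and "\<And>x y. norm x = 1 \<Longrightarrow> norm y = 1 \<Longrightarrow> Q x y \<le> R x y"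
  shows "pair_mean Q \<le> pair_mean R"
  unfolding pair_mean_def
  by (intro integral_mono sphere_kernel_integrable assms) (auto simp: space_sphere_pair)

lemma pair_mean_swap:
  fixes Q :: "'a::euclidean_space \<Rightarrow> 'a \<Rightarrow> real"
  assumes "sphere_kernel Q"
  shows "pair_mean (\<lambda>x y. Q y x) = pair_mean Q"
  using sphere_pair.integral_product_swap[of "\<lambda>p. Q (fst p) (snd p)"]
    sphere_kernel_integrable[OF assms]
  by (simp add: pair_mean_def case_prod_unfold borel_measurable_integrable)

lemma pair_mean_inner:
  fixes e :: "'a::euclidean_space"
  assumes "norm e = 1" "continuous_on UNIV g"
  shows "pair_mean (\<lambda>x y :: 'a. g (x \<bullet> y)) = (\<integral>z. g (e \<bullet> z) \<partial>sphere_measure)"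
  using integral_sphere_pair_inner[OF assms] by (simp add: pair_mean_def case_prod_unfold)

lemma pair_mean_orthogonal:
  assumes n: "DIM('a::euclidean_space) \<ge> 2"
  shows "pair_mean (\<lambda>x y :: 'a. sphere_poly DIM('a) k (x \<bullet> y) * sphere_poly DIM('a) l (x \<bullet> y)) =
    (if k = l then sphere_poly_norm2 TYPE('a) k else 0)"
proof -
  obtain e :: 'a where "e \<in> Basis" using nonempty_Basis by blast
  hence e: "norm e = 1" by simp
  have "pair_mean (\<lambda>x y :: 'a. sphere_poly DIM('a) k (x \<bullet> y) * sphere_poly DIM('a) l (x \<bullet> y)) =
      (\<integral>z. sphere_poly DIM('a) k (e \<bullet> z) * sphere_poly DIM('a) l (e \<bullet> z) \<partial>sphere_measure)"
    by (rule pair_mean_inner[OF e, of "\<lambda>u. sphere_poly DIM('a) k u * sphere_poly DIM('a) l u"])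
       (intro continuous_intros)
  thus ?thesis
    using integral_sphere_orthogonal_polynomials[OF n e, of k l] sphere_poly_norm2[OF e, of k]
    by (auto simp: poly_sphere_polynomial power2_eq_square)
qed

text \<open>Indexing by finite sets of points fits the range of a simple function, over which
  averages are approximated.\<close>

definition psd_on_sphere :: "('a::euclidean_space \<Rightarrow> 'a \<Rightarrow> real) \<Rightarrow> bool" where
  "psd_on_sphere Q \<longleftrightarrow> (\<forall>I c. finite I \<longrightarrow> I \<subseteq> sphere 0 1 \<longrightarrow>
     (\<Sum>x\<in>I. \<Sum>y\<in>I. c x * Q x y * c y) \<ge> 0)"

text \<open>
  The double average of a kernel is the limit of its values on discrete measures, obtained by
  replacing the identity by simple functions with values on the sphere.
\<close>

lemma pair_mean_nonneg:
  fixes Q :: "'a::euclidean_space \<Rightarrow> 'a \<Rightarrow> real"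
  assumes Q: "sphere_kernel Q" and psd: "psd_on_sphere Q"
  shows "pair_mean Q \<ge> 0"
proof -
  let ?M = "sphere_measure :: 'a measure"
  obtain s where s: "\<And>i. simple_function ?M (s i)" "\<And>x. x \<in> space ?M \<Longrightarrow> (\<lambda>i. s i x) \<longlonglongrightarrow> x"
    using borel_measurable_implies_sequence_metric[OF id_measurable_sphere_measure, of 0] by blast
  \<comment> \<open>The approximating simple functions may leave the sphere, where nothing is known
    about \<open>Q\<close>. Radial projection brings them back and keeps the limit, since x is
    nonzero.\<close>
  define r where "r i x = sphere_proj (s i x)" for i x
  have rS: "norm (r i x) = 1" for i x using sphere_proj_in_sphere[of "s i x"] by (simp add: r_def)
  have r_simple: "simple_function ?M (r i)" for i
    using simple_function_compose[OF s(1), of sphere_proj i] by (simp add: r_def[abs_def] comp_def)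
  have r_lim: "(\<lambda>i. r i x) \<longlonglongrightarrow> x" if x: "norm x = 1" for x
  proof -
    have lim: "(\<lambda>i. s i x) \<longlonglongrightarrow> x" using s(2) x by simp
    have x0: "x \<noteq> 0" using x by auto
    have "(\<lambda>i. sgn (s i x)) \<longlonglongrightarrow> sgn x" by (intro tendsto_sgn lim x0)
    moreover have "\<forall>\<^sub>F i in sequentially. sgn (s i x) = r i x"
      using tendsto_imp_eventually_ne[OF lim x0] by eventually_elim (simp add: r_def sphere_proj_def)
    ultimately show ?thesis using x by (auto simp: sgn_div_norm dest: Lim_transform_eventually)
  qed
  obtain B where B: "\<And>x y. norm x = 1 \<Longrightarrow> norm y = 1 \<Longrightarrow> \<bar>Q x y\<bar> \<le> B"
    using sphere_kernel_bounded[OF Q] by blast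
  let ?f = "\<lambda>i p. Q (r i (fst p)) (r i (snd p))"
  \<comment> \<open>On rectangles of fibres \<open>?f i\<close> is constant, so its integral is the
    quadratic form of \<open>Q\<close> at the finitely many values of \<open>r i\<close>, with the
    masses of the fibres as coefficients.\<close>
  define X where "X i a = r i -` {a} \<inter> space ?M" for i a
  define A where "A i = r i ` space ?M" for i
  have finA: "finite (A i)" for i using simple_functionD(1)[OF r_simple] by (simp add: A_def)
  have AS: "A i \<subseteq> sphere 0 1" for i by (auto simp: A_def rS)
  have Xs: "X i a \<in> sets ?M" for i a using simple_functionD(2)[OF r_simple] by (simp add: X_def)
  have f_eq: "?f i p = (\<Sum>a\<in>A i. \<Sum>b\<in>A i. Q a b * indicator (X i a \<times> X i b) p)"
    if p: "p \<in> space (?M \<Otimes>\<^sub>M ?M)" for i p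
  proof -
    obtain x y where xy: "p = (x, y)" "x \<in> space ?M" "y \<in> space ?M"
      using p by (auto simp: space_pair_measure)
    have "(\<Sum>a\<in>A i. \<Sum>b\<in>A i. Q a b * indicator (X i a \<times> X i b) p) =
        (\<Sum>a\<in>A i. \<Sum>b\<in>A i. if b = r i y then (if a = r i x then Q a b else 0) else 0)"
      using xy by (intro sum.cong refl) (auto simp: X_def indicator_def)
    also have "\<dots> = Q (r i x) (r i y)"
    proof -
      have "r i x \<in> A i" "r i y \<in> A i" using xy(2,3) unfolding A_def by blast+
      thus ?thesis using finA[of i] by simp
    qed
    finally show ?thesis using xy by simp
  qed
  have meas: "measure (?M \<Otimes>\<^sub>M ?M) (X i a \<times> X i b) = measure ?M (X i a) * measure ?M (X i b)" for i a b
    by (simp add: measure_def sphere_measure.emeasure_pair_measure_Times Xs enn2real_mult)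
  have ind: "integrable (?M \<Otimes>\<^sub>M ?M) (\<lambda>p. Q a b * indicator (X i a \<times> X i b) p)" for i a b
    by (intro integrable_mult_right integrable_real_indicator pair_measureI Xs)
       (simp add: less_top[symmetric])
  have ind_int: "(\<integral>p. Q a b * indicator (X i a \<times> X i b) p \<partial>(?M \<Otimes>\<^sub>M ?M)) =
      measure ?M (X i a) * Q a b * measure ?M (X i b)" for i a b
  proof -
    have "X i a \<times> X i b \<inter> space (?M \<Otimes>\<^sub>M ?M) = X i a \<times> X i b"
      by (intro Int_absorb2 sets.sets_into_space pair_measureI Xs)
    thus ?thesis by (simp only: Bochner_Integration.integral_mult_right_zero
          Bochner_Integration.integral_indicator meas mult_ac)
  qed
  have f_int: "integral\<^sup>L (?M \<Otimes>\<^sub>M ?M) (?f i) =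
      (\<Sum>a\<in>A i. \<Sum>b\<in>A i. measure ?M (X i a) * Q a b * measure ?M (X i b))" for i
  proof -
    have "integral\<^sup>L (?M \<Otimes>\<^sub>M ?M) (?f i) =
        (\<integral>p. (\<Sum>a\<in>A i. \<Sum>b\<in>A i. Q a b * indicator (X i a \<times> X i b) p) \<partial>(?M \<Otimes>\<^sub>M ?M))"
      by (intro Bochner_Integration.integral_cong refl f_eq)
    also have "\<dots> = (\<Sum>a\<in>A i. \<Sum>b\<in>A i. (\<integral>p. Q a b * indicator (X i a \<times> X i b) p \<partial>(?M \<Otimes>\<^sub>M ?M)))"
      by (subst Bochner_Integration.integral_sum, intro Bochner_Integration.integrable_sum ind,
          intro sum.cong refl Bochner_Integration.integral_sum ind)
    also have "\<dots> = (\<Sum>a\<in>A i. \<Sum>b\<in>A i. measure ?M (X i a) * Q a b * measure ?M (X i b))"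
      by (intro sum.cong refl ind_int)
    finally show ?thesis .
  qed
  have "(\<lambda>i. integral\<^sup>L (?M \<Otimes>\<^sub>M ?M) (?f i)) \<longlonglongrightarrow> pair_mean Q"
    unfolding pair_mean_def
  proof (rule integral_dominated_convergence[where w = "\<lambda>_. B"])
    show "(\<lambda>p. Q (fst p) (snd p)) \<in> borel_measurable (?M \<Otimes>\<^sub>M ?M)"
      using sphere_kernel_integrable[OF Q] by (rule borel_measurable_integrable)
    show "?f i \<in> borel_measurable (?M \<Otimes>\<^sub>M ?M)" for i
      by (rule measurable_cong[THEN iffD2, OF f_eq])
         (auto intro!: borel_measurable_sum borel_measurable_integrable[OF ind])
    show "AE p in ?M \<Otimes>\<^sub>M ?M. (\<lambda>i. ?f i p) \<longlonglongrightarrow> Q (fst p) (snd p)"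
    proof (rule AE_I2)
      fix p assume "p \<in> space (?M \<Otimes>\<^sub>M ?M)"
      hence p: "norm (fst p) = 1" "norm (snd p) = 1" by (auto simp: space_pair_measure)
      have "(\<lambda>i. (r i (fst p), r i (snd p))) \<longlonglongrightarrow> p"
        using tendsto_Pair[OF r_lim[OF p(1)] r_lim[OF p(2)]] by simp
      from continuous_on_tendsto_compose[OF Q[unfolded sphere_kernel_def] this]
      show "(\<lambda>i. ?f i p) \<longlonglongrightarrow> Q (fst p) (snd p)" using p rS by (cases p) simp
    qed
    show "AE p in ?M \<Otimes>\<^sub>M ?M. norm (?f i p) \<le> B" for i
      using B rS by (intro AE_I2) simp
  qed simp
  moreover have "integral\<^sup>L (?M \<Otimes>\<^sub>M ?M) (?f i) \<ge> 0" for i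
    unfolding f_int by (rule psd[unfolded psd_on_sphere_def, rule_format, OF finA AS])
  ultimately show ?thesis using LIMSEQ_le_const by blast
qed

lemma psd_on_sphere_const: "psd_on_sphere (\<lambda>x y. 1)"
  unfolding psd_on_sphere_def by (auto simp: sum_product[symmetric])

text \<open>The factor is half of 1 plus the sum of (x . b)(y . b) over the basis, a Gram kernel.
  Each of its summands merely rescales the coefficients in the form of \<open>Q\<close>.\<close>

lemma psd_on_sphere_half_one_plus_inner:
  assumes "psd_on_sphere Q"
  shows "psd_on_sphere (\<lambda>x y. (1 + x \<bullet> y) / 2 * Q x y)"
  unfolding psd_on_sphere_def
proof (intro allI impI)
  fix I :: "'a set" and c assume I: "finite I" "I \<subseteq> sphere 0 1"
  have psd: "(\<Sum>x\<in>I. \<Sum>y\<in>I. d x * Q x y * d y) \<ge> 0" for d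
    using assms I unfolding psd_on_sphere_def by blast
  have "(\<Sum>x\<in>I. \<Sum>y\<in>I. c x * ((1 + x \<bullet> y) / 2 * Q x y) * c y) =
     (\<Sum>x\<in>I. \<Sum>y\<in>I. 1 / 2 * (c x * Q x y * c y) +
        (\<Sum>b\<in>Basis. 1 / 2 * ((c x * (x \<bullet> b)) * Q x y * (c y * (y \<bullet> b)))))"
  proof (intro sum.cong refl)
    fix x y :: 'a
    have "(\<Sum>b\<in>Basis. 1 / 2 * ((c x * (x \<bullet> b)) * Q x y * (c y * (y \<bullet> b)))) =
       1 / 2 * (c x * Q x y * c y) * (\<Sum>b\<in>Basis. (x \<bullet> b) * (y \<bullet> b))"
      unfolding sum_distrib_left by (intro sum.cong) auto
    also have "\<dots> = 1 / 2 * (c x * Q x y * c y) * (x \<bullet> y)" by (simp add: euclidean_inner[of x y])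
    finally show "c x * ((1 + x \<bullet> y) / 2 * Q x y) * c y = 1 / 2 * (c x * Q x y * c y) +
        (\<Sum>b\<in>Basis. 1 / 2 * ((c x * (x \<bullet> b)) * Q x y * (c y * (y \<bullet> b))))"
      by (simp add: algebra_simps)
  qed
  also have "\<dots> = 1 / 2 * (\<Sum>x\<in>I. \<Sum>y\<in>I. c x * Q x y * c y) +
      (\<Sum>x\<in>I. \<Sum>y\<in>I. \<Sum>b\<in>Basis. 1 / 2 * ((c x * (x \<bullet> b)) * Q x y * (c y * (y \<bullet> b))))"
    by (simp only: sum.distrib sum_distrib_left)
  also have "(\<Sum>x\<in>I. \<Sum>y\<in>I. \<Sum>b\<in>Basis. 1 / 2 * ((c x * (x \<bullet> b)) * Q x y * (c y * (y \<bullet> b)))) =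
      (\<Sum>b\<in>Basis. 1 / 2 * (\<Sum>x\<in>I. \<Sum>y\<in>I. (c x * (x \<bullet> b)) * Q x y * (c y * (y \<bullet> b))))"
    unfolding sum_distrib_left by (subst sum.swap[of _ Basis]) (intro sum.cong refl sum.swap)
  finally show "(\<Sum>x\<in>I. \<Sum>y\<in>I. c x * ((1 + x \<bullet> y) / 2 * Q x y) * c y) \<ge> 0"
    using psd[of c] psd[of "\<lambda>x. c x * (x \<bullet> b)" for b]
    by (simp add: sum_nonneg)
qed

subsection \<open>Concentration\<close>

text \<open>Where the base is at most \<open>\<rho>\<close> the integral gains at most
  \<open>B * \<rho> ^ m\<close>; where it is at least r it loses at least c r^m times a positive
  mass; in between the integrand is nonpositive. As \<open>\<rho> < r\<close>, the loss
  prevails.\<close>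

lemma (in prob_space) eventually_integral_power_neg:
  fixes \<phi> \<beta> :: "'a \<Rightarrow> real"
  assumes [measurable]: "\<phi> \<in> borel_measurable M" "\<beta> \<in> borel_measurable M"
    and \<phi>: "\<And>\<omega>. \<omega> \<in> space M \<Longrightarrow> \<bar>\<phi> \<omega>\<bar> \<le> B"
    and \<beta>: "\<And>\<omega>. \<omega> \<in> space M \<Longrightarrow> 0 \<le> \<beta> \<omega> \<and> \<beta> \<omega> \<le> 1"
    and near: "\<And>\<omega>. \<omega> \<in> space M \<Longrightarrow> \<rho> < \<beta> \<omega> \<Longrightarrow> \<phi> \<omega> \<le> - c"
    and c: "c > 0" and \<rho>: "0 \<le> \<rho>" "\<rho> < r"
    and pos: "prob {\<omega> \<in> space M. r \<le> \<beta> \<omega>} > 0"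
  shows "\<forall>\<^sub>F m in sequentially. (\<integral>\<omega>. \<phi> \<omega> * \<beta> \<omega> ^ m \<partial>M) < 0"
proof -
  let ?W = "{\<omega> \<in> space M. r \<le> \<beta> \<omega>}"
  have W [measurable]: "?W \<in> events" by measurable
  have B: "B \<ge> 0" using \<phi> not_empty by (meson abs_ge_zero ex_in_conv order_trans)
  have r: "r > 0" using \<rho> by simp
  have "(\<lambda>m. (\<rho> / r) ^ m) \<longlonglongrightarrow> 0" using \<rho> by (intro LIMSEQ_realpow_zero) auto
  hence "(\<lambda>m. B * (\<rho> / r) ^ m) \<longlonglongrightarrow> B * 0" by (intro tendsto_mult_left)
  hence "\<forall>\<^sub>F m in sequentially. B * (\<rho> / r) ^ m < c * prob ?W"
    by (rule order_tendstoD) (use c pos in simp)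
  thus ?thesis
  proof eventually_elim
    case (elim m)
    have bound: "\<phi> \<omega> * \<beta> \<omega> ^ m \<le> B * \<rho> ^ m - c * r ^ m * indicator ?W \<omega>" if \<omega>: "\<omega> \<in> space M" for \<omega>
    proof (cases "\<rho> < \<beta> \<omega>")
      case True
      have "\<phi> \<omega> * \<beta> \<omega> ^ m \<le> - c * \<beta> \<omega> ^ m"
        using near[OF \<omega> True] \<beta>[OF \<omega>] by (intro mult_right_mono) auto
      also have "\<dots> \<le> - (c * r ^ m * indicator ?W \<omega>)"
        using c r \<beta>[OF \<omega>] by (auto simp: indicator_def power_mono)
      also have "\<dots> \<le> B * \<rho> ^ m - c * r ^ m * indicator ?W \<omega>" using B \<rho> by simp
      finally show ?thesis .
    next
      case False
      have "\<phi> \<omega> * \<beta> \<omega> ^ m \<le> B * \<rho> ^ m"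
        using \<phi>[OF \<omega>] \<beta>[OF \<omega>] False B by (intro mult_mono power_mono) auto
      thus ?thesis using False \<rho> by (simp add: indicator_def)
    qed
    have "(\<integral>\<omega>. \<phi> \<omega> * \<beta> \<omega> ^ m \<partial>M) \<le> (\<integral>\<omega>. B * \<rho> ^ m - c * r ^ m * indicator ?W \<omega> \<partial>M)"
    proof (rule integral_mono)
      have "\<bar>\<phi> \<omega> * \<beta> \<omega> ^ m\<bar> \<le> B * 1" if "\<omega> \<in> space M" for \<omega>
        using \<phi>[OF that] \<beta>[OF that] B unfolding abs_mult by (intro mult_mono) (auto simp: power_le_one)
      thus "integrable M (\<lambda>\<omega>. \<phi> \<omega> * \<beta> \<omega> ^ m)"
        by (intro integrable_const_bound[where B = B] AE_I2) auto
      show "integrable M (\<lambda>\<omega>. B * \<rho> ^ m - c * r ^ m * indicator ?W \<omega>)"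
        by (intro Bochner_Integration.integrable_diff integrable_mult_right integrable_real_indicator W)
           (simp_all add: less_top[symmetric])
    qed (rule bound)
    also have "\<dots> = B * \<rho> ^ m - c * r ^ m * prob ?W"
    proof -
      have "integrable M (\<lambda>\<omega>. c * r ^ m * indicator ?W \<omega> :: real)"
        by (intro integrable_mult_right integrable_real_indicator W) (simp add: less_top[symmetric])
      thus ?thesis by (simp add: prob_space)
    qed
    also have "\<dots> = r ^ m * (B * (\<rho> / r) ^ m - c * prob ?W)"
      using r by (simp add: power_divide field_simps)
    also have "\<dots> < 0" using elim r by (simp add: mult_less_0_iff)
    finally show ?case .
  qed
qed

text \<open>Compactness bounds b by some \<open>\<rho> < 1\<close> at distance at least
  \<open>\<delta>\<close> from its peak. Near a pair with inner product \<open>\<tau>\<close>,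
  continuity keeps b above a number r between \<open>\<rho>\<close> and 1 on a product of open sets,
  which has positive measure.\<close>

lemma sphere_concentration:
  fixes \<phi> :: "'a::euclidean_space \<Rightarrow> 'a \<Rightarrow> real" and b :: "real poly"
  assumes n: "DIM('a) \<ge> 2" and \<phi>: "sphere_kernel \<phi>"
    and \<tau>: "- 1 \<le> \<tau>" "\<tau> \<le> 1"
    and b01: "\<And>u. - 1 \<le> u \<Longrightarrow> u \<le> 1 \<Longrightarrow> 0 \<le> poly b u \<and> poly b u \<le> 1"
    and b1: "poly b \<tau> = 1" "\<And>u. - 1 \<le> u \<Longrightarrow> u \<le> 1 \<Longrightarrow> u \<noteq> \<tau> \<Longrightarrow> poly b u < 1"
    and c: "c > 0" and \<delta>: "\<delta> > 0"
    and near: "\<And>x y. norm x = 1 \<Longrightarrow> norm y = 1 \<Longrightarrow> \<bar>x \<bullet> y - \<tau>\<bar> < \<delta> \<Longrightarrow> \<phi> x y \<le> - c"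
  shows "\<forall>\<^sub>F m in sequentially. pair_mean (\<lambda>x y. \<phi> x y * poly (b ^ m) (x \<bullet> y)) < 0"
proof -
  let ?P = "sphere_measure \<Otimes>\<^sub>M sphere_measure :: ('a \<times> 'a) measure"
  obtain B where B: "\<And>x y. norm x = 1 \<Longrightarrow> norm y = 1 \<Longrightarrow> \<bar>\<phi> x y\<bar> \<le> B"
    using sphere_kernel_bounded[OF \<phi>] by blast
  define K where "K = {-1..1} - ball \<tau> \<delta>"
  have K: "compact K" unfolding K_def by (intro compact_diff) auto
  have "\<exists>\<rho>. 0 \<le> \<rho> \<and> \<rho> < 1 \<and> (\<forall>u\<in>K. poly b u \<le> \<rho>)"
  proof (cases "K = {}")
    case True
    thus ?thesis by (intro exI[of _ 0]) auto
  next
    case False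
    have "continuous_on K (poly b)" by (intro continuous_intros)
    then obtain v where v: "v \<in> K" "\<forall>u\<in>K. poly b u \<le> poly b v"
      using continuous_attains_sup[OF K False, of "poly b"] by blast
    hence "- 1 \<le> v" "v \<le> 1" "v \<noteq> \<tau>" using \<delta> by (auto simp: K_def)
    thus ?thesis using v b01[of v] b1(2)[of v] by (intro exI[of _ "poly b v"]) auto
  qed
  then obtain \<rho> where \<rho>: "0 \<le> \<rho>" "\<rho> < 1" "\<And>u. u \<in> K \<Longrightarrow> poly b u \<le> \<rho>" by blast
  define r where "r = (\<rho> + 1) / 2"
  have r: "\<rho> < r" "r < 1" using \<rho> by (simp_all add: r_def)
  obtain x0 y0 :: 'a where xy0: "norm x0 = 1" "norm y0 = 1" "x0 \<bullet> y0 = \<tau>"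
    using unit_vectors_with_inner[OF n \<tau>] .
  let ?O = "{p :: 'a \<times> 'a. r < poly b (fst p \<bullet> snd p)}"
  have "open ?O" by (intro open_Collect_less continuous_intros)
  moreover have "(x0, y0) \<in> ?O" using xy0 b1 r by simp
  ultimately obtain C D where CD: "open C" "open D" "(x0, y0) \<in> C \<times> D" "C \<times> D \<subseteq> ?O"
    by (rule open_prod_elim)
  have mC: "C \<inter> sphere 0 1 \<in> sets sphere_measure" and mD: "D \<inter> sphere 0 1 \<in> sets sphere_measure"
    using CD(1,2) by (simp_all only: open_Int_sphere_measurable)
  have bm: "(\<lambda>p. poly b (fst p \<bullet> snd p)) \<in> borel_measurable ?P"
    using sphere_kernel_integrable[OF sphere_kernel_poly[of b]] by (rule borel_measurable_integrable)
  have "\<forall>\<^sub>F m in sequentially. (\<integral>p. \<phi> (fst p) (snd p) * poly b (fst p \<bullet> snd p) ^ m \<partial>?P) < 0"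
  proof (rule sphere_pair.eventually_integral_power_neg[where B = B and c = c and \<rho> = \<rho> and r = r])
    show "(\<lambda>p. \<phi> (fst p) (snd p)) \<in> borel_measurable ?P"
      using sphere_kernel_integrable[OF \<phi>] by (rule borel_measurable_integrable)
    show "0 < measure ?P {\<omega> \<in> space ?P. r \<le> poly b (fst \<omega> \<bullet> snd \<omega>)}"
    proof -
      have "0 < measure sphere_measure (C \<inter> sphere 0 1) * measure sphere_measure (D \<inter> sphere 0 1)"
        using CD xy0 sphere_measure_open_pos[of C x0] sphere_measure_open_pos[of D y0] by auto
      also have "\<dots> = measure ?P ((C \<inter> sphere 0 1) \<times> (D \<inter> sphere 0 1))"
        by (simp add: measure_def sphere_measure.emeasure_pair_measure_Times mC mD enn2real_mult)
      also have "\<dots> \<le> measure ?P {\<omega> \<in> space ?P. r \<le> poly b (fst \<omega> \<bullet> snd \<omega>)}"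
      proof (rule sphere_pair.finite_measure_mono)
        show "(C \<inter> sphere 0 1) \<times> (D \<inter> sphere 0 1) \<subseteq> {\<omega> \<in> space ?P. r \<le> poly b (fst \<omega> \<bullet> snd \<omega>)}"
          using CD(4) by (fastforce simp: space_sphere_pair)
        show "{\<omega> \<in> space ?P. r \<le> poly b (fst \<omega> \<bullet> snd \<omega>)} \<in> sets ?P"
          by (rule borel_measurable_le[OF borel_measurable_const bm])
      qed
      finally show ?thesis .
    qed
    fix p assume "p \<in> space ?P"
    hence p: "norm (fst p) = 1" "norm (snd p) = 1" by (auto simp: space_sphere_pair)
    from inner_unit_bounds[OF p]
    have u: "- 1 \<le> fst p \<bullet> snd p" "fst p \<bullet> snd p \<le> 1" by auto
    show "0 \<le> poly b (fst p \<bullet> snd p) \<and> poly b (fst p \<bullet> snd p) \<le> 1" by (rule b01[OF u])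
    show "\<bar>\<phi> (fst p) (snd p)\<bar> \<le> B" by (rule B[OF p])
    assume "\<rho> < poly b (fst p \<bullet> snd p)"
    hence "fst p \<bullet> snd p \<notin> K" using \<rho>(3)[of "fst p \<bullet> snd p"] by auto
    hence "\<bar>fst p \<bullet> snd p - \<tau>\<bar> < \<delta>" using u by (auto simp: K_def dist_real_def abs_minus_commute)
    thus "\<phi> (fst p) (snd p) \<le> - c" by (rule near[OF p])
  qed (rule bm c \<rho>(1) r(1))+
  thus ?thesis by (simp add: pair_mean_def)
qed

subsection \<open>Zonal coefficients of continuous kernels\<close>

definition zonal_coeff :: "('a::euclidean_space \<Rightarrow> 'a \<Rightarrow> real) \<Rightarrow> nat \<Rightarrow> real" where
  "zonal_coeff Q k =
     pair_mean (\<lambda>x y. Q x y * sphere_poly DIM('a) k (x \<bullet> y)) / sphere_poly_norm2 TYPE('a) k"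

lemma pair_mean_zonal:
  fixes Q :: "'a::euclidean_space \<Rightarrow> 'a \<Rightarrow> real"
  assumes n: "DIM('a) \<ge> 2"
  shows "pair_mean (\<lambda>x y. Q x y * sphere_poly DIM('a) k (x \<bullet> y)) =
    sphere_poly_norm2 TYPE('a) k * zonal_coeff Q k"
  using sphere_poly_norm2_pos[OF n, of k] by (simp add: zonal_coeff_def)

lemma pair_mean_poly_span:
  fixes Q :: "'a::euclidean_space \<Rightarrow> 'a \<Rightarrow> real"
  assumes Q: "sphere_kernel Q"
  shows "pair_mean (\<lambda>x y. Q x y * poly (\<Sum>k\<le>m. smult (a k) (sphere_polynomial DIM('a) k)) (x \<bullet> y)) =
    (\<Sum>k\<le>m. a k * pair_mean (\<lambda>x y. Q x y * sphere_poly DIM('a) k (x \<bullet> y)))"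
proof -
  have "pair_mean (\<lambda>x y. Q x y * poly (\<Sum>k\<le>m. smult (a k) (sphere_polynomial DIM('a) k)) (x \<bullet> y)) =
      pair_mean (\<lambda>x y. \<Sum>k\<le>m. a k * (Q x y * sphere_poly DIM('a) k (x \<bullet> y)))"
    by (simp add: poly_sum poly_sphere_polynomial sum_distrib_left mult_ac)
  also have "\<dots> = (\<Sum>k\<le>m. pair_mean (\<lambda>x y. a k * (Q x y * sphere_poly DIM('a) k (x \<bullet> y))))"
    by (intro pair_mean_sum sphere_kernel_intros Q)
  finally show ?thesis by (simp only: pair_mean_cmult)
qed

text \<open>The weights 1 and -1 at x and y give 2 Q(x, y) <= Q(x, x) + Q(y, y).\<close>

lemma psd_on_sphere_bound:
  assumes psd: "psd_on_sphere Q" and sym: "\<And>x y. norm x = 1 \<Longrightarrow> norm y = 1 \<Longrightarrow> Q x y = Q y x"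
    and M: "\<And>x. norm x = 1 \<Longrightarrow> Q x x \<le> M" and x: "norm x = 1" and y: "norm y = 1"
  shows "Q x y \<le> M"
proof (cases "x = y")
  case False
  have "0 \<le> (\<Sum>u\<in>{x, y}. \<Sum>v\<in>{x, y}. (if u = x then 1 else - 1) * Q u v * (if v = x then 1 else - 1))"
    by (rule psd[unfolded psd_on_sphere_def, rule_format]) (use x y in auto)
  thus ?thesis using False sym[OF x y] M[OF x] M[OF y] by simp
qed (use M x in simp)

lemma psd_on_sphere_schur:
  fixes Q :: "'a::euclidean_space \<Rightarrow> 'a \<Rightarrow> real"
  assumes n: "DIM('a) \<ge> 2" and Q: "psd_on_sphere Q"
  shows "psd_on_sphere (\<lambda>x y. Q x y * sphere_poly DIM('a) k (x \<bullet> y))"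
  unfolding psd_on_sphere_def
proof (intro allI impI)
  fix I :: "'a set" and c assume I: "finite I" "I \<subseteq> sphere 0 1"
  show "(\<Sum>x\<in>I. \<Sum>y\<in>I. c x * (Q x y * sphere_poly DIM('a) k (x \<bullet> y)) * c y) \<ge> 0"
  proof (rule sphere_poly_schur[OF n, where x = "\<lambda>x. x"])
    show "norm x = 1" if "x \<in> I" for x using that I(2) by auto
    show "(\<Sum>x\<in>I. \<Sum>y\<in>I. d x * Q x y * d y) \<ge> 0" for d
      by (rule Q[unfolded psd_on_sphere_def, rule_format, OF I])
  qed
qed

text \<open>
  The weights \<open>((1 + u) / 2) ^ m\<close> have nonnegative zonal coefficients and concentrate at
  \<open>u = 1\<close>; testing \<open>Q\<close> against them gives the bound without any summability a priori.
\<close>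

lemma zonal_coeff_sum_le:
  fixes Q :: "'a::euclidean_space \<Rightarrow> 'a \<Rightarrow> real"
  assumes n: "DIM('a) \<ge> 2" and Q: "sphere_kernel Q" and psd: "psd_on_sphere Q"
    and sym: "\<And>x y. norm x = 1 \<Longrightarrow> norm y = 1 \<Longrightarrow> Q x y = Q y x"
    and M: "\<And>x. norm x = 1 \<Longrightarrow> Q x x \<le> M"
  shows "zonal_coeff Q k \<ge> 0" "(\<Sum>k<L. zonal_coeff Q k) \<le> M"
proof -
  let ?P = "sphere_poly DIM('a)"
  show f0: "zonal_coeff Q k \<ge> 0" for k
    unfolding zonal_coeff_def using sphere_poly_norm2_pos[OF n, of k]
    by (intro divide_nonneg_pos pair_mean_nonneg psd_on_sphere_schur n psd sphere_kernel_intros Q) auto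
  define b :: "real poly" where "b = [:1 / 2, 1 / 2:]"
  have b: "poly b u = (1 + u) / 2" for u by (simp add: b_def field_simps)
  \<comment> \<open>Up to the squared norm of P_k this is the k-th zonal coefficient of b^m, as
    \<open>la\<close> shows below.\<close>
  define lam where "lam m k = pair_mean (\<lambda>x y :: 'a. ?P k (x \<bullet> y) * poly (b ^ m) (x \<bullet> y))" for m k
  have psdb: "psd_on_sphere (\<lambda>x y :: 'a. poly (b ^ m) (x \<bullet> y))" for m
  proof (induction m)
    case 0
    thus ?case by (simp add: psd_on_sphere_const)
  next
    case (Suc m)
    from psd_on_sphere_half_one_plus_inner[OF this] show ?case by (simp add: b)
  qed
  have lam0: "lam m k \<ge> 0" for m k
    unfolding lam_def mult.commute[of "?P k _"]
    by (intro pair_mean_nonneg psd_on_sphere_schur n psdb sphere_kernel_intros)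
  \<comment> \<open>As b^m concentrates at u = 1, where P_k = 1, the ratio of \<open>lam m k\<close>
    to \<open>lam m 0\<close> eventually exceeds any z < 1.\<close>
  have conc: "\<forall>\<^sub>F m in sequentially. z * lam m 0 < lam m k" if z: "z < 1" for z k
  proof -
    have "continuous_on UNIV (?P k)"
      using continuous_on_sphere_poly[of UNIV "\<lambda>u. u" "DIM('a)" k] by simp
    moreover have "(1 - z) / 2 > 0" using z by simp
    ultimately obtain \<delta> where \<delta>: "\<delta> > 0" "\<And>u. dist u 1 < \<delta> \<Longrightarrow> dist (?P k u) (?P k 1) < (1 - z) / 2"
      unfolding continuous_on_iff by blast
    have P_near: "?P k u > (1 + z) / 2" if "\<bar>u - 1\<bar> < \<delta>" for u
      using \<delta>(2)[of u, unfolded dist_real_def, OF that] sphere_poly_1[OF n, of k]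
      unfolding abs_less_iff by (simp add: field_simps)
    have "\<forall>\<^sub>F m in sequentially. pair_mean (\<lambda>x y :: 'a. (z - ?P k (x \<bullet> y)) * poly (b ^ m) (x \<bullet> y)) < 0"
    proof (rule sphere_concentration[where \<tau> = 1 and \<delta> = \<delta> and c = "(1 - z) / 2"])
      fix x y :: 'a assume "\<bar>x \<bullet> y - 1\<bar> < \<delta>"
      hence "?P k (x \<bullet> y) > (1 + z) / 2" by (rule P_near)
      thus "z - ?P k (x \<bullet> y) \<le> - ((1 - z) / 2)" by (simp add: field_simps)
    qed (use n z \<delta> in \<open>auto simp: b intro!: sphere_kernel_intros\<close>)
    moreover have "pair_mean (\<lambda>x y :: 'a. (z - ?P k (x \<bullet> y)) * poly (b ^ m) (x \<bullet> y)) = z * lam m 0 - lam m k" for m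
    proof -
      have "pair_mean (\<lambda>x y :: 'a. (z - ?P k (x \<bullet> y)) * poly (b ^ m) (x \<bullet> y)) =
          pair_mean (\<lambda>x y :: 'a. z * (?P 0 (x \<bullet> y) * poly (b ^ m) (x \<bullet> y)) - ?P k (x \<bullet> y) * poly (b ^ m) (x \<bullet> y))"
        using n by (simp add: sphere_poly_0 left_diff_distrib)
      thus ?thesis unfolding lam_def pair_mean_cmult[symmetric]
        by (subst (asm) pair_mean_diff) (auto intro!: sphere_kernel_intros)
    qed
    ultimately show ?thesis by simp
  qed
  \<comment> \<open>The mean of Q b^m is a finite sum because b^m has degree m. It is at most the
    mean of M b^m, since b is nonnegative on [-1, 1] and \<open>Q\<close> is bounded by M off the
    diagonal too.\<close>
  have upper: "(\<Sum>k\<le>m. lam m k * zonal_coeff Q k) \<le> M * lam m 0" for m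
  proof -
    have "degree (b ^ m) \<le> m" using degree_power_le[of b m] by (simp add: b_def)
    then obtain a where a: "b ^ m = (\<Sum>k\<le>m. smult (a k) (sphere_polynomial DIM('a) k))"
      using sphere_polynomial_span[OF n] by blast
    have la: "lam m k = a k * sphere_poly_norm2 TYPE('a) k" if "k \<le> m" for k
    proof -
      have "lam m k = (\<Sum>l\<le>m. a l * pair_mean (\<lambda>x y :: 'a. ?P k (x \<bullet> y) * ?P l (x \<bullet> y)))"
        unfolding lam_def a by (intro pair_mean_poly_span sphere_kernel_intros)
      also have "\<dots> = (\<Sum>l\<le>m. if l = k then a k * sphere_poly_norm2 TYPE('a) k else 0)"
        by (intro sum.cong refl) (auto simp: pair_mean_orthogonal[OF n])
      finally show ?thesis using that by simp
    qed
    have "pair_mean (\<lambda>x y. Q x y * poly (b ^ m) (x \<bullet> y)) = (\<Sum>k\<le>m. lam m k * zonal_coeff Q k)"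
      unfolding a pair_mean_poly_span[OF Q] pair_mean_zonal[OF n]
      by (intro sum.cong refl) (simp add: la)
    moreover have "pair_mean (\<lambda>x y. Q x y * poly (b ^ m) (x \<bullet> y)) \<le>
        pair_mean (\<lambda>x y :: 'a. M * (?P 0 (x \<bullet> y) * poly (b ^ m) (x \<bullet> y)))"
    proof (intro pair_mean_mono sphere_kernel_intros Q)
      fix x y :: 'a assume xy: "norm x = 1" "norm y = 1"
      have "poly (b ^ m) (x \<bullet> y) \<ge> 0" using inner_unit_bounds[OF xy] by (simp add: b)
      from mult_right_mono[OF psd_on_sphere_bound[OF psd sym M xy] this]
      show "Q x y * poly (b ^ m) (x \<bullet> y) \<le> M * (?P 0 (x \<bullet> y) * poly (b ^ m) (x \<bullet> y))"
        unfolding sphere_poly_0[OF n] mult_1_left .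
    qed
    moreover have "pair_mean (\<lambda>x y :: 'a. M * (?P 0 (x \<bullet> y) * poly (b ^ m) (x \<bullet> y))) = M * lam m 0"
      unfolding lam_def by (rule pair_mean_cmult)
    ultimately show ?thesis by (simp only:)
  qed
  show "(\<Sum>k<L. zonal_coeff Q k) \<le> M"
  proof (rule field_le_mult_one_interval)
    fix z :: real assume z: "0 < z" "z < 1"
    have "\<forall>\<^sub>F m in sequentially. \<forall>k\<in>{..<L}. z * lam m 0 < lam m k"
      by (rule eventually_ball_finite) (use conc[OF z(2)] in auto)
    \<comment> \<open>The case z = 0, k = 0 records that \<open>lam m 0\<close> is positive, so that
      it can be cancelled at the end.\<close>
    moreover have "\<forall>\<^sub>F m in sequentially. 0 * lam m 0 < lam m 0" by (rule conc) simp
    ultimately have "\<forall>\<^sub>F m in sequentially.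
        (\<forall>k\<in>{..<L}. z * lam m 0 < lam m k) \<and> 0 * lam m 0 < lam m 0 \<and> L \<le> m"
      using eventually_ge_at_top[of L] by (intro eventually_conj)
    from eventually_happens'[OF sequentially_bot this]
    obtain m where m: "\<forall>k\<in>{..<L}. z * lam m 0 < lam m k" "0 < lam m 0" "L \<le> m" by auto
    have "z * lam m 0 * (\<Sum>k<L. zonal_coeff Q k) = (\<Sum>k<L. z * lam m 0 * zonal_coeff Q k)"
      by (rule sum_distrib_left)
    also have "\<dots> \<le> (\<Sum>k<L. lam m k * zonal_coeff Q k)"
      using m(1) f0 by (intro sum_mono mult_right_mono) (blast intro: less_imp_le)+
    also have "\<dots> \<le> (\<Sum>k\<le>m. lam m k * zonal_coeff Q k)"
      using m(3) f0 lam0 by (intro sum_mono2) auto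
    also have "\<dots> \<le> M * lam m 0" by (rule upper)
    finally have "lam m 0 * (z * (\<Sum>k<L. zonal_coeff Q k)) \<le> lam m 0 * M" by (simp add: mult_ac)
    thus "z * (\<Sum>k<L. zonal_coeff Q k) \<le> M" using m(2) by simp
  qed
qed

section \<open>Absolutely convergent zonal series\<close>

lemma summable_sphere_series:
  assumes "DIM('a::euclidean_space) \<ge> 2" "summable (\<lambda>k. \<bar>c k\<bar>)" "- 1 \<le> u" "u \<le> 1"
  shows "summable (\<lambda>k. \<bar>c k * sphere_poly DIM('a) k u\<bar>)"
proof (rule summable_comparison_test_ev[OF always_eventually assms(2)], rule allI)
  fix k
  show "norm \<bar>c k * sphere_poly DIM('a) k u\<bar> \<le> \<bar>c k\<bar>"
    using abs_sphere_poly_le_1[OF assms(1) refl assms(3,4), of k]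
    by (simp add: abs_mult mult_left_le)
qed

lemma continuous_on_sphere_series:
  assumes n: "DIM('a::euclidean_space) \<ge> 2" and c: "summable (\<lambda>k. \<bar>c k\<bar>)"
  shows "continuous_on {-1..1} (sphere_series DIM('a) c)"
proof -
  have "uniform_limit {-1..1} (\<lambda>m u. \<Sum>k<m. c k * sphere_poly DIM('a) k u)
      (\<lambda>u. \<Sum>k. c k * sphere_poly DIM('a) k u) sequentially"
  proof (rule Weierstrass_m_test[OF _ c])
    fix k u assume "u \<in> {-1..1::real}"
    thus "norm (c k * sphere_poly DIM('a) k u) \<le> \<bar>c k\<bar>"
      using abs_sphere_poly_le_1[OF n refl, of u k] by (simp add: abs_mult mult_left_le)
  qed
  thus ?thesis unfolding sphere_series_def[abs_def]
    by (rule uniform_limit_theorem[rotated])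
       (auto intro!: always_eventually continuous_intros)
qed

text \<open>As |P_k| <= 1, the coefficients dominate the terms and integration is termwise.
  Consequently a kernel and the series of its zonal coefficients have the same averages against all
  polynomials.\<close>

lemma pair_mean_sphere_series:
  assumes n: "DIM('a::euclidean_space) \<ge> 2" and c: "summable (\<lambda>k. \<bar>c k\<bar>)"
  shows "pair_mean (\<lambda>x y :: 'a. sphere_series DIM('a) c (x \<bullet> y) * sphere_poly DIM('a) l (x \<bullet> y)) =
    sphere_poly_norm2 TYPE('a) l * c l"
proof -
  let ?M = "sphere_measure \<Otimes>\<^sub>M sphere_measure :: ('a \<times> 'a) measure"
  let ?P = "sphere_poly DIM('a)"
  let ?f = "\<lambda>k p. c k * (?P k (fst p \<bullet> snd p) * ?P l (fst p \<bullet> snd p))"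
  have f_le: "norm (?f k p) \<le> \<bar>c k\<bar>" if "p \<in> space ?M" for k p
  proof -
    have p: "norm (fst p) = 1" "norm (snd p) = 1" using that by (auto simp: space_sphere_pair)
    have "\<bar>?P k (fst p \<bullet> snd p)\<bar> * \<bar>?P l (fst p \<bullet> snd p)\<bar> \<le> 1 * 1"
      using inner_unit_bounds[OF p] by (intro mult_mono abs_sphere_poly_le_1[OF n refl]) auto
    thus ?thesis by (simp add: abs_mult mult_left_le)
  qed
  have f_int: "integrable ?M (?f k)" for k
    by (rule integrable_mult_right, rule sphere_kernel_integrable[of "\<lambda>x y. ?P k (x \<bullet> y) * ?P l (x \<bullet> y)"])
       (intro sphere_kernel_intros)
  have "pair_mean (\<lambda>x y :: 'a. sphere_series DIM('a) c (x \<bullet> y) * ?P l (x \<bullet> y)) = (\<integral>p. (\<Sum>k. ?f k p) \<partial>?M)"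
    unfolding pair_mean_def
  proof (intro Bochner_Integration.integral_cong refl)
    fix p assume "p \<in> space ?M"
    hence p: "norm (fst p) = 1" "norm (snd p) = 1" by (auto simp: space_sphere_pair)
    have "summable (\<lambda>k. c k * ?P k (fst p \<bullet> snd p))"
      using summable_sphere_series[OF n c] inner_unit_bounds[OF p] by (blast intro: summable_rabs_cancel)
    from suminf_mult2[OF this, of "?P l (fst p \<bullet> snd p)"]
    show "sphere_series DIM('a) c (fst p \<bullet> snd p) * ?P l (fst p \<bullet> snd p) = (\<Sum>k. ?f k p)"
      by (simp add: sphere_series_def mult_ac)
  qed
  also have "\<dots> = (\<Sum>k. integral\<^sup>L ?M (?f k))"
  proof (rule integral_suminf[OF f_int])
    show "AE p in ?M. summable (\<lambda>k. norm (?f k p))"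
    proof (rule AE_I2)
      fix p assume "p \<in> space ?M"
      thus "summable (\<lambda>k. norm (?f k p))"
        by (intro summable_comparison_test_ev[OF always_eventually c]) (use f_le in force)
    qed
    show "summable (\<lambda>k. \<integral>p. norm (?f k p) \<partial>?M)"
    proof (rule summable_comparison_test_ev[OF always_eventually c], rule allI)
      fix k
      have "(\<integral>p. norm (?f k p) \<partial>?M) \<le> (\<integral>p. \<bar>c k\<bar> \<partial>?M)"
        by (rule integral_mono[OF integrable_norm[OF f_int]]) (use f_le in auto)
      thus "norm (\<integral>p. norm (?f k p) \<partial>?M) \<le> \<bar>c k\<bar>"
        using sphere_pair.prob_space[where 'a = 'a] by simp
    qed
  qed
  also have "\<dots> = (\<Sum>k. if k = l then sphere_poly_norm2 TYPE('a) l * c l else 0)"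
  proof (intro suminf_cong)
    fix k
    have "integral\<^sup>L ?M (?f k) = c k * pair_mean (\<lambda>x y :: 'a. ?P k (x \<bullet> y) * ?P l (x \<bullet> y))"
      by (simp add: pair_mean_def)
    thus "integral\<^sup>L ?M (?f k) = (if k = l then sphere_poly_norm2 TYPE('a) l * c l else 0)"
      unfolding pair_mean_orthogonal[OF n] by auto
  qed
  also have "\<dots> = sphere_poly_norm2 TYPE('a) l * c l"
    by (subst suminf_finite[of "{l}"]) auto
  finally show ?thesis .
qed

text \<open>\<open>Q\<close> minus its series averages to zero against every polynomial. If the
  series were positive at \<open>\<tau>\<close>, this difference would be uniformly negative for x .
  y near \<open>\<tau>\<close>, and a power peaking at \<open>\<tau>\<close> would give a negative
  average. The series is never compared with \<open>Q\<close> pointwise.\<close>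

lemma sphere_series_zonal_coeff_nonpos:
  fixes Q :: "'a::euclidean_space \<Rightarrow> 'a \<Rightarrow> real"
  assumes n: "DIM('a) \<ge> 2" and Q: "sphere_kernel Q"
    and sum: "summable (\<lambda>k. \<bar>zonal_coeff Q k\<bar>)" and \<tau>: "- 1 \<le> \<tau>" "\<tau> \<le> 1"
    and near: "\<And>\<eta>. \<eta> > 0 \<Longrightarrow> \<exists>\<delta>>0. \<forall>x y. norm x = 1 \<longrightarrow> norm y = 1 \<longrightarrow> \<bar>x \<bullet> y - \<tau>\<bar> < \<delta> \<longrightarrow> Q x y \<le> \<eta>"
  shows "sphere_series DIM('a) (zonal_coeff Q) \<tau> \<le> 0"
proof (rule ccontr)
  assume neg: "\<not> ?thesis"
  define g where "g = sphere_series DIM('a) (zonal_coeff Q)"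
  \<comment> \<open>A quarter leaves room: near \<open>\<tau>\<close> the series exceeds 3c while
    \<open>Q\<close> is at most c.\<close>
  define c where "c = g \<tau> / 4"
  have c: "c > 0" using neg by (simp add: c_def g_def)
  have g_cont: "continuous_on {-1..1} g" unfolding g_def by (rule continuous_on_sphere_series[OF n sum])
  have \<phi>: "sphere_kernel (\<lambda>x y. Q x y - g (x \<bullet> y))"
    by (intro sphere_kernel_intros Q sphere_kernel_inner g_cont)
  obtain \<delta>1 where \<delta>1: "\<delta>1 > 0" "\<And>u. u \<in> {-1..1} \<Longrightarrow> dist u \<tau> < \<delta>1 \<Longrightarrow> dist (g u) (g \<tau>) < c"
    using g_cont \<tau> c unfolding continuous_on_iff by (metis atLeastAtMost_iff)
  obtain \<delta>2 where \<delta>2: "\<delta>2 > 0" "\<And>x y. norm x = 1 \<Longrightarrow> norm y = 1 \<Longrightarrow> \<bar>x \<bullet> y - \<tau>\<bar> < \<delta>2 \<Longrightarrow> Q x y \<le> c"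
    using near[OF c] by blast
  \<comment> \<open>Two points of [-1, 1] are at distance at most 2, so the divisor 4 keeps this
    parabola in [0, 1]; it equals 1 only at \<open>\<tau>\<close>.\<close>
  define b where "b = 1 - smult (1 / 4) ([:- \<tau>, 1:] ^ 2)"
  have b: "poly b u = 1 - (u - \<tau>)\<^sup>2 / 4" for u by (simp add: b_def)
  have b_range: "0 \<le> poly b u" if "- 1 \<le> u" "u \<le> 1" for u
  proof -
    have "\<bar>u - \<tau>\<bar> \<le> 2" using that \<tau> by linarith
    hence "(u - \<tau>)\<^sup>2 \<le> 2\<^sup>2" using abs_le_square_iff[of "u - \<tau>" 2] by simp
    thus ?thesis by (simp add: b)
  qed
  have conc: "\<forall>\<^sub>F m in sequentially. pair_mean (\<lambda>x y. (Q x y - g (x \<bullet> y)) * poly (b ^ m) (x \<bullet> y)) < 0"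
  proof (rule sphere_concentration[where \<tau> = \<tau> and \<delta> = "min \<delta>1 \<delta>2" and c = c, OF n \<phi> \<tau>])
    fix x y :: 'a assume xy: "norm x = 1" "norm y = 1" "\<bar>x \<bullet> y - \<tau>\<bar> < min \<delta>1 \<delta>2"
    have "dist (g (x \<bullet> y)) (g \<tau>) < c"
      using inner_unit_bounds[OF xy(1,2)] xy(3) by (intro \<delta>1) (auto simp: dist_real_def)
    moreover have "Q x y \<le> c" using xy by (intro \<delta>2) auto
    ultimately show "Q x y - g (x \<bullet> y) \<le> - c" 
      unfolding dist_real_def abs_less_iff c_def by linarith
  qed (use c \<delta>1 \<delta>2 b_range in \<open>auto simp: b\<close>)
  have zero: "pair_mean (\<lambda>x y. (Q x y - g (x \<bullet> y)) * poly h (x \<bullet> y)) = 0" for h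
  proof -
    obtain a where a: "h = (\<Sum>k\<le>degree h. smult (a k) (sphere_polynomial DIM('a) k))"
      using sphere_polynomial_span[OF n order_refl] .
    have "pair_mean (\<lambda>x y. (Q x y - g (x \<bullet> y)) * sphere_poly DIM('a) k (x \<bullet> y)) = 0" for k
    proof -
      have "pair_mean (\<lambda>x y. (Q x y - g (x \<bullet> y)) * sphere_poly DIM('a) k (x \<bullet> y)) =
          pair_mean (\<lambda>x y. Q x y * sphere_poly DIM('a) k (x \<bullet> y)) -
          pair_mean (\<lambda>x y :: 'a. g (x \<bullet> y) * sphere_poly DIM('a) k (x \<bullet> y))"
        unfolding left_diff_distrib
        by (intro pair_mean_diff sphere_kernel_intros Q sphere_kernel_inner g_cont)
      thus ?thesis unfolding g_def pair_mean_sphere_series[OF n sum] pair_mean_zonal[OF n] by simp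
    qed
    thus ?thesis by (subst a, subst pair_mean_poly_span[OF \<phi>]) simp
  qed
  from eventually_happens'[OF sequentially_bot conc] show False unfolding zero by simp
qed

subsection \<open>Kernels on the disjoint union of spheres\<close>

lemma psd_matrixD: "psd_matrix I A \<Longrightarrow> 0 \<le> (\<Sum>i\<in>I. \<Sum>j\<in>I. c i * A i j * c j)"
  by (simp add: psd_matrix_def)

lemma positive_kernel_finite:
  assumes W: "positive_kernel V W" and I: "finite I" and p: "\<And>i. i \<in> I \<Longrightarrow> p i \<in> V"
  shows "(\<Sum>i\<in>I. \<Sum>j\<in>I. c i * W (p i) (p j) * c j) \<ge> 0"
proof -
  obtain h where h: "bij_betw h {1..card I} I" using ex_bij_betw_nat_finite_1[OF I] by blast
  hence hI: "h i \<in> I" if "i \<in> {1..card I}" for i using that by (auto simp: bij_betw_def)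
  have "psd_matrix {1..card I} (\<lambda>i j. W (p (h i)) (p (h j)))"
    using W hI p unfolding positive_kernel_def by simp
  hence "0 \<le> (\<Sum>i\<in>{1..card I}. \<Sum>j\<in>{1..card I}. c (h i) * W (p (h i)) (p (h j)) * c (h j))"
    by (rule psd_matrixD[where c = "\<lambda>i. c (h i)"])
  also have "\<dots> = (\<Sum>i\<in>{1..card I}. \<Sum>j\<in>I. c (h i) * W (p (h i)) (p j) * c j)"
    by (intro sum.cong refl sum.reindex_bij_betw[OF h])
  also have "\<dots> = (\<Sum>i\<in>I. \<Sum>j\<in>I. c i * W (p i) (p j) * c j)"
    by (rule sum.reindex_bij_betw[OF h])
  finally show ?thesis .
qed

lemma positive_kernelI:
  fixes V :: "'a::topological_space set"
  assumes "symmetric_kernel V W"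
    and "\<And>(I :: nat set) p c. finite I \<Longrightarrow> (\<And>i. i \<in> I \<Longrightarrow> p i \<in> V) \<Longrightarrow>
      (\<Sum>i\<in>I. \<Sum>j\<in>I. c i * W (p i) (p j) * c j) \<ge> 0"
  shows "positive_kernel V W"
  unfolding positive_kernel_def psd_matrix_def
proof (intro conjI allI impI ballI assms(1))
  fix m :: nat and p :: "nat \<Rightarrow> 'a" assume p: "\<forall>i\<in>{1..m}. p i \<in> V"
  show "W (p i) (p j) = W (p j) (p i)" if "i \<in> {1..m}" "j \<in> {1..m}" for i j
    using assms(1) p that unfolding symmetric_kernel_def by blast
  show "0 \<le> (\<Sum>i\<in>{1..m}. \<Sum>j\<in>{1..m}. c i * W (p i) (p j) * c j)" for c
    by (rule assms(2)) (use p in auto)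
qed

lemma kernel_on_component:
  fixes W :: "'a::euclidean_space \<times> nat \<Rightarrow> 'a \<times> nat \<Rightarrow> real"
  assumes "kernel_on (sphere 0 1 \<times> A) W" "i \<in> A" "j \<in> A"
  shows "sphere_kernel (\<lambda>x y. W (x, i) (y, j))"
proof -
  have "continuous_on (sphere 0 1 \<times> sphere 0 1) (\<lambda>p. (\<lambda>(x, y). W x y) ((fst p, i), (snd p, j)))"
    by (rule continuous_on_compose2[OF assms(1)[unfolded kernel_on_def]])
       (use assms(2,3) in \<open>auto intro!: continuous_intros\<close>)
  thus ?thesis by (simp add: sphere_kernel_def)
qed

text \<open>Indicators of single indices are continuous on a discrete space, so the kernel is a
  finite sum of products of continuous functions.\<close>

lemma kernel_on_inner:
  fixes g :: "nat \<Rightarrow> nat \<Rightarrow> real \<Rightarrow> real"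
  assumes g: "\<And>i j. i \<in> {1..N} \<Longrightarrow> j \<in> {1..N} \<Longrightarrow> continuous_on {-1..1} (g i j)"
  shows "kernel_on (sphere (0::'a::euclidean_space) 1 \<times> {1..N}) (\<lambda>(x, i) (y, j). g i j (x \<bullet> y))"
proof -
  let ?V = "sphere (0::'a) 1 \<times> {1..N}"
  define ind :: "nat \<Rightarrow> nat \<Rightarrow> real" where "ind i = (\<lambda>k. if k = i then 1 else 0)" for i
  have disc: "continuous_on A (\<lambda>q. ind i (h q))" if "continuous_on A h" for A i and h :: "('a \<times> nat) \<times> ('a \<times> nat) \<Rightarrow> nat"
    by (rule continuous_on_compose2[OF _ that, of UNIV]) (simp_all add: continuous_on_discrete)
  have "continuous_on (?V \<times> ?V) (\<lambda>q. \<Sum>i\<in>{1..N}. \<Sum>j\<in>{1..N}.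
      ind i (snd (fst q)) * ind j (snd (snd q)) * g i j (fst (fst q) \<bullet> fst (snd q)))"
  proof (intro continuous_on_sum continuous_on_mult disc continuous_intros)
    fix i j assume "i \<in> {1..N}" "j \<in> {1..N}"
    show "continuous_on (?V \<times> ?V) (\<lambda>q. g i j (fst (fst q) \<bullet> fst (snd q)))"
      by (rule continuous_on_compose2[OF g[OF \<open>i \<in> _\<close> \<open>j \<in> _\<close>]])
         (auto intro!: continuous_intros dest: inner_unit_bounds)
  qed
  moreover have "(\<Sum>i\<in>{1..N}. \<Sum>j\<in>{1..N}.
      ind i (snd (fst q)) * ind j (snd (snd q)) * g i j (fst (fst q) \<bullet> fst (snd q))) =
      (\<lambda>(p, p'). (\<lambda>(x, i) (y, j). g i j (x \<bullet> y)) p p') q" if "q \<in> ?V \<times> ?V" for q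
  proof -
    obtain x i y j where q: "q = ((x, i), (y, j))" by (metis prod.collapse)
    hence ij: "i \<in> {1..N}" "j \<in> {1..N}" using that by auto
    have "(\<Sum>i'\<in>{1..N}. \<Sum>j'\<in>{1..N}. ind i' i * ind j' j * g i' j' (x \<bullet> y)) =
        (\<Sum>i'\<in>{1..N}. \<Sum>j'\<in>{1..N}. if j' = j then (if i' = i then g i' j' (x \<bullet> y) else 0) else 0)"
      by (intro sum.cong refl) (auto simp: ind_def)
    thus ?thesis using q ij by simp
  qed
  ultimately show ?thesis unfolding kernel_on_def
    by (subst continuous_on_cong[OF refl]) auto
qed

text \<open>For a fixed vector d, combine the blocks with weights d_i d_j and multiply by P_k(x .
  y). The result is positive on the sphere: its form with coefficients c is that of \<open>W\<close>
  times P_k at the points (x, i) with coefficients c_x d_i. Its average is the form of the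
  coefficient matrix at d, up to the squared norm.\<close>

lemma zonal_coeff_psd:
  fixes W :: "'a::euclidean_space \<times> nat \<Rightarrow> 'a \<times> nat \<Rightarrow> real"
  assumes n: "DIM('a) \<ge> 2" and W: "positive_kernel (sphere 0 1 \<times> {1..N}) W"
  shows "psd_matrix {1..N} (\<lambda>i j. zonal_coeff (\<lambda>x y. W (x, i) (y, j)) k)"
  unfolding psd_matrix_def
proof (intro conjI ballI allI)
  let ?V = "sphere (0::'a) 1 \<times> {1..N}"
  let ?P = "sphere_poly DIM('a) k" and ?nu = "sphere_poly_norm2 TYPE('a) k"
  have sym: "symmetric_kernel ?V W" using W by (simp add: positive_kernel_def)
  have cont: "sphere_kernel (\<lambda>x y. W (x, i) (y, j))" if "i \<in> {1..N}" "j \<in> {1..N}" for i j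
    using sym that kernel_on_component unfolding symmetric_kernel_def by blast
  {
    fix i j assume ij: "i \<in> {1..N}" "j \<in> {1..N}"
    have "pair_mean (\<lambda>x y. W (x, i) (y, j) * ?P (x \<bullet> y)) = pair_mean (\<lambda>x y. W (y, j) (x, i) * ?P (y \<bullet> x))"
      using sym ij unfolding symmetric_kernel_def
      by (intro pair_mean_cong) (simp add: inner_commute)
    also have "\<dots> = pair_mean (\<lambda>x y. W (x, j) (y, i) * ?P (x \<bullet> y))"
      by (rule pair_mean_swap[of "\<lambda>x y. W (x, j) (y, i) * ?P (x \<bullet> y)"])
         (intro sphere_kernel_intros cont ij)
    finally show "zonal_coeff (\<lambda>x y. W (x, i) (y, j)) k = zonal_coeff (\<lambda>x y. W (x, j) (y, i)) k"
      by (simp add: zonal_coeff_def)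
  }
  fix d :: "nat \<Rightarrow> real"
  define Q where "Q x y = (\<Sum>i\<in>{1..N}. \<Sum>j\<in>{1..N}. d i * d j * (W (x, i) (y, j) * ?P (x \<bullet> y)))" for x y
  have contQ: "sphere_kernel Q"
    unfolding Q_def[abs_def] by (intro sphere_kernel_intros cont)
  have "psd_on_sphere Q"
    unfolding psd_on_sphere_def
  proof (intro allI impI)
    fix I :: "'a set" and c assume I: "finite I" "I \<subseteq> sphere 0 1"
    let ?J = "I \<times> {1..N}"
    have "0 \<le> (\<Sum>p\<in>?J. \<Sum>q\<in>?J. (c (fst p) * d (snd p)) * (W p q * ?P (fst p \<bullet> fst q)) * (c (fst q) * d (snd q)))"
    proof (rule sphere_poly_schur[OF n, where x = fst])
      show "norm (fst p) = 1" if "p \<in> ?J" for p using that I by auto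
      show "0 \<le> (\<Sum>p\<in>?J. \<Sum>q\<in>?J. e p * W p q * e q)" for e
        by (rule positive_kernel_finite[OF W, where p = "\<lambda>p. p"]) (use I in auto)
    qed
    also have "\<dots> = (\<Sum>x\<in>I. \<Sum>i\<in>{1..N}. \<Sum>y\<in>I. \<Sum>j\<in>{1..N}.
        c x * (d i * d j * (W (x, i) (y, j) * ?P (x \<bullet> y))) * c y)"
      by (simp add: sum.cartesian_product' mult_ac)
    also have "\<dots> = (\<Sum>x\<in>I. \<Sum>y\<in>I. \<Sum>i\<in>{1..N}. \<Sum>j\<in>{1..N}.
        c x * (d i * d j * (W (x, i) (y, j) * ?P (x \<bullet> y))) * c y)"
      by (intro sum.cong refl sum.swap)
    also have "\<dots> = (\<Sum>x\<in>I. \<Sum>y\<in>I. c x * Q x y * c y)"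
      by (simp only: Q_def sum_distrib_left sum_distrib_right)
    finally show "0 \<le> (\<Sum>x\<in>I. \<Sum>y\<in>I. c x * Q x y * c y)" .
  qed
  hence "0 \<le> pair_mean Q" by (rule pair_mean_nonneg[OF contQ])
  also have "pair_mean Q = (\<Sum>i\<in>{1..N}. \<Sum>j\<in>{1..N}. d i * d j * pair_mean (\<lambda>x y. W (x, i) (y, j) * ?P (x \<bullet> y)))"
    unfolding Q_def[abs_def] pair_mean_cmult[symmetric]
    by (subst pair_mean_sum, intro sphere_kernel_intros cont, assumption+,
        intro sum.cong refl pair_mean_sum sphere_kernel_intros cont)
  also have "\<dots> = ?nu * (\<Sum>i\<in>{1..N}. \<Sum>j\<in>{1..N}. d i * zonal_coeff (\<lambda>x y. W (x, i) (y, j)) k * d j)"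
    unfolding pair_mean_zonal[OF n] sum_distrib_left by (intro sum.cong refl) simp
  finally show "0 \<le> (\<Sum>i\<in>{1..N}. \<Sum>j\<in>{1..N}. d i * zonal_coeff (\<lambda>x y. W (x, i) (y, j)) k * d j)"
    using sphere_poly_norm2_pos[OF n, of k] by (simp add: zero_le_mult_iff)
qed

text \<open>Test with the unit vectors combined as e_i + e_j and e_i - e_j; for i = j only
  nonnegativity of the diagonal is at stake. This lets summability of the diagonal coefficients
  control all others.\<close>

lemma psd_matrix_off_diagonal:
  assumes A: "psd_matrix {1..N} A" and i: "i \<in> {1..N}" and j: "j \<in> {1..(N::nat)}"
  shows "2 * \<bar>A i j\<bar> \<le> A i i + A j j"
proof (cases "i = j")
  case True
  have "0 \<le> (\<Sum>k\<in>{1..N}. \<Sum>l\<in>{1..N}. (if k = i then 1 else 0) * A k l * (if l = i then 1 else 0))"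
    by (rule psd_matrixD[OF A])
  also have "\<dots> = (\<Sum>k\<in>{1..N}. \<Sum>l\<in>{1..N}. if l = i then (if k = i then A k l else 0) else 0)"
    by (intro sum.cong refl) auto
  finally show ?thesis using True i by simp
next
  case False
  have *: "0 \<le> A i i + 2 * s * A i j + A j j" if s: "s * s = 1" for s
  proof -
    define c where "c k = (if k = i then 1 else if k = j then s else 0)" for k
    have "(\<Sum>l\<in>{1..N}. b l * c l) = b i + s * b j" for b :: "nat \<Rightarrow> real"
    proof -
      have "(\<Sum>l\<in>{1..N}. b l * c l) = (\<Sum>l\<in>{1..N}. (if l = i then b i else 0) + (if l = j then s * b j else 0))"
        using False by (intro sum.cong) (auto simp: c_def)
      thus ?thesis using i j by (simp add: sum.distrib)
    qed
    note red = this
    have "0 \<le> (\<Sum>k\<in>{1..N}. \<Sum>l\<in>{1..N}. c k * A k l * c l)"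
      by (rule psd_matrixD[OF A])
    also have "\<dots> = (\<Sum>k\<in>{1..N}. (A k i + s * A k j) * c k)"
    proof (intro sum.cong refl)
      fix k
      show "(\<Sum>l\<in>{1..N}. c k * A k l * c l) = (A k i + s * A k j) * c k"
        unfolding red[of "\<lambda>l. c k * A k l"] by (simp add: algebra_simps)
    qed
    also have "\<dots> = A i i + s * A i j + s * (A j i + s * A j j)"
      by (rule red)
    also have "A j i = A i j" using A i j unfolding psd_matrix_def by blast
    also have "A i i + s * A i j + s * (A i j + s * A j j) = A i i + 2 * s * A i j + (s * s) * A j j"
      by (simp add: algebra_simps)
    finally show ?thesis by (simp add: s)
  qed
  from *[of 1] *[of "-1"] show ?thesis by (simp add: abs_le_iff)
qed

text \<open>Several points may lie on the same sphere, so h need not be injective; the weights of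
  points with equal image are added up.\<close>

lemma psd_matrix_pullback:
  assumes A: "psd_matrix J A" and J: "finite J" and I: "finite I" and h: "\<And>a. a \<in> I \<Longrightarrow> h a \<in> J"
  shows "(\<Sum>a\<in>I. \<Sum>b\<in>I. d a * A (h a) (h b) * d b) \<ge> 0"
proof -
  define U where "U j = (\<Sum>a\<in>{a \<in> I. h a = j}. d a)" for j
  have group: "(\<Sum>a\<in>I. g (h a) * d a) = (\<Sum>j\<in>J. g j * U j)" for g
  proof -
    have "(\<Sum>a\<in>I. g (h a) * d a) = (\<Sum>j\<in>J. \<Sum>a\<in>{a \<in> I. h a = j}. g (h a) * d a)"
      using h by (intro sum.group[symmetric] I J) auto
    thus ?thesis by (simp add: U_def sum_distrib_left)
  qed
  have "(\<Sum>a\<in>I. \<Sum>b\<in>I. d a * A (h a) (h b) * d b) = (\<Sum>a\<in>I. (\<Sum>b\<in>I. A (h a) (h b) * d b) * d a)"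
    by (simp add: sum_distrib_left mult_ac)
  also have "\<dots> = (\<Sum>a\<in>I. (\<Sum>j\<in>J. A (h a) j * U j) * d a)"
    using group[of "A (h a)" for a] by simp
  also have "\<dots> = (\<Sum>i\<in>J. (\<Sum>j\<in>J. A i j * U j) * U i)"
    by (rule group[of "\<lambda>i. \<Sum>j\<in>J. A i j * U j"])
  also have "\<dots> = (\<Sum>i\<in>J. \<Sum>j\<in>J. U i * A i j * U j)"
    by (simp add: sum_distrib_left mult_ac)
  finally show ?thesis using psd_matrixD[OF A, of U] by simp
qed

lemma sphere_series_diff_const:
  assumes n: "DIM('a::euclidean_space) \<ge> 2" and c: "summable (\<lambda>k. \<bar>c k\<bar>)" and u: "- 1 \<le> u" "u \<le> 1"
  shows "(\<lambda>k. (c k - (if k = 0 then w else 0)) * sphere_poly DIM('a) k u) sums (sphere_series DIM('a) c u - w)"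
proof -
  have "(\<lambda>k. c k * sphere_poly DIM('a) k u) sums sphere_series DIM('a) c u"
    unfolding sphere_series_def
    using summable_sphere_series[OF n c u] by (intro summable_sums) (rule summable_rabs_cancel)
  moreover have "(\<lambda>k. if k = 0 then w else 0) sums w" using sums_If_finite[of "\<lambda>k. k = 0" "\<lambda>_. w"] by simp
  ultimately have "(\<lambda>k. c k * sphere_poly DIM('a) k u - (if k = 0 then w else 0)) sums (sphere_series DIM('a) c u - w)"
    by (rule sums_diff)
  moreover have "(\<lambda>k. (c k - (if k = 0 then w else 0)) * sphere_poly DIM('a) k u) =
      (\<lambda>k. c k * sphere_poly DIM('a) k u - (if k = 0 then w else 0))"
    using n by (auto simp: sphere_poly_0)
  ultimately show ?thesis by simp
qed

text \<open>Because P_0 = 1, subtracting the weights alters only the coefficient of degree 0,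
  exactly as in the first semidefiniteness condition. Each degree then contributes a nonnegative
  form by the Schur product, and these contributions sum to the form of the kernel.\<close>

lemma positive_kernel_sphere_series:
  fixes f :: "nat \<Rightarrow> nat \<Rightarrow> nat \<Rightarrow> real"
  assumes n: "DIM('a::euclidean_space) \<ge> 2"
    and sum: "\<And>i j. i \<in> {1..N} \<Longrightarrow> j \<in> {1..N} \<Longrightarrow> summable (\<lambda>k. \<bar>f i j k\<bar>)"
    and sym: "\<And>i j k. i \<in> {1..N} \<Longrightarrow> j \<in> {1..N} \<Longrightarrow> f i j k = f j i k"
    and psd0: "psd_matrix {1..N} (\<lambda>i j. f i j 0 - w i * w j)"
    and psd: "\<And>k. k \<ge> 1 \<Longrightarrow> psd_matrix {1..N} (\<lambda>i j. f i j k)"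
  shows "symmetric_kernel (sphere (0::'a) 1 \<times> {1..N}) (\<lambda>(x, i) (y, j). sphere_series DIM('a) (f i j) (x \<bullet> y))"
    and "positive_kernel (sphere (0::'a) 1 \<times> {1..N})
      (\<lambda>p q. (\<lambda>(x, i) (y, j). sphere_series DIM('a) (f i j) (x \<bullet> y)) p q - w (snd p) * w (snd q))"
proof -
  let ?V = "sphere (0::'a) 1 \<times> {1..N}"
  let ?K = "\<lambda>(x::'a, i) (y, j). sphere_series DIM('a) (f i j) (x \<bullet> y)"
  let ?K' = "\<lambda>p q. ?K p q - w (snd p) * w (snd q)"
  have sym': "?K p q = ?K q p" if "p \<in> ?V" "q \<in> ?V" for p q
  proof -
    have "f (snd p) (snd q) = f (snd q) (snd p)" using that sym by (intro ext) auto
    thus ?thesis by (simp add: case_prod_unfold inner_commute)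
  qed
  have g: "continuous_on {-1..1} (sphere_series DIM('a) (f i j))" if "i \<in> {1..N}" "j \<in> {1..N}" for i j
    by (rule continuous_on_sphere_series[OF n sum[OF that]])
  show K: "symmetric_kernel ?V ?K"
    unfolding symmetric_kernel_def
    by (intro conjI ballI sym' kernel_on_inner[of N "\<lambda>i j. sphere_series DIM('a) (f i j)"] g)
  show "positive_kernel ?V ?K'"
  proof (rule positive_kernelI)
    have "kernel_on ?V (\<lambda>(x, i) (y, j). (\<lambda>i j u. sphere_series DIM('a) (f i j) u - w i * w j) i j (x \<bullet> y))"
      by (rule kernel_on_inner) (intro continuous_intros g)
    hence "kernel_on ?V ?K'" by (simp add: case_prod_unfold)
    moreover have "?K' p q = ?K' q p" if "p \<in> ?V" "q \<in> ?V" for p q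
      using sym'[OF that] by (simp only: mult.commute)
    ultimately show "symmetric_kernel ?V ?K'" unfolding symmetric_kernel_def by blast
    fix I :: "nat set" and p :: "nat \<Rightarrow> 'a \<times> nat" and c
    assume I: "finite I" and p: "\<And>a. a \<in> I \<Longrightarrow> p a \<in> ?V"
    define F where "F i j k = f i j k - (if k = 0 then w i * w j else 0)" for i j k
    have Fpsd: "psd_matrix {1..N} (\<lambda>i j. F i j k)" for k
      using psd0 psd[of k] by (cases "k = 0") (simp_all add: F_def)
    let ?x = "\<lambda>a. fst (p a)" and ?i = "\<lambda>a. snd (p a)"
    have px: "norm (?x a) = 1" "?i a \<in> {1..N}" if "a \<in> I" for a using p[OF that] by auto
    have "(\<lambda>k. \<Sum>a\<in>I. \<Sum>b\<in>I. c a * (F (?i a) (?i b) k * sphere_poly DIM('a) k (?x a \<bullet> ?x b)) * c b) sums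
        (\<Sum>a\<in>I. \<Sum>b\<in>I. c a * ?K' (p a) (p b) * c b)"
    proof (intro sums_sum sums_mult sums_mult2)
      fix a b assume ab: "a \<in> I" "b \<in> I"
      show "(\<lambda>k. F (?i a) (?i b) k * sphere_poly DIM('a) k (?x a \<bullet> ?x b)) sums ?K' (p a) (p b)"
        using sphere_series_diff_const[OF n sum[OF px(2)[OF ab(1)] px(2)[OF ab(2)]],
            of "?x a \<bullet> ?x b" "w (?i a) * w (?i b)"] inner_unit_bounds[OF px(1)[OF ab(1)] px(1)[OF ab(2)]]
        unfolding F_def by (simp add: case_prod_unfold)
    qed
    moreover have "0 \<le> (\<Sum>a\<in>I. \<Sum>b\<in>I. c a * (F (?i a) (?i b) k * sphere_poly DIM('a) k (?x a \<bullet> ?x b)) * c b)" for k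
    proof (rule sphere_poly_schur[OF n])
      show "norm (?x a) = 1" if "a \<in> I" for a by (rule px(1)[OF that])
      show "0 \<le> (\<Sum>a\<in>I. \<Sum>b\<in>I. d a * F (?i a) (?i b) k * d b)" for d
        by (rule psd_matrix_pullback[OF Fpsd _ I px(2)]) simp
    qed
    ultimately show "0 \<le> (\<Sum>a\<in>I. \<Sum>b\<in>I. c a * ?K' (p a) (p b) * c b)"
      by (metis (no_types, lifting) sums_le sums_zero)
  qed
qed

section \<open>The value at 1, the constant term, the diagonal and level sets\<close>

lemma sphere_series_1:
  "n \<ge> 2 \<Longrightarrow> sphere_series n c 1 = (\<Sum>k. c k)"
  by (simp add: sphere_series_def sphere_poly_1)

lemma zonal_coeff_diff_const:
  fixes Q :: "'a::euclidean_space \<Rightarrow> 'a \<Rightarrow> real"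
  assumes n: "DIM('a) \<ge> 2" and Q: "sphere_kernel Q"
  shows "zonal_coeff (\<lambda>x y. Q x y - c) 0 = zonal_coeff Q 0 - c"
proof -
  let ?P = "sphere_poly DIM('a) 0"
  have "pair_mean (\<lambda>x y. (Q x y - c) * ?P (x \<bullet> y)) =
      pair_mean (\<lambda>x y. Q x y * ?P (x \<bullet> y) - c * (?P (x \<bullet> y) * ?P (x \<bullet> y)))"
    using n by (simp add: sphere_poly_0)
  also have "\<dots> = pair_mean (\<lambda>x y. Q x y * ?P (x \<bullet> y)) - pair_mean (\<lambda>x y :: 'a. c * (?P (x \<bullet> y) * ?P (x \<bullet> y)))"
    by (intro pair_mean_diff sphere_kernel_intros Q)
  also have "pair_mean (\<lambda>x y :: 'a. c * (?P (x \<bullet> y) * ?P (x \<bullet> y))) = c * sphere_poly_norm2 TYPE('a) 0"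
    unfolding pair_mean_cmult by (simp add: pair_mean_orthogonal[OF n])
  finally show ?thesis
    using sphere_poly_norm2_pos[OF n, of 0] by (simp add: zonal_coeff_def diff_divide_distrib)
qed

text \<open>
  The sphere has no isolated points, so a sign condition on pairs of distinct points extends
  to the diagonal.
\<close>

lemma sphere_kernel_diagonal_nonpos:
  fixes Q :: "'a::euclidean_space \<Rightarrow> 'a \<Rightarrow> real"
  assumes n: "DIM('a) \<ge> 2" and Q: "sphere_kernel Q" and x: "norm x = 1"
    and neg: "\<And>y. norm y = 1 \<Longrightarrow> y \<noteq> x \<Longrightarrow> Q x y \<le> 0"
  shows "Q x x \<le> 0"
proof -
  obtain w where w: "orthonormal_pair x w" using orthonormal_pair_exists[OF n x] .
  \<comment> \<open>A great circle through x: it leaves x at t = 0 and avoids it for 0 < t < pi, so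
    letting t tend to 0 from the right reaches the diagonal.\<close>
  define y where "y t = cos t *\<^sub>R x + sin t *\<^sub>R w" for t
  have e: "x \<bullet> x = 1" "w \<bullet> w = 1" "x \<bullet> w = 0" "w \<bullet> x = 0"
    using w by (auto simp: orthonormal_pair_def norm_eq_1 inner_commute)
  have y1: "norm (y t) = 1" for t
    unfolding norm_eq_1 y_def by (simp add: inner_add_left inner_add_right e power2_eq_square[symmetric])
  have yc: "continuous_on UNIV y" unfolding y_def[abs_def] by (intro continuous_intros)
  have "continuous_on UNIV (\<lambda>t. Q (fst (x, y t)) (snd (x, y t)))"
    by (rule continuous_on_compose2[OF Q[unfolded sphere_kernel_def], of UNIV "\<lambda>t. (x, y t)"])
       (use x y1 yc in \<open>auto intro!: continuous_intros\<close>)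
  hence "isCont (\<lambda>t. Q x (y t)) 0" by (simp add: continuous_on_eq_continuous_at)
  hence "((\<lambda>t. Q x (y t)) \<longlongrightarrow> Q x (y 0)) (at_right 0)"
    unfolding isCont_def by (rule filterlim_at_split[THEN iffD1, THEN conjunct2])
  moreover have "\<forall>\<^sub>F t in at_right 0. Q x (y t) \<le> 0"
  proof (rule eventually_at_rightI[of 0 pi])
    fix t :: real assume t: "t \<in> {0<..<pi}"
    have "x \<bullet> y t = cos t" by (simp add: y_def inner_add_right e)
    moreover have "cos t < cos 0" using t by (intro cos_monotone_0_pi) auto
    ultimately have "y t \<noteq> x" using e(1) by auto
    thus "Q x (y t) \<le> 0" by (intro neg y1)
  qed simp
  ultimately have "Q x (y 0) \<le> 0" by (rule tendsto_upperbound) simp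
  thus ?thesis by (simp add: y_def)
qed

text \<open>The pairs with \<open>Q\<close> at least \<open>\<eta>\<close> form a compact set. Its
  image under the inner product is closed and misses u, hence misses a neighbourhood of u.\<close>

lemma sphere_kernel_near_level:
  fixes Q :: "'a::euclidean_space \<Rightarrow> 'a \<Rightarrow> real"
  assumes Q: "sphere_kernel Q" and \<eta>: "\<eta> > 0"
    and neg: "\<And>x y. norm x = 1 \<Longrightarrow> norm y = 1 \<Longrightarrow> x \<bullet> y = u \<Longrightarrow> Q x y \<le> 0"
  shows "\<exists>\<delta>>0. \<forall>x y. norm x = 1 \<longrightarrow> norm y = 1 \<longrightarrow> \<bar>x \<bullet> y - u\<bar> < \<delta> \<longrightarrow> Q x y \<le> \<eta>"
proof -
  let ?S = "sphere 0 1 \<times> sphere 0 1 :: ('a \<times> 'a) set"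
  define C where "C = ?S \<inter> (\<lambda>p. Q (fst p) (snd p)) -` {\<eta>..}"
  have S: "compact ?S" by (intro compact_Times) auto
  have "closed C" unfolding C_def
    by (rule continuous_closed_preimage[OF Q[unfolded sphere_kernel_def] compact_imp_closed[OF S] closed_atLeast])
  from compact_Int_closed[OF S this] have "compact C" by (simp add: C_def)
  hence "closed ((\<lambda>p. fst p \<bullet> snd p) ` C)"
    by (intro compact_imp_closed compact_continuous_image continuous_intros)
  hence "open (- ((\<lambda>p. fst p \<bullet> snd p) ` C))" by (rule open_Compl)
  moreover have "u \<in> - ((\<lambda>p. fst p \<bullet> snd p) ` C)"
  proof
    assume "u \<in> (\<lambda>p. fst p \<bullet> snd p) ` C"
    then obtain x y where "(x, y) \<in> C" "u = x \<bullet> y" by auto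
    thus False using neg[of x y] \<eta> by (simp add: C_def)
  qed
  ultimately obtain \<delta> where \<delta>: "\<delta> > 0" "ball u \<delta> \<subseteq> - (\<lambda>p. fst p \<bullet> snd p) ` C"
    unfolding open_contains_ball by blast
  have "Q x y \<le> \<eta>" if "norm x = 1" "norm y = 1" "\<bar>x \<bullet> y - u\<bar> < \<delta>" for x y
  proof (rule ccontr)
    assume "\<not> Q x y \<le> \<eta>"
    hence "(x, y) \<in> C" using that by (simp add: C_def)
    moreover have "x \<bullet> y \<in> ball u \<delta>" using that by (simp add: dist_real_def abs_minus_commute)
    ultimately show False using \<delta>(2) by force
  qed
  thus ?thesis using \<delta>(1) by blast
qed

subsection \<open>The two directions\<close>

definition theta_feasible ::
    "'a::topological_space set \<Rightarrow> 'a set set \<Rightarrow> ('a \<Rightarrow> real) \<Rightarrow> real \<Rightarrow> ('a \<Rightarrow> 'a \<Rightarrow> real) \<Rightarrow> bool" where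
  "theta_feasible V E w M K \<longleftrightarrow> symmetric_kernel V K \<and>
     positive_kernel V (\<lambda>x y. K x y - sqrt (w x) * sqrt (w y)) \<and>
     (\<forall>x\<in>V. K x x \<le> M) \<and>
     (\<forall>x\<in>V. \<forall>y\<in>V. x \<noteq> y \<and> {x, y} \<notin> E \<longrightarrow> K x y \<le> 0)"

lemma psd_matrix_cong:
  assumes "\<And>i j. i \<in> I \<Longrightarrow> j \<in> I \<Longrightarrow> A i j = B i j"
  shows "psd_matrix I A \<longleftrightarrow> psd_matrix I B"
  unfolding psd_matrix_def using assms by (simp cong: sum.cong)

text \<open>Edges are unordered, so the pair is recovered only up to exchange; the inequality is
  invariant under this exchange.\<close>

lemma cap_edges_iff:
  fixes x y :: "real ^ 'n::finite"
  assumes "norm x = 1" "norm y = 1" "i \<in> {1..N}" "j \<in> {1..N}" "(x, i) \<noteq> (y, j)"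
  shows "{(x, i), (y, j)} \<in> cap_edges N \<alpha> \<longleftrightarrow> cos (\<alpha> i + \<alpha> j) < x \<bullet> y"
proof
  assume "{(x, i), (y, j)} \<in> cap_edges N \<alpha>"
  then obtain x' i' y' j' where e: "{(x, i), (y, j)} = {(x', i'), (y', j')}"
      "cos (\<alpha> i' + \<alpha> j') < x' \<bullet> y'"
    unfolding cap_edges_def by blast
  from e(1) consider "x = x'" "i = i'" "y = y'" "j = j'" | "x = y'" "i = j'" "y = x'" "j = i'"
    unfolding doubleton_eq_iff by auto
  thus "cos (\<alpha> i + \<alpha> j) < x \<bullet> y"
    by cases (use e(2) in \<open>simp_all add: inner_commute add.commute\<close>)
next
  assume c: "cos (\<alpha> i + \<alpha> j) < x \<bullet> y"
  have "(x, i) \<in> cap_vertices N" "(y, j) \<in> cap_vertices N"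
    using assms by (simp_all add: cap_vertices_def)
  with c assms(5) show "{(x, i), (y, j)} \<in> cap_edges N \<alpha>" unfolding cap_edges_def by blast
qed

text \<open>The diagonal of the kernel takes only the values f_ii(1), whence M is their maximum.
  Nonadjacency of distinct vertices means that x . y lies in the range of the sign
  condition.\<close>

lemma cap_feasible_imp_theta_feasible:
  assumes n: "CARD('n::finite) \<ge> 2" and f: "cap_feasible CARD('n) N \<alpha> f"
  shows "\<exists>K. theta_feasible (cap_vertices N :: ((real ^ 'n) \<times> nat) set) (cap_edges N \<alpha>) (cap_weight \<alpha>)
    (Max ((\<lambda>i. sphere_series CARD('n) (f i i) 1) ` {1..N})) K"
proof -
  let ?n = "CARD('n)"
  let ?V = "cap_vertices N :: ((real ^ 'n) \<times> nat) set"
  define w where "w i = sqrt (cap_volume ?n (\<alpha> i))" for i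
  have D: "DIM(real ^ 'n) = ?n" by simp
  have n': "DIM(real ^ 'n) \<ge> 2" using n by simp
  let ?K = "\<lambda>(x :: real ^ 'n, i) (y, j). sphere_series ?n (f i j) (x \<bullet> y)"
  have sum: "summable (\<lambda>k. \<bar>f i j k\<bar>)" and sym: "f i j k = f j i k"
    and neg: "- 1 \<le> u \<Longrightarrow> u \<le> cos (\<alpha> i + \<alpha> j) \<Longrightarrow> sphere_series ?n (f i j) u \<le> 0"
    if "i \<in> {1..N}" "j \<in> {1..N}" for i j k u
    using f that unfolding cap_feasible_def by blast+
  have psd0: "psd_matrix {1..N} (\<lambda>i j. f i j 0 - w i * w j)"
    and psd: "k \<ge> 1 \<Longrightarrow> psd_matrix {1..N} (\<lambda>i j. f i j k)" for k
    using f unfolding cap_feasible_def w_def by blast+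
  note K = positive_kernel_sphere_series[OF n' sum sym psd0 psd, unfolded D, folded cap_vertices_def]
  have "theta_feasible ?V (cap_edges N \<alpha>) (cap_weight \<alpha>)
      (Max ((\<lambda>i. sphere_series ?n (f i i) 1) ` {1..N})) ?K"
    unfolding theta_feasible_def
  proof (intro conjI ballI impI)
    show "symmetric_kernel ?V ?K" by (rule K(1))
    have "(\<lambda>p. sqrt (cap_weight \<alpha> p)) = (\<lambda>p :: (real ^ 'n) \<times> nat. w (snd p))"
      by (auto simp: cap_weight_def w_def)
    hence "sqrt (cap_weight \<alpha> p) = w (snd p)" for p :: "(real ^ 'n) \<times> nat" by metis
    thus "positive_kernel ?V (\<lambda>p q. ?K p q - sqrt (cap_weight \<alpha> p) * sqrt (cap_weight \<alpha> q))"
      using K(2) by (simp only:)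
  next
    fix p :: "(real ^ 'n) \<times> nat" assume "p \<in> ?V"
    then obtain x i where p: "p = (x, i)" "norm x = 1" "i \<in> {1..N}" by (auto simp: cap_vertices_def)
    have "x \<bullet> x = 1" using p(2) by (simp add: norm_eq_1)
    thus "?K p p \<le> Max ((\<lambda>i. sphere_series ?n (f i i) 1) ` {1..N})"
      using p(3) by (auto simp: p(1) intro: Max_ge)
  next
    fix p q :: "(real ^ 'n) \<times> nat"
    assume pq: "p \<in> ?V" "q \<in> ?V" "p \<noteq> q \<and> {p, q} \<notin> cap_edges N \<alpha>"
    obtain x i where p: "p = (x, i)" "norm x = 1" "i \<in> {1..N}" using pq(1) by (auto simp: cap_vertices_def)
    obtain y j where q: "q = (y, j)" "norm y = 1" "j \<in> {1..N}" using pq(2) by (auto simp: cap_vertices_def)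
    have "x \<bullet> y \<le> cos (\<alpha> i + \<alpha> j)"
      using cap_edges_iff[OF p(2) q(2) p(3) q(3), of \<alpha>] pq(3) unfolding p(1) q(1) by auto
    thus "?K p q \<le> 0"
      using neg[OF p(3) q(3), of "x \<bullet> y"] inner_unit_bounds[OF p(2) q(2)] by (simp add: p(1) q(1))
  qed
  thus ?thesis by blast
qed

text \<open>The witness consists of the zonal coefficients of the blocks of \<open>K\<close>.
  Bounded partial sums on the diagonal give both summability and the bound on the maximum.\<close>

lemma theta_feasible_imp_cap_feasible:
  assumes n: "CARD('n::finite) \<ge> 2" and N: "N \<ge> 1"
    and K: "theta_feasible (cap_vertices N :: ((real ^ 'n) \<times> nat) set) (cap_edges N \<alpha>) (cap_weight \<alpha>) M K"
  shows "\<exists>f. cap_feasible CARD('n) N \<alpha> f \<and> Max ((\<lambda>i. sphere_series CARD('n) (f i i) 1) ` {1..N}) \<le> M"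
proof -
  let ?n = "CARD('n)"
  define V where "V = sphere (0 :: real ^ 'n) 1 \<times> {1..N}"
  have V: "cap_vertices N = V" by (simp add: V_def cap_vertices_def)
  have D: "DIM(real ^ 'n) = ?n" by simp
  have n': "DIM(real ^ 'n) \<ge> 2" using n by simp
  define w where "w i = sqrt (cap_volume ?n (\<alpha> i))" for i
  have w: "sqrt (cap_weight \<alpha> p) = w (snd p)" for p :: "(real ^ 'n) \<times> nat"
    by (simp add: cap_weight_def w_def case_prod_unfold)
  have sym: "symmetric_kernel V K" and W: "positive_kernel V (\<lambda>p q. K p q - w (snd p) * w (snd q))"
    and KM: "\<And>p. p \<in> V \<Longrightarrow> K p p \<le> M"
    and neg: "\<And>p q. p \<in> V \<Longrightarrow> q \<in> V \<Longrightarrow> p \<noteq> q \<Longrightarrow> {p, q} \<notin> cap_edges N \<alpha> \<Longrightarrow> K p q \<le> 0"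
    using K unfolding theta_feasible_def V w by blast+
  \<comment> \<open>Adding back the weights adds a rank-one form, which is a square.\<close>
  have Kpos: "positive_kernel V K"
  proof (rule positive_kernelI[OF sym])
    fix I :: "nat set" and p c assume I: "finite I" and p: "\<And>i. i \<in> I \<Longrightarrow> p i \<in> V"
    have "(\<Sum>i\<in>I. \<Sum>j\<in>I. c i * K (p i) (p j) * c j) =
        (\<Sum>i\<in>I. \<Sum>j\<in>I. c i * (K (p i) (p j) - w (snd (p i)) * w (snd (p j))) * c j) +
        (\<Sum>i\<in>I. c i * w (snd (p i))) * (\<Sum>j\<in>I. c j * w (snd (p j)))"
      unfolding sum_product sum.distrib[symmetric]
      by (intro sum.cong refl) (simp add: algebra_simps)
    moreover have "0 \<le> (\<Sum>i\<in>I. \<Sum>j\<in>I. c i * (K (p i) (p j) - w (snd (p i)) * w (snd (p j))) * c j)"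
      by (rule positive_kernel_finite[OF W I p])
    ultimately show "0 \<le> (\<Sum>i\<in>I. \<Sum>j\<in>I. c i * K (p i) (p j) * c j)" by simp
  qed
  have cont: "sphere_kernel (\<lambda>x y. K (x, i) (y, j))" if "i \<in> {1..N}" "j \<in> {1..N}" for i j
    using sym that unfolding symmetric_kernel_def V_def by (intro kernel_on_component) auto
  define f where "f i j = zonal_coeff (\<lambda>x y. K (x, i) (y, j))" for i j
  have psd: "psd_matrix {1..N} (\<lambda>i j. f i j k)" for k
    unfolding f_def by (rule zonal_coeff_psd[OF n' Kpos[unfolded V_def]])
  have diag: "f i i k \<ge> 0" "(\<Sum>k<L. f i i k) \<le> M" if i: "i \<in> {1..N}" for i k L
  proof -
    have psdK: "psd_on_sphere (\<lambda>x y. K (x, i) (y, i))"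
      unfolding psd_on_sphere_def
    proof (intro allI impI)
      fix I :: "(real ^ 'n) set" and c assume I: "finite I" "I \<subseteq> sphere 0 1"
      show "0 \<le> (\<Sum>x\<in>I. \<Sum>y\<in>I. c x * K (x, i) (y, i) * c y)"
        by (rule positive_kernel_finite[OF Kpos I(1), of "\<lambda>x. (x, i)"]) (use I(2) i in \<open>auto simp: V_def\<close>)
    qed
    have symK: "K (x, i) (y, i) = K (y, i) (x, i)" if "norm x = 1" "norm y = 1" for x y
      using sym that i unfolding symmetric_kernel_def V_def by simp
    have "K (x, i) (x, i) \<le> M" if "norm x = 1" for x
      using KM[of "(x, i)"] that i by (simp add: V_def)
    from zonal_coeff_sum_le[OF n' cont[OF i i] psdK symK this]
    show "f i i k \<ge> 0" "(\<Sum>k<L. f i i k) \<le> M" unfolding f_def by blast+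
  qed
  have sum_diag: "summable (f i i)" if "i \<in> {1..N}" for i
    by (rule summableI_nonneg_bounded[OF diag[OF that]])
  have sum: "summable (\<lambda>k. \<bar>f i j k\<bar>)" if ij: "i \<in> {1..N}" "j \<in> {1..N}" for i j
  proof (rule summable_comparison_test_ev[OF always_eventually], rule allI)
    show "norm \<bar>f i j k\<bar> \<le> f i i k + f j j k" for k
      using psd_matrix_off_diagonal[OF psd ij, of k] diag(1)[OF ij(1), of k] diag(1)[OF ij(2), of k]
      by simp
    show "summable (\<lambda>k. f i i k + f j j k)" by (intro summable_add sum_diag ij)
  qed
  have "cap_feasible ?n N \<alpha> f"
    unfolding cap_feasible_def
  proof (intro conjI ballI allI impI)
    fix i j assume ij: "i \<in> {1..N}" "j \<in> {1..N}"
    show "f i j k = f j i k" for k using psd[of k] ij unfolding psd_matrix_def by blast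
    show "summable (\<lambda>k. \<bar>f i j k\<bar>)" by (rule sum[OF ij])
    fix u :: real assume u: "- 1 \<le> u \<and> u \<le> cos (\<alpha> i + \<alpha> j)"
    hence u1: "u \<le> 1" using cos_le_one[of "\<alpha> i + \<alpha> j"] by linarith
    have off: "K (x, i) (y, j) \<le> 0"
      if "norm x = 1" "norm y = 1" "(x, i) \<noteq> (y, j)" "x \<bullet> y \<le> cos (\<alpha> i + \<alpha> j)" for x y
      using cap_edges_iff[OF that(1,2) ij that(3), of \<alpha>] that ij by (intro neg) (auto simp: V_def)
    \<comment> \<open>The graph says nothing about a vertex paired with itself, yet the sign
      condition reaches u = 1 when cos (\<open>\<alpha> i + \<alpha> j\<close>) = 1. For i = j this
      concerns the diagonal; all other pairs on that sphere are then nonadjacent, and continuity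
      closes the gap.\<close>
    have level: "K (x, i) (y, j) \<le> 0" if xy: "norm x = 1" "norm y = 1" "x \<bullet> y = u" for x y
    proof (cases "(x, i) = (y, j)")
      case False
      thus ?thesis using xy u by (intro off) auto
    next
      case True
      hence c: "cos (\<alpha> i + \<alpha> j) \<ge> 1" using xy u by (simp add: norm_eq_1)
      have "K (x, i) (x, j) \<le> 0"
      proof (rule sphere_kernel_diagonal_nonpos[OF n' cont[OF ij] xy(1)])
        fix z :: "real ^ 'n" assume "norm z = 1" "z \<noteq> x"
        thus "K (x, i) (z, j) \<le> 0" using xy(1) c inner_unit_bounds[of x z] by (intro off) auto
      qed
      thus ?thesis using True by simp
    qed
    have "sphere_series DIM(real ^ 'n) (f i j) u \<le> 0"
      unfolding f_def
    proof (rule sphere_series_zonal_coeff_nonpos[OF n' cont[OF ij]])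
      show "summable (\<lambda>k. \<bar>zonal_coeff (\<lambda>x y. K (x, i) (y, j)) k\<bar>)"
        using sum[OF ij] unfolding f_def .
      show "- 1 \<le> u" "u \<le> 1" using u u1 by blast+
      show "\<exists>\<delta>>0. \<forall>x y. norm x = 1 \<longrightarrow> norm y = 1 \<longrightarrow> \<bar>x \<bullet> y - u\<bar> < \<delta> \<longrightarrow> K (x, i) (y, j) \<le> \<eta>"
        if "\<eta> > 0" for \<eta>
        by (rule sphere_kernel_near_level[OF cont[OF ij] that level])
    qed
    thus "sphere_series ?n (f i j) u \<le> 0" unfolding D .
  next
    \<comment> \<open>Positivity of the kernel minus weights is used only in degree 0, where the
      constant shows; for k >= 1 positivity of \<open>K\<close> gives the matrices directly.\<close>
    have eq: "zonal_coeff (\<lambda>x y. K (x, i) (y, j) - w i * w j) 0 = f i j 0 - w i * w j"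
      if "i \<in> {1..N}" "j \<in> {1..N}" for i j
      unfolding f_def by (rule zonal_coeff_diff_const[OF n' cont[OF that]])
    have "psd_matrix {1..N} (\<lambda>i j. zonal_coeff (\<lambda>x y. K (x, i) (y, j) - w i * w j) 0)"
      using zonal_coeff_psd[OF n' W[unfolded V_def], of 0] unfolding snd_conv .
    thus "psd_matrix {1..N} (\<lambda>i j. f i j 0 - sqrt (cap_volume ?n (\<alpha> i)) * sqrt (cap_volume ?n (\<alpha> j)))"
      unfolding w_def[symmetric] by (rule psd_matrix_cong[THEN iffD1, rotated]) (rule eq)
  qed (rule psd)
  moreover have "sphere_series ?n (f i i) 1 \<le> M" if "i \<in> {1..N}" for i
    unfolding sphere_series_1[OF n]
    by (rule suminf_le_const[OF sum_diag[OF that] diag(2)[OF that]])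
  hence "Max ((\<lambda>i. sphere_series ?n (f i i) 1) ` {1..N}) \<le> M"
    using N by (intro Max.boundedI) auto
  ultimately show ?thesis by blast
qed

theorem mainTheorem4:
  fixes N :: nat and \<alpha> :: "nat \<Rightarrow> real"
  assumes "CARD('n::finite) \<ge> 2" and "N \<ge> 1"
    and "\<And>i. i \<in> {1..N} \<Longrightarrow> 0 < \<alpha> i \<and> \<alpha> i \<le> pi"
  shows "weighted_theta_prime (cap_vertices N :: ((real ^ 'n) \<times> nat) set)
           (cap_edges N \<alpha>) (cap_weight \<alpha>) =
         Inf {ereal (Max ((\<lambda>i. sphere_series CARD('n) (f i i) 1) ` {1..N})) | f.
           cap_feasible CARD('n) N \<alpha> f}"
proof (rule antisym)
  let ?V = "cap_vertices N :: ((real ^ 'n) \<times> nat) set"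
  let ?val = "\<lambda>f. ereal (Max ((\<lambda>i. sphere_series CARD('n) (f i i) 1) ` {1..N}))"
  have theta: "weighted_theta_prime ?V (cap_edges N \<alpha>) (cap_weight \<alpha>) =
      Inf {ereal M | M. \<exists>K. theta_feasible ?V (cap_edges N \<alpha>) (cap_weight \<alpha>) M K}"
    unfolding weighted_theta_prime_def theta_feasible_def ..
  show "weighted_theta_prime ?V (cap_edges N \<alpha>) (cap_weight \<alpha>) \<le>
      Inf {?val f | f. cap_feasible CARD('n) N \<alpha> f}"
    unfolding theta using cap_feasible_imp_theta_feasible[OF assms(1)]
    by (intro Inf_superset_mono) blast
  \<comment> \<open>A feasible bound M need not itself be a value of the second problem; it suffices
    that some value lies below it.\<close>
  show "Inf {?val f | f. cap_feasible CARD('n) N \<alpha> f} \<le>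
      weighted_theta_prime ?V (cap_edges N \<alpha>) (cap_weight \<alpha>)"
    unfolding theta
  proof (rule Inf_mono)
    fix b assume "b \<in> {ereal M | M. \<exists>K. theta_feasible ?V (cap_edges N \<alpha>) (cap_weight \<alpha>) M K}"
    then obtain M K where b: "b = ereal M" "theta_feasible ?V (cap_edges N \<alpha>) (cap_weight \<alpha>) M K"
      by blast
    from theta_feasible_imp_cap_feasible[OF assms(1,2) b(2)]
    obtain f where f: "cap_feasible CARD('n) N \<alpha> f"
      "Max ((\<lambda>i. sphere_series CARD('n) (f i i) 1) ` {1..N}) \<le> M" by blast
    have "?val f \<le> b" using f(2) unfolding b(1) by (simp only: ereal_less_eq)
    with f(1) show "\<exists>a\<in>{?val f | f. cap_feasible CARD('n) N \<alpha> f}. a \<le> b" by blast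
  qed
qed

end
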